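(* Let $M$ be a smooth manifold and let $\varpi\in\Omega^{1,1}_{\Delta_M}(M\mid M)$ be a contrast bi-form on $M$, with induced metric $g^\varpi$ and induced affine connection $\nabla^\varpi$. (i) If $\varpi$ is left-exact, i.e. there is $S\in\Omega^{0,1}(M\mid M)$ such that $\varpi=\mathrm d^LS$, then $(M,g^\varpi,\nabla^\varpi)$ is a statistical manifold admitting torsion (SMAT). (ii) Conversely, if $(M,g^\varpi,\nabla^\varpi)$ is a SMAT, then there is $S\in\Omega^{0,1}(M\mid M)$ such that $\varpi$ and $\mathrm d^LS$ induce the same pseudo-Riemannian metric and the same affine connection, i.e. $\mathrm d^LS$ is a contrast bi-form with $g^{\mathrm d^LS}=g^\varpi$ and $\nabla^{\mathrm d^LS}=\nabla^\varpi$. Moreover, $S$ can be chosen in such a way that $\iota^\ast S=0$.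
   Context: Let $M$ be a smooth manifold, $\pi_L,\pi_R\colon M\times M\to M$ the projections $\pi_L(m,n)=m$, $\pi_R(m,n)=n$, and $\iota\colon M\to M\times M$, $\iota(m)=(m,m)$ the diagonal embedding with image $\Delta_M$. Bi-forms: for $p,q\in\mathbb N_0$, a $(p,q)$-bi-form on $M$ is a smooth section of the vector bundle $\bigwedge^p\pi_L^\ast T^\vee M\otimes\bigwedge^q\pi_R^\ast T^\vee M$ over $M\times M$, where $T^\vee M$ is the cotangent bundle. The space of these is $\Omega^{p,q}(M\mid M)$. $\Omega^{p,q}_{\Delta_M}(M\mid M)$ denotes the space of $(p,q)$-bi-forms defined on an open neighborhood of $\Delta_M$ in $M\times M$; all operations below are local and apply to it as well, and an equality between such a bi-form and a globally defined one is understood on the domain of the former. For vector fields $X_1,\dots,X_p,Y_1,\dots,Y_q$ on $M$, one gets a smooth function $\varpi(X_1,\dots,X_p\mid Y_1,\dots,Y_q)(m,n)=\varpi(X_1(m),\dots,X_p(m)\mid Y_1(n),\dots,Y_q(n))$ on the domain of $\varpi$. Operators: (1) $\iota^\ast\varpi$ is the covariant tensor on $M$, i.e. the element of $\Omega^p(M)\otimes_{C^\infty(M)}\Omega^q(M)$, given by $(\iota^\ast\varpi)(Z_1,\dots,Z_{p+q})=\iota^\ast\big(\varpi(Z_1,\dots,Z_p\mid Z_{p+1},\dots,Z_{p+q})\big)$. (2) For a vector field $X$ on $M$, its $\pi_L$-horizontal lift $X^L$ is the vector field $X^L(m,n)=(X(m),0)$ on $M\times M$. The left differential $\mathrm d^L$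 maps $(p,q)$-bi-forms to $(p+1,q)$-bi-forms by $$\mathrm d^L\varpi(X_0,\dots,X_p\mid Y_1,\dots,Y_q)=\sum_{i=0}^p(-1)^i\mathcal L_{X_i^L}\big(\varpi(X_0,\dots,\check X_i,\dots,X_p\mid Y_1,\dots,Y_q)\big)+\sum_{0\le a<b\le p}(-1)^{a+b}\varpi([X_a,X_b],X_0,\dots,\check X_a,\dots,\check X_b,\dots,X_p\mid Y_1,\dots,Y_q),$$ where a check denotes omission. In particular, for $S\in\Omega^{0,1}(M\mid M)$, $(\mathrm d^LS)(X\mid Y)=\mathcal L_{X^L}\big(S(\,\mid Y)\big)$. Contrast bi-forms: a contrast bi-form on $M$ is an element $\varpi\in\Omega^{1,1}_{\Delta_M}(M\mid M)$ such that $g^\varpi:=\iota^\ast\varpi$ is a pseudo-Riemannian metric on $M$. Its induced affine connection $\nabla^\varpi$ is defined by $g^\varpi(\nabla^\varpi_ZX,Y)=\iota^\ast\big(\mathcal L_{Z^L}(\varpi(X\mid Y))\big)$ for all vector fields $X,Y,Z$ on $M$. SMAT: a statistical manifold admitting torsion (SMAT) is a triple $(M,g,\nabla)$ with $g$ a pseudo-Riemannian metric on $M$ and $\nabla$ a torsion-free affine connection on $M$; its $g$-conjugate connection $\nabla^\dagger$, defined by $Z(g(X,Y))=g(\nabla_ZX,Y)+g(X,\nabla^\dagger_ZY)$, is allowed to have torsion. *)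

theory Defs
  imports "HOL-Analysis.Analysis"
begin

section \<open>Smooth maps between open subsets of normed spaces\<close>

text \<open>
  For \<open>S\<close> open in a finite-dimensional space, \<open>Ck_on k S f\<close> says that all iterated directional
  derivatives of \<open>f\<close> of order at most \<open>k\<close> exist on \<open>S\<close> and are continuous there.  Values of \<open>f\<close>
  outside \<open>S\<close> are irrelevant.
\<close>

primrec Ck_on :: "nat \<Rightarrow> 'a::real_normed_vector set \<Rightarrow> ('a \<Rightarrow> 'b::real_normed_vector) \<Rightarrow> bool" where
  "Ck_on 0 S f \<longleftrightarrow> continuous_on S f"
| "Ck_on (Suc k) S f \<longleftrightarrow>
     (\<forall>x\<in>S. f differentiable (at x)) \<and> (\<forall>v. Ck_on k S (\<lambda>x. frechet_derivative f (at x) v))"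

definition smooth_on :: "'a::real_normed_vector set \<Rightarrow> ('a \<Rightarrow> 'b::real_normed_vector) \<Rightarrow> bool" where
  "smooth_on S f \<longleftrightarrow> (\<forall>k. Ck_on k S f)"


section \<open>Smooth manifolds\<close>

text \<open>
  A chart is a pair \<open>(U, \<phi>)\<close> of an open set and a coordinate map; values of \<open>\<phi>\<close> outside \<open>U\<close> are
  irrelevant.  The points of the manifold are the elements of the type \<open>'m\<close>; a smooth structure is
  given by any (not necessarily maximal) smooth atlas.
\<close>

type_synonym ('m, 'e) chart = "'m set \<times> ('m \<Rightarrow> 'e)"

abbreviation chart_dom :: "('m, 'e) chart \<Rightarrow> 'm set" where
  "chart_dom \<equiv> fst"

abbreviation chart_map :: "('m, 'e) chart \<Rightarrow> 'm \<Rightarrow> 'e" where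
  "chart_map \<equiv> snd"

definition chart_inv :: "('m, 'e) chart \<Rightarrow> 'e \<Rightarrow> 'm" where
  "chart_inv c = inv_into (chart_dom c) (chart_map c)"

definition transition :: "('m, 'e) chart \<Rightarrow> ('m, 'e) chart \<Rightarrow> 'e \<Rightarrow> 'e" where
  "transition c d = chart_map d \<circ> chart_inv c"

definition topological_chart ::
    "('m::topological_space, 'e::topological_space) chart \<Rightarrow> bool" where
  "topological_chart c \<longleftrightarrow>
     open (chart_dom c) \<and> open (chart_map c ` chart_dom c) \<and>
     homeomorphism (chart_dom c) (chart_map c ` chart_dom c) (chart_map c) (chart_inv c)"

text \<open>
  The model space \<open>'e\<close> is a finite-dimensional inner product space.  The class
  \<open>euclidean_space\<close> is avoided only because it excludes dimension \<open>0\<close>.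
\<close>

definition smooth_manifold ::
    "('m::{t2_space, second_countable_topology}, 'e::real_inner) chart set \<Rightarrow> bool" where
  "smooth_manifold A \<longleftrightarrow>
     (\<exists>B. finite B \<and> span B = (UNIV :: 'e set)) \<and>
     (\<forall>c\<in>A. topological_chart c) \<and>
     (\<Union>c\<in>A. chart_dom c) = UNIV \<and>
     (\<forall>c\<in>A. \<forall>d\<in>A. smooth_on (chart_map c ` (chart_dom c \<inter> chart_dom d)) (transition c d))"

definition charts_at :: "('m, 'e) chart set \<Rightarrow> 'm \<Rightarrow> ('m, 'e) chart set" where
  "charts_at A p = {c \<in> A. p \<in> chart_dom c}"

definition smooth_fun ::
    "('m, 'e::real_normed_vector) chart set \<Rightarrow> 'm set \<Rightarrow> ('m \<Rightarrow> real) \<Rightarrow> bool" where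
  "smooth_fun A W f \<longleftrightarrow>
     (\<forall>c\<in>A. smooth_on (chart_map c ` (chart_dom c \<inter> W)) (f \<circ> chart_inv c))"

definition prod_atlas ::
    "('m, 'e) chart set \<Rightarrow> ('n, 'f) chart set \<Rightarrow> ('m \<times> 'n, 'e \<times> 'f) chart set" where
  "prod_atlas A B =
     {(chart_dom c \<times> chart_dom d, map_prod (chart_map c) (chart_map d)) | c d. c \<in> A \<and> d \<in> B}"


section \<open>Tangent vectors and vector fields\<close>

text \<open>
  A tangent vector at \<open>p\<close> is a family of coordinate vectors, one for each chart around \<open>p\<close>, that
  transforms by the differentials of the transition maps.  The family is \<open>0\<close> at the remaining
  charts, so that equality of tangent vectors is equality of functions.
\<close>

type_synonym ('m, 'e) tv = "('m, 'e) chart \<Rightarrow> 'e"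
type_synonym ('m, 'e) vfield = "'m \<Rightarrow> ('m, 'e) tv"

definition tangent_space ::
    "('m, 'e::real_normed_vector) chart set \<Rightarrow> 'm \<Rightarrow> ('m, 'e) tv set" where
  "tangent_space A p =
     {v. (\<forall>c\<in>charts_at A p. \<forall>d\<in>charts_at A p.
            v d = frechet_derivative (transition c d) (at (chart_map c p)) (v c)) \<and>
         (\<forall>c. c \<notin> charts_at A p \<longrightarrow> v c = 0)}"

definition tv_add :: "('m, 'e::real_normed_vector) tv \<Rightarrow> ('m, 'e) tv \<Rightarrow> ('m, 'e) tv" where
  "tv_add u v = (\<lambda>c. u c + v c)"

definition tv_scale :: "real \<Rightarrow> ('m, 'e::real_normed_vector) tv \<Rightarrow> ('m, 'e) tv" where
  "tv_scale a u = (\<lambda>c. a *\<^sub>R u c)"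

definition tv_zero :: "('m, 'e::real_normed_vector) tv" where
  "tv_zero = (\<lambda>c. 0)"

text \<open>The tangent vector at \<open>p\<close> whose coordinate vector with respect to the chart \<open>c\<close> is \<open>e\<close>.\<close>

definition coord_vec ::
    "('m, 'e::real_normed_vector) chart set \<Rightarrow> ('m, 'e) chart \<Rightarrow> 'm \<Rightarrow> 'e \<Rightarrow> ('m, 'e) tv" where
  "coord_vec A c p e = (\<lambda>d. if d \<in> charts_at A p
     then frechet_derivative (transition c d) (at (chart_map c p)) e else 0)"

definition vector_field ::
    "('m, 'e::real_normed_vector) chart set \<Rightarrow> ('m, 'e) vfield \<Rightarrow> bool" where
  "vector_field A X \<longleftrightarrow>
     (\<forall>p. X p \<in> tangent_space A p) \<and>
     (\<forall>c\<in>A. smooth_on (chart_map c ` chart_dom c) (\<lambda>x. X (chart_inv c x) c))"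

definition vf_add ::
    "('m, 'e::real_normed_vector) vfield \<Rightarrow> ('m, 'e) vfield \<Rightarrow> ('m, 'e) vfield" where
  "vf_add X Y = (\<lambda>p. tv_add (X p) (Y p))"

definition vf_scale ::
    "('m \<Rightarrow> real) \<Rightarrow> ('m, 'e::real_normed_vector) vfield \<Rightarrow> ('m, 'e) vfield" where
  "vf_scale f X = (\<lambda>p. tv_scale (f p) (X p))"

text \<open>
  The Lie derivative of a function, computed in some chart around the point; for \<open>f\<close> differentiable
  near \<open>p\<close> and \<open>X p\<close> tangent the choice of chart is immaterial.
\<close>

definition lie_deriv ::
    "('m, 'e::real_normed_vector) chart set \<Rightarrow> ('m, 'e) vfield \<Rightarrow> ('m \<Rightarrow> real) \<Rightarrow> 'm \<Rightarrow> real" where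
  "lie_deriv A X f p =
     (let c = (SOME c. c \<in> charts_at A p)
      in frechet_derivative (f \<circ> chart_inv c) (at (chart_map c p)) (X p c))"

text \<open>The Lie bracket in coordinates: \<open>[X, Y]\<^sup>i = X\<^sup>j \<partial>\<^sub>j Y\<^sup>i - Y\<^sup>j \<partial>\<^sub>j X\<^sup>i\<close>.\<close>

definition lie_bracket ::
    "('m, 'e::real_normed_vector) chart set \<Rightarrow> ('m, 'e) vfield \<Rightarrow> ('m, 'e) vfield \<Rightarrow> ('m, 'e) vfield"
where
  "lie_bracket A X Y = (\<lambda>p c. if c \<in> charts_at A p then
       frechet_derivative (\<lambda>x. Y (chart_inv c x) c) (at (chart_map c p)) (X p c)
     - frechet_derivative (\<lambda>x. X (chart_inv c x) c) (at (chart_map c p)) (Y p c)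
     else 0)"

text \<open>
  The identification of \<open>T\<^sub>p M \<oplus> T\<^sub>q N\<close> with the tangent space of the product at \<open>(p, q)\<close>.  The
  two factors of a product chart around \<open>(p, q)\<close> are recovered by projecting its domain and by
  slicing its coordinate map.
\<close>

definition pair_tv ::
    "('m, 'e::real_normed_vector) chart set \<Rightarrow> ('n, 'f::real_normed_vector) chart set \<Rightarrow> 'm \<Rightarrow> 'n
     \<Rightarrow> ('m, 'e) tv \<Rightarrow> ('n, 'f) tv \<Rightarrow> ('m \<times> 'n, 'e \<times> 'f) tv" where
  "pair_tv A B p q u v = (\<lambda>c. if c \<in> charts_at (prod_atlas A B) (p, q)
     then (u (fst ` chart_dom c, \<lambda>x. fst (chart_map c (x, q))),
           v (snd ` chart_dom c, \<lambda>y. snd (chart_map c (p, y))))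
     else 0)"

definition hlift_L ::
    "('m, 'e::real_normed_vector) chart set \<Rightarrow> ('m, 'e) vfield \<Rightarrow> ('m \<times> 'm, 'e \<times> 'e) vfield" where
  "hlift_L A X = (\<lambda>(m, n). pair_tv A A m n (X m) tv_zero)"


section \<open>Bi-forms\<close>

text \<open>
  The fibre of \<open>\<Lambda>\<^sup>p \<pi>\<^sub>L\<^sup>* T\<^sup>\<or>M \<otimes> \<Lambda>\<^sup>q \<pi>\<^sub>R\<^sup>* T\<^sup>\<or>M\<close> over \<open>(m, n)\<close> consists of the multilinear maps on
  \<open>(T\<^sub>m M)\<^sup>p \<times> (T\<^sub>n M)\<^sup>q\<close> that are alternating in the first \<open>p\<close> and in the last \<open>q\<close> arguments.  The two
  groups of arguments are passed as lists.
\<close>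

type_synonym ('m, 'e) biform = "'m \<Rightarrow> 'm \<Rightarrow> ('m, 'e) tv list \<Rightarrow> ('m, 'e) tv list \<Rightarrow> real"

definition alternating_form ::
    "('m, 'e::real_normed_vector) tv set \<Rightarrow> nat \<Rightarrow> (('m, 'e) tv list \<Rightarrow> real) \<Rightarrow> bool" where
  "alternating_form T p F \<longleftrightarrow>
     (\<forall>us. length us = p \<and> set us \<subseteq> T \<longrightarrow>
        (\<forall>i<p. \<forall>u\<in>T. \<forall>v\<in>T. F (us[i := tv_add u v]) = F (us[i := u]) + F (us[i := v])) \<and>
        (\<forall>i<p. \<forall>u\<in>T. \<forall>a. F (us[i := tv_scale a u]) = a * F (us[i := u])) \<and>
        (\<forall>i j. i < j \<and> j < p \<and> us ! i = us ! j \<longrightarrow> F us = 0))"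

text \<open>
  \<open>biform A p q W \<omega>\<close>: \<open>\<omega>\<close> is a \<open>(p, q)\<close>-bi-form on the open set \<open>W\<close>.  The values of \<open>\<omega>\<close> outside
  \<open>W\<close> and at arguments that are not tangent vectors are irrelevant.  Smoothness is that of the
  components with respect to the coordinate frames of product charts.
\<close>

definition biform ::
    "('m::topological_space, 'e::real_normed_vector) chart set \<Rightarrow> nat \<Rightarrow> nat \<Rightarrow> ('m \<times> 'm) set
     \<Rightarrow> ('m, 'e) biform \<Rightarrow> bool" where
  "biform A p q W \<omega> \<longleftrightarrow> open W \<and>
     (\<forall>(m, n)\<in>W.
        (\<forall>vs. length vs = q \<and> set vs \<subseteq> tangent_space A n \<longrightarrow>
           alternating_form (tangent_space A m) p (\<lambda>us. \<omega> m n us vs)) \<and>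
        (\<forall>us. length us = p \<and> set us \<subseteq> tangent_space A m \<longrightarrow>
           alternating_form (tangent_space A n) q (\<lambda>vs. \<omega> m n us vs))) \<and>
     (\<forall>c\<in>A. \<forall>d\<in>A. \<forall>es fs. length es = p \<and> length fs = q \<longrightarrow>
        smooth_on (map_prod (chart_map c) (chart_map d) ` ((chart_dom c \<times> chart_dom d) \<inter> W))
          (\<lambda>(x, y). \<omega> (chart_inv c x) (chart_inv d y)
             (map (coord_vec A c (chart_inv c x)) es) (map (coord_vec A d (chart_inv d y)) fs)))"

definition biform_eq_on ::
    "('m, 'e::real_normed_vector) chart set \<Rightarrow> nat \<Rightarrow> nat \<Rightarrow> ('m \<times> 'm) set
     \<Rightarrow> ('m, 'e) biform \<Rightarrow> ('m, 'e) biform \<Rightarrow> bool" where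
  "biform_eq_on A p q W \<omega> \<theta> \<longleftrightarrow>
     (\<forall>(m, n)\<in>W. \<forall>us vs.
        length us = p \<and> set us \<subseteq> tangent_space A m \<and>
        length vs = q \<and> set vs \<subseteq> tangent_space A n \<longrightarrow> \<omega> m n us vs = \<theta> m n us vs)"

definition biform_eval ::
    "('m, 'e) biform \<Rightarrow> ('m, 'e) vfield list \<Rightarrow> ('m, 'e) vfield list \<Rightarrow> 'm \<times> 'm \<Rightarrow> real" where
  "biform_eval \<omega> Xs Ys = (\<lambda>(m, n). \<omega> m n (map (\<lambda>X. X m) Xs) (map (\<lambda>Y. Y n) Ys))"

text \<open>\<open>\<iota>\<^sup>*\<omega>\<close> for a \<open>(p, q)\<close>-bi-form \<open>\<omega>\<close>, as a covariant tensor evaluated on \<open>p + q\<close> tangent vectors.\<close>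

definition diag_pullback ::
    "nat \<Rightarrow> ('m, 'e) biform \<Rightarrow> 'm \<Rightarrow> ('m, 'e) tv list \<Rightarrow> real" where
  "diag_pullback p \<omega> m zs = \<omega> m m (take p zs) (drop p zs)"

definition omit :: "nat \<Rightarrow> 'a list \<Rightarrow> 'a list" where
  "omit i xs = take i xs @ drop (Suc i) xs"

definition dL_eval ::
    "('m, 'e::real_normed_vector) chart set \<Rightarrow> ('m, 'e) biform
     \<Rightarrow> ('m, 'e) vfield list \<Rightarrow> ('m, 'e) vfield list \<Rightarrow> 'm \<times> 'm \<Rightarrow> real" where
  "dL_eval A \<omega> Xs Ys z =
     (\<Sum>i<length Xs. (-1) ^ i *
        lie_deriv (prod_atlas A A) (hlift_L A (Xs ! i)) (biform_eval \<omega> (omit i Xs) Ys) z)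
   + (\<Sum>b<length Xs. \<Sum>a<b. (-1) ^ (a + b) *
        biform_eval \<omega> (lie_bracket A (Xs ! a) (Xs ! b) # omit a (omit b Xs)) Ys z)"

text \<open>
  The previous expression is tensorial in the vector fields, so that the value of \<open>d\<^sup>L\<omega>\<close> at tangent
  vectors is obtained from arbitrary extensions of these to vector fields on \<open>M\<close>.
\<close>

definition vf_extension ::
    "('m, 'e::real_normed_vector) chart set \<Rightarrow> 'm \<Rightarrow> ('m, 'e) tv \<Rightarrow> ('m, 'e) vfield" where
  "vf_extension A p u = (SOME X. vector_field A X \<and> X p = u)"

definition dL ::
    "('m, 'e::real_normed_vector) chart set \<Rightarrow> ('m, 'e) biform \<Rightarrow> ('m, 'e) biform" where
  "dL A \<omega> = (\<lambda>m n us vs.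
     dL_eval A \<omega> (map (vf_extension A m) us) (map (vf_extension A n) vs) (m, n))"


section \<open>Metrics, connections, statistical manifolds admitting torsion\<close>

type_synonym ('m, 'e) tensor2 = "'m \<Rightarrow> ('m, 'e) tv \<Rightarrow> ('m, 'e) tv \<Rightarrow> real"

definition pseudo_riemannian ::
    "('m, 'e::real_normed_vector) chart set \<Rightarrow> ('m, 'e) tensor2 \<Rightarrow> bool" where
  "pseudo_riemannian A g \<longleftrightarrow>
     (\<forall>p. \<forall>u\<in>tangent_space A p. \<forall>v\<in>tangent_space A p.
        g p u v = g p v u \<and>
        (\<forall>w\<in>tangent_space A p. g p (tv_add u w) v = g p u v + g p w v) \<and>
        (\<forall>a. g p (tv_scale a u) v = a * g p u v)) \<and>
     (\<forall>p. \<forall>u\<in>tangent_space A p. (\<forall>v\<in>tangent_space A p. g p u v = 0) \<longrightarrow> u = tv_zero) \<and>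
     (\<forall>c\<in>A. \<forall>e f. smooth_on (chart_map c ` chart_dom c)
        (\<lambda>x. g (chart_inv c x) (coord_vec A c (chart_inv c x) e) (coord_vec A c (chart_inv c x) f)))"

text \<open>\<open>D X Y\<close> is the covariant derivative of \<open>Y\<close> in the direction \<open>X\<close>.\<close>

type_synonym ('m, 'e) connection = "('m, 'e) vfield \<Rightarrow> ('m, 'e) vfield \<Rightarrow> ('m, 'e) vfield"

definition affine_connection ::
    "('m, 'e::real_normed_vector) chart set \<Rightarrow> ('m, 'e) connection \<Rightarrow> bool" where
  "affine_connection A D \<longleftrightarrow>
     (\<forall>X Y. vector_field A X \<and> vector_field A Y \<longrightarrow>
        vector_field A (D X Y) \<and>
        (\<forall>Z. vector_field A Z \<longrightarrow>
           D (vf_add X Z) Y = vf_add (D X Y) (D Z Y) \<and>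
           D X (vf_add Y Z) = vf_add (D X Y) (D X Z)) \<and>
        (\<forall>f. smooth_fun A UNIV f \<longrightarrow>
           D (vf_scale f X) Y = vf_scale f (D X Y) \<and>
           D X (vf_scale f Y) = vf_add (vf_scale (lie_deriv A X f) Y) (vf_scale f (D X Y))))"

definition torsion ::
    "('m, 'e::real_normed_vector) chart set \<Rightarrow> ('m, 'e) connection
     \<Rightarrow> ('m, 'e) vfield \<Rightarrow> ('m, 'e) vfield \<Rightarrow> ('m, 'e) vfield" where
  "torsion A D X Y = (\<lambda>p c. D X Y p c - D Y X p c - lie_bracket A X Y p c)"

definition torsion_free ::
    "('m, 'e::real_normed_vector) chart set \<Rightarrow> ('m, 'e) connection \<Rightarrow> bool" where
  "torsion_free A D \<longleftrightarrow>
     (\<forall>X Y. vector_field A X \<and> vector_field A Y \<longrightarrow> torsion A D X Y = (\<lambda>p. tv_zero))"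

text \<open>No condition is imposed on the \<open>g\<close>-conjugate connection, which may have torsion.\<close>

definition smat ::
    "('m, 'e::real_normed_vector) chart set \<Rightarrow> ('m, 'e) tensor2 \<Rightarrow> ('m, 'e) connection \<Rightarrow> bool" where
  "smat A g D \<longleftrightarrow> pseudo_riemannian A g \<and> affine_connection A D \<and> torsion_free A D"


section \<open>Contrast bi-forms\<close>

definition induced_metric :: "('m, 'e) biform \<Rightarrow> ('m, 'e) tensor2" where
  "induced_metric \<omega> = (\<lambda>m u v. diag_pullback 1 \<omega> m [u, v])"

definition contrast_biform ::
    "('m::topological_space, 'e::real_normed_vector) chart set \<Rightarrow> ('m \<times> 'm) set
     \<Rightarrow> ('m, 'e) biform \<Rightarrow> bool" where
  "contrast_biform A W \<omega> \<longleftrightarrow>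
     (\<forall>m. (m, m) \<in> W) \<and> biform A 1 1 W \<omega> \<and> pseudo_riemannian A (induced_metric \<omega>)"

definition induced_connection ::
    "('m, 'e::real_normed_vector) chart set \<Rightarrow> ('m, 'e) biform \<Rightarrow> ('m, 'e) connection" where
  "induced_connection A \<omega> Z X = (THE V. vector_field A V \<and>
     (\<forall>Y m. vector_field A Y \<longrightarrow>
        induced_metric \<omega> m (V m) (Y m) =
        lie_deriv (prod_atlas A A) (hlift_L A Z) (biform_eval \<omega> [X] [Y]) (m, m)))"

definition left_exact ::
    "('m::topological_space, 'e::real_normed_vector) chart set \<Rightarrow> ('m \<times> 'm) set
     \<Rightarrow> ('m, 'e) biform \<Rightarrow> bool" where
  "left_exact A W \<omega> \<longleftrightarrow> (\<exists>S. biform A 0 1 UNIV S \<and> biform_eq_on A 1 1 W \<omega> (dL A S))"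

definition tensor2_eq ::
    "('m, 'e::real_normed_vector) chart set \<Rightarrow> ('m, 'e) tensor2 \<Rightarrow> ('m, 'e) tensor2 \<Rightarrow> bool" where
  "tensor2_eq A g h \<longleftrightarrow> (\<forall>m. \<forall>u\<in>tangent_space A m. \<forall>v\<in>tangent_space A m. g m u v = h m u v)"

definition connection_eq ::
    "('m, 'e::real_normed_vector) chart set \<Rightarrow> ('m, 'e) connection \<Rightarrow> ('m, 'e) connection \<Rightarrow> bool" where
  "connection_eq A D D' \<longleftrightarrow>
     (\<forall>X Y. vector_field A X \<and> vector_field A Y \<longrightarrow> D X Y = D' X Y)"

end

theory Submission
  imports Defs
begin

text \<open>
  In a chart, \<open>g(\<nabla>\<^sub>Z X, v) = \<omega>(dX(Z) | v) + \<Gamma>\<^sub>v(Z, X)\<close> with \<open>\<Gamma>\<^sub>v(z, e)\<close> the derivative of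
  \<open>x \<mapsto> \<omega>(x, m)(e | v)\<close> at \<open>x = m\<close> in the direction \<open>z\<close>.  Hence \<open>\<nabla>\<close> is torsion-free if and only if
  every \<open>\<Gamma>\<^sub>v\<close> is symmetric.  For \<open>\<omega> = d\<^sup>L S\<close> the form \<open>\<Gamma>\<^sub>v\<close> is the second derivative of
  \<open>x \<mapsto> S(x, m)(v)\<close>, which is symmetric.

  Conversely, a potential with the right \<open>2\<close>-jet along the diagonal is, in a chart, the Taylor polynomial
  \<open>P(x, y)(v) = \<omega>(y, y)(x - y | v) + \<Gamma>\<^sub>v(x - y, x - y) / 2\<close>.  With locally finite bump functions \<open>b\<close>
  supported in charts, the sum of the \<open>b(x) b(y) (2 b(y) - b(x)) P(x, y)\<close>, divided by the sum of the
  \<open>b(y)\<^sup>3\<close>, is global.  It keeps the \<open>2\<close>-jet because \<open>b(x) (2 b(y) - b(x))\<close> is stationary in \<open>x\<close>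
  at \<open>x = y\<close>.
\<close>

section \<open>Calculus of smooth maps\<close>

text \<open>Gluing concerns \<open>conn_form\<close>, the covector g(\<nabla>_Z X, .): like the
  metric it is linear in the bi-form, whereas the connection arises from it by inverting the metric.
  So each local potential only has to reproduce metric and \<open>conn_form\<close> up to a common
  factor. The obstacle is that P exists only for x and y in one chart, while a cut-off in x adds to
  the second derivative cross terms with the first derivative of P, that is, with the metric. The
  identity b(x) (2 b(y) - b(x)) = b(y)^2 - (b(x) - b(y))^2 shows a cut-off without first order term;
  its second order term meets P(y, y) = 0. The remaining factor b(y) confines y to the chart. The
  common factor is thus b(y)^3, and the divisor, depending on y alone, commutes with
  \<open>dL\<close>. P involves \<omega> only through its 1-jet along the diagonal, so S is global
  even if \<omega> is not, and P(y, y) = 0 yields the vanishing of S on the diagonal. Before all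
  this, \<nabla> must exist: every covector needs a representing vector, depending smoothly on the
  point.\<close>

lemma Ck_on_mono: "Ck_on k S f \<Longrightarrow> T \<subseteq> S \<Longrightarrow> Ck_on k T f"
  by (induction k arbitrary: f) (auto intro: continuous_on_subset)

lemma Ck_on_cong:
  assumes "open S" "\<And>x. x \<in> S \<Longrightarrow> f x = g x" "Ck_on k S f"
  shows "Ck_on k S g"
  using assms(2,3)
proof (induction k arbitrary: f g)
  case 0
  then show ?case by (metis Ck_on.simps(1) continuous_on_cong)
next
  case (Suc k)
  have d: "(g has_derivative frechet_derivative f (at x)) (at x)" if "x \<in> S" for x
    using Suc.prems that assms(1) frechet_derivative_works[of f "at x"]
    by (auto intro: has_derivative_transform_within_open)
  have "frechet_derivative g (at x) = frechet_derivative f (at x)" if "x \<in> S" for x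
    using d[OF that] frechet_derivative_at by metis
  with d Suc show ?case
    by (auto simp: differentiable_def intro!: Suc.IH)
qed

text \<open>A closed formula for the derivative can take the place of
  \<open>frechet_derivative\<close>, because the two agree on all of the open set
  \<open>S\<close>.\<close>

lemma Ck_on_SucI:
  assumes "open S" "\<And>x. x \<in> S \<Longrightarrow> (f has_derivative f' x) (at x)" "\<And>v. Ck_on k S (\<lambda>x. f' x v)"
  shows "Ck_on (Suc k) S f"
proof -
  have "Ck_on k S (\<lambda>x. frechet_derivative f (at x) v)" for v
    by (rule Ck_on_cong[OF assms(1) _ assms(3)[of v]]) (metis assms(2) frechet_derivative_at)
  then show ?thesis using assms(2) by (auto simp: differentiable_def)
qed

lemma Ck_on_has_derivative:
  "Ck_on (Suc k) S f \<Longrightarrow> x \<in> S \<Longrightarrow> (f has_derivative frechet_derivative f (at x)) (at x)"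
  by (simp add: frechet_derivative_works)

lemma Ck_on_SucD: "Ck_on (Suc k) S f \<Longrightarrow> Ck_on k S f"
proof (induction k arbitrary: f)
  case 0
  then show ?case
    by (auto intro!: differentiable_imp_continuous_on
        simp: differentiable_on_def differentiable_at_withinI)
next
  case (Suc k)
  then show ?case by simp
qed

lemma Ck_on_const: "open S \<Longrightarrow> Ck_on k S (\<lambda>x. c)"
proof (induction k arbitrary: c)
  case (Suc k)
  then show ?case by (intro Ck_on_SucI[where f' = "\<lambda>x v. 0"]) auto
qed simp

lemma Ck_on_bounded_linear:
  assumes "bounded_linear L" "open S" "Ck_on k S f"
  shows "Ck_on k S (\<lambda>x. L (f x))"
  using assms(3)
proof (induction k arbitrary: f)
  case 0
  then show ?case
    using bounded_linear.continuous_on[OF assms(1)] by auto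
next
  case (Suc k)
  show ?case
    by (rule Ck_on_SucI[OF assms(2)
          bounded_linear.has_derivative[OF assms(1) Ck_on_has_derivative[OF Suc.prems]]])
      (use Suc in auto)
qed

lemma Ck_on_add:
  assumes "open S" "Ck_on k S f" "Ck_on k S g"
  shows "Ck_on k S (\<lambda>x. f x + g x)"
  using assms(2,3)
proof (induction k arbitrary: f g)
  case 0
  then show ?case by (auto intro: continuous_on_add)
next
  case (Suc k)
  show ?case
    by (rule Ck_on_SucI[OF assms(1) has_derivative_add])
      (use Suc in \<open>auto simp: frechet_derivative_works\<close>)
qed

lemma Ck_on_bounded_bilinear:
  assumes "bounded_bilinear B" "open S" "Ck_on k S f" "Ck_on k S g"
  shows "Ck_on k S (\<lambda>x. B (f x) (g x))"
  using assms(3,4)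
proof (induction k arbitrary: f g)
  case 0
  then show ?case
    using bounded_bilinear.continuous_on[OF assms(1)] by auto
next
  case (Suc k)
  note pr = Ck_on_SucD[OF Suc.prems(1)] Ck_on_SucD[OF Suc.prems(2)]
  show ?case
    by (rule Ck_on_SucI[OF assms(2) bounded_bilinear.FDERIV[OF assms(1)]])
      (use Suc pr in \<open>auto simp: frechet_derivative_works intro!: Ck_on_add assms(2)\<close>)
qed

lemma Ck_on_inverse:
  fixes f :: "'a::real_normed_vector \<Rightarrow> real"
  assumes "open S" "Ck_on k S f" "\<And>x. x \<in> S \<Longrightarrow> f x \<noteq> 0"
  shows "Ck_on k S (\<lambda>x. inverse (f x))"
  using assms(2)
proof (induction k)
  case 0
  then show ?case using assms(3) by (auto intro!: continuous_on_inverse)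
next
  case (Suc k)
  \<comment> \<open>The derivative of 1 / f again contains 1 / f, but only to the order
    \<open>k\<close>, where the induction hypothesis applies.\<close>
  have I: "Ck_on k S (\<lambda>x. inverse (f x))"
    using Suc Ck_on_SucD by blast
  have "Ck_on k S (\<lambda>x. - (inverse (f x) * frechet_derivative f (at x) v * inverse (f x)))" for v
    using Suc.prems I assms(1)
    by (intro Ck_on_bounded_linear[OF bounded_linear_minus[OF bounded_linear_ident]]
        Ck_on_bounded_bilinear[OF bounded_bilinear_mult]) auto
  then show ?case
    using Suc.prems assms(3)
    by (intro Ck_on_SucI[OF assms(1) Deriv.has_derivative_inverse])
      (auto simp: frechet_derivative_works)
qed

text \<open>
  The model space is not assumed to be of class \<open>euclidean_space\<close>; a finite tight frame takes the
  place of \<open>Basis\<close>.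
\<close>

definition frame :: "'a::real_inner set \<Rightarrow> bool" where
  "frame E \<longleftrightarrow> finite E \<and> (\<forall>x. (\<Sum>b\<in>E. (x \<bullet> b) *\<^sub>R b) = x)"

lemma frame_finite: "frame E \<Longrightarrow> finite E"
  by (simp add: frame_def)

lemma frame_expand: "frame E \<Longrightarrow> (\<Sum>b\<in>E. (x \<bullet> b) *\<^sub>R b) = x"
  by (simp add: frame_def)

lemma frame_linear:
  assumes "frame E" "linear f"
  shows "f x = (\<Sum>b\<in>E. (x \<bullet> b) *\<^sub>R f b)"
proof -
  have "f x = f (\<Sum>b\<in>E. (x \<bullet> b) *\<^sub>R b)"
    using frame_expand[OF assms(1)] by simp
  also have "\<dots> = (\<Sum>b\<in>E. (x \<bullet> b) *\<^sub>R f b)"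
    using assms(2) by (simp add: linear_sum linear_scale)
  finally show ?thesis .
qed

text \<open>Gram-Schmidt along the finite spanning set; a vector that depends on the earlier ones is
  dropped, so that dimension 0 yields the empty frame. Orthonormality goes beyond
  \<open>frame\<close>: it makes the coefficients of a frame combination recoverable by inner
  products.\<close>

lemma frame_exists:
  fixes B :: "'a::real_inner set"
  assumes "finite B" "span B = UNIV"
  shows "\<exists>E :: 'a set. frame E \<and> (\<forall>a\<in>E. \<forall>b\<in>E. a \<bullet> b = (if a = b then 1 else 0))"
proof -
  have "\<exists>E. finite E \<and> E \<subseteq> span B \<and> (\<forall>x\<in>span B. (\<Sum>b\<in>E. (x \<bullet> b) *\<^sub>R b) = x)
      \<and> (\<forall>a\<in>E. \<forall>b\<in>E. a \<bullet> b = (if a = b then 1 else 0))"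
    using assms(1)
  proof (induction B)
    case empty
    then show ?case by (auto intro!: exI[of _ "{}"])
  next
    case (insert a B)
    then obtain E where E0: "finite E" "E \<subseteq> span B" "\<forall>x\<in>span B. (\<Sum>b\<in>E. (x \<bullet> b) *\<^sub>R b) = x"
      "\<forall>a\<in>E. \<forall>b\<in>E. a \<bullet> b = (if a = b then 1 else 0)"
      by (elim exE conjE)
    note E = E0(1,2) bspec[OF E0(3)] E0(4)
    define p where "p = (\<Sum>b\<in>E. (a \<bullet> b) *\<^sub>R b)"
    have pB: "p \<in> span B"
      unfolding p_def using E(2) by (intro span_sum span_scale) auto
    show ?case
    proof (cases "a = p")
      case True
      then have "span (insert a B) = span B"
        using pB by (simp add: span_redundant)
      with E0 show ?thesis by (intro exI[of _ E]) simp
    next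
      case False
      define u where "u = (1 / norm (a - p)) *\<^sub>R (a - p)"
      \<comment> \<open>\<open>p\<close> is the projection of \<open>a\<close> to the span of
        \<open>B\<close>; expanding \<open>y\<close> in \<open>E\<close> moves the projection from
        one side of the inner product to the other.\<close>
      have orth: "(a - p) \<bullet> y = 0" if "y \<in> span B" for y
      proof -
        have "a \<bullet> y = a \<bullet> (\<Sum>b\<in>E. (y \<bullet> b) *\<^sub>R b)"
          using E(3)[OF that] by simp
        also have "\<dots> = p \<bullet> y"
          unfolding p_def by (simp add: inner_sum_left inner_sum_right inner_commute mult.commute)
        finally show ?thesis by (simp add: inner_diff_left)
      qed
      have uy: "u \<bullet> y = 0" if "y \<in> span B" for y
        using orth[OF that] by (simp add: u_def)
      have uu: "u \<bullet> u = 1"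
        using False by (simp add: u_def dot_square_norm power2_eq_square)
      have uE: "u \<notin> E"
        using uy uu E(2) by force
      have aspan: "a = p + norm (a - p) *\<^sub>R u"
        using False by (simp add: u_def)
      have "u \<in> span (insert a B)"
        unfolding u_def using pB span_mono[of B "insert a B"]
        by (intro span_scale span_diff) (auto intro: span_base)
      moreover have "(\<Sum>b\<in>insert u E. (x \<bullet> b) *\<^sub>R b) = x" if "x \<in> span (insert a B)" for x
      proof -
        obtain k where k: "x - k *\<^sub>R a \<in> span B"
          using \<open>x \<in> span (insert a B)\<close> span_breakdown_eq[of x a B] by blast
        define y where "y = x - k *\<^sub>R a + k *\<^sub>R p"
        define t where "t = k * norm (a - p)"
        have y: "y \<in> span B"
          unfolding y_def using k pB by (intro span_add span_scale) auto
        have "x = y + k *\<^sub>R (a - p)"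
          unfolding y_def by (simp add: algebra_simps)
        also have "k *\<^sub>R (a - p) = t *\<^sub>R u"
          using False unfolding t_def u_def by simp
        finally have x: "x = y + t *\<^sub>R u" .
        have "x \<bullet> u = t"
          using uy[OF y] uu by (simp add: x inner_add_left inner_commute[of y])
        moreover have "x \<bullet> b = y \<bullet> b" if "b \<in> E" for b
          using uy[of b] that E(2) by (auto simp: x inner_add_left)
        ultimately show ?thesis
          using uE E(1) E(3)[OF y] x by simp
      qed
      moreover have "\<forall>a\<in>insert u E. \<forall>b\<in>insert u E. a \<bullet> b = (if a = b then 1 else 0)"
      proof (intro ballI)
        fix v w assume v: "v \<in> insert u E" and w: "w \<in> insert u E"
        have u0: "u \<bullet> b = 0" if "b \<in> E" for b
          using uy E(2) that by auto
        consider "v = u" "w = u" | "v = u" "w \<in> E" | "v \<in> E" "w = u" | "v \<in> E" "w \<in> E"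
          using v w by blast
        then show "v \<bullet> w = (if v = w then 1 else 0)"
        proof cases
          case 1
          then show ?thesis using uu by simp
        next
          case 2
          then show ?thesis using uE u0[of w] by metis
        next
          case 3
          then show ?thesis using uE u0[of v] by (metis inner_commute)
        next
          case 4
          then show ?thesis using bspec[OF bspec[OF E0(4)]] by blast
        qed
      qed
      ultimately show ?thesis
        using E(1,2) span_mono[of B "insert a B"] by (intro exI[of _ "insert u E"] conjI ballI) auto
    qed
  qed
  then obtain E where "finite E" "\<forall>x\<in>span B. (\<Sum>b\<in>E. (x \<bullet> b) *\<^sub>R b) = x"
      "\<forall>a\<in>E. \<forall>b\<in>E. a \<bullet> b = (if a = b then 1 else 0)"
    by (elim exE conjE)
  then show ?thesis
    using assms(2) by (intro exI[of _ E]) (simp add: frame_def)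
qed

text \<open>A frame may contain 0, and (0, 0) would then lie in both images; removing 0 from
  \<open>F\<close> makes the union disjoint without changing any expansion.\<close>

lemma frame_Times:
  fixes E :: "'a::real_inner set" and F :: "'b::real_inner set"
  assumes "frame E" "frame F"
  shows "frame ((\<lambda>b. (b, 0)) ` E \<union> (\<lambda>b. (0, b)) ` (F - {0}))"
proof -
  have F: "(\<Sum>b\<in>F - {0}. (y \<bullet> b) *\<^sub>R b) = y" for y
    using frame_expand[OF assms(2), of y] frame_finite[OF assms(2)]
      sum.mono_neutral_left[of F "F - {0}" "\<lambda>b. (y \<bullet> b) *\<^sub>R b"]
    by auto
  have i: "inj_on (\<lambda>b::'a. (b, 0::'b)) E" "inj_on (\<lambda>b::'b. (0::'a, b)) (F - {0})"
    by (auto simp: inj_on_def)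
  show ?thesis
    unfolding frame_def
    apply (intro conjI allI)
    subgoal using assms by (simp add: frame_finite)
    subgoal for x
      apply (subst sum.union_disjoint)
      using assms
         apply (auto simp: frame_finite sum.reindex[OF i(1)] sum.reindex[OF i(2)] inner_prod_def
          F frame_expand prod_eq_iff fst_sum snd_sum)
      done
    done
qed

text \<open>\<open>Ck_on\<close> differentiates in fixed directions only, whereas the chain rule
  evaluates the derivative of \<open>f\<close> in the direction \<open>?Dg x v\<close>, which moves
  with \<open>x\<close>. Expanding that direction in the frame leaves finitely many fixed directions
  with scalar coefficients of class k.\<close>

lemma Ck_on_compose:
  fixes g :: "'a::real_normed_vector \<Rightarrow> 'b::real_inner" and f :: "'b \<Rightarrow> 'c::real_normed_vector"
    and E :: "'b set"
  assumes E: "frame E" and "open S" "open T" "Ck_on k S g" "Ck_on k T f" "g ` S \<subseteq> T"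
  shows "Ck_on k S (\<lambda>x. f (g x))"
  using assms(4,5)
proof (induction k arbitrary: f)
  case 0
  then show ?case using assms(6) by (auto intro: continuous_on_compose2)
next
  case (Suc k)
  let ?Df = "\<lambda>x. frechet_derivative f (at x)" and ?Dg = "\<lambda>x. frechet_derivative g (at x)"
  have d: "((\<lambda>x. f (g x)) has_derivative (\<lambda>v. \<Sum>b\<in>E. (?Dg x v \<bullet> b) *\<^sub>R ?Df (g x) b)) (at x)"
    if "x \<in> S" for x
  proof -
    have gx: "g x \<in> T" using that assms(6) by auto
    have "((\<lambda>x. f (g x)) has_derivative (\<lambda>v. ?Df (g x) (?Dg x v))) (at x)"
      using has_derivative_compose[OF Ck_on_has_derivative[OF Suc.prems(1) that]
          Ck_on_has_derivative[OF Suc.prems(2) gx]] .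
    moreover have "linear (?Df (g x))"
      using Ck_on_has_derivative[OF Suc.prems(2) gx] has_derivative_linear by blast
    ultimately show ?thesis
      by (subst frame_linear[OF E, symmetric])
  qed
  have s: "Ck_on k S (\<lambda>x. \<Sum>b\<in>F. h b x)"
    if "finite F" "\<And>b. b \<in> F \<Longrightarrow> Ck_on k S (h b)" for F and h :: "'b \<Rightarrow> 'a \<Rightarrow> 'c"
    using that by (induction F) (auto intro: Ck_on_const Ck_on_add assms(2))
  have "Ck_on k S (\<lambda>x. \<Sum>b\<in>E. (?Dg x v \<bullet> b) *\<^sub>R ?Df (g x) b)" for v
    using Suc.prems Ck_on_SucD[OF Suc.prems(1)]
    by (intro s frame_finite[OF E] Ck_on_bounded_bilinear[OF bounded_bilinear_scaleR] assms(2)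
        Ck_on_bounded_linear[OF bounded_linear_inner_left] Suc.IH) auto
  then show ?case
    by (intro Ck_on_SucI[OF assms(2) d]) auto
qed

section \<open>Smoothness at a point\<close>

definition smooth_at :: "('a::real_normed_vector \<Rightarrow> 'b::real_normed_vector) \<Rightarrow> 'a \<Rightarrow> bool" where
  "smooth_at f x \<longleftrightarrow> (\<exists>S. open S \<and> x \<in> S \<and> smooth_on S f)"

lemma smooth_atI: "open S \<Longrightarrow> x \<in> S \<Longrightarrow> smooth_on S f \<Longrightarrow> smooth_at f x"
  by (auto simp: smooth_at_def)

lemma smooth_on_mono: "smooth_on S f \<Longrightarrow> T \<subseteq> S \<Longrightarrow> smooth_on T f"
  by (auto simp: smooth_on_def intro: Ck_on_mono)

lemma smooth_on_cong: "open S \<Longrightarrow> (\<And>x. x \<in> S \<Longrightarrow> f x = g x) \<Longrightarrow> smooth_on S f \<Longrightarrow> smooth_on S g"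
  by (metis Ck_on_cong smooth_on_def)

text \<open>\<open>frechet_derivative f (at x)\<close> does not refer to a neighbourhood, so the
  local statements about it fit together.\<close>

lemma Ck_on_local:
  assumes "\<And>x. x \<in> S \<Longrightarrow> \<exists>T. open T \<and> x \<in> T \<and> Ck_on k T f"
  shows "Ck_on k S f"
  using assms
proof (induction k arbitrary: f)
  case 0
  show ?case
    unfolding Ck_on.simps
  proof (rule continuous_at_imp_continuous_on, rule ballI)
    fix x assume "x \<in> S"
    then obtain T where "open T" "x \<in> T" "continuous_on T f" using 0 by auto
    then show "isCont f x" by (simp add: continuous_on_eq_continuous_at)
  qed
next
  case (Suc k)
  have "f differentiable at x" if "x \<in> S" for x
    using Suc.prems[OF that] by auto
  moreover have "Ck_on k S (\<lambda>x. frechet_derivative f (at x) v)" for v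
    by (rule Suc.IH) (use Suc.prems in force)
  ultimately show ?case by simp
qed

lemma smooth_on_iff_smooth_at: "open S \<Longrightarrow> smooth_on S f \<longleftrightarrow> (\<forall>x\<in>S. smooth_at f x)"
  unfolding smooth_on_def smooth_at_def by (meson Ck_on_local)

lemma smooth_at_eventually: "smooth_at f x \<Longrightarrow> eventually (smooth_at f) (nhds x)"
  unfolding smooth_at_def eventually_nhds by blast

lemma smooth_at_cong:
  assumes "eventually (\<lambda>y. f y = g y) (nhds x)" "smooth_at f x"
  shows "smooth_at g x"
proof -
  obtain S where "open S" "x \<in> S" "smooth_on S f" using assms(2) by (auto simp: smooth_at_def)
  moreover obtain T where "open T" "x \<in> T" "\<And>y. y \<in> T \<Longrightarrow> f y = g y"
    using assms(1) by (auto simp: eventually_nhds)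
  ultimately show ?thesis
    by (intro smooth_atI[of "S \<inter> T"]) (auto intro: smooth_on_cong[of _ f] smooth_on_mono)
qed

lemma smooth_at_differentiable: "smooth_at f x \<Longrightarrow> f differentiable (at x)"
  unfolding smooth_at_def smooth_on_def by (metis Ck_on.simps(2))

lemma smooth_at_has_derivative:
  "smooth_at f x \<Longrightarrow> (f has_derivative frechet_derivative f (at x)) (at x)"
  using smooth_at_differentiable frechet_derivative_works by blast

lemma smooth_at_isCont: "smooth_at f x \<Longrightarrow> isCont f x"
  by (simp add: differentiable_imp_continuous_within smooth_at_differentiable)

lemma smooth_at_deriv_const:
  "smooth_at f x \<Longrightarrow> smooth_at (\<lambda>y. frechet_derivative f (at y) v) x"
  unfolding smooth_at_def smooth_on_def by (metis Ck_on.simps(2))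

lemma smooth_at_const [simp, intro]: "smooth_at (\<lambda>x. c) x"
  by (auto intro!: smooth_atI[of UNIV] simp: smooth_on_def Ck_on_const)

lemma smooth_at_bounded_linear: 
  assumes "bounded_linear L" "smooth_at f x" shows "smooth_at (\<lambda>x. L (f x)) x"
  using assms by (auto simp: smooth_at_def smooth_on_def intro: Ck_on_bounded_linear)

lemma smooth_on_ident: "open S \<Longrightarrow> smooth_on S (\<lambda>x. x)"
  unfolding smooth_on_def
proof
  fix k assume "open S"
  then show "Ck_on k S (\<lambda>x. x)"
    by (cases k) (auto intro!: Ck_on_const)
qed

lemma smooth_at_ident [simp, intro]: "smooth_at (\<lambda>x. x) x"
  by (auto intro!: smooth_atI[of UNIV] smooth_on_ident)

lemma smooth_at_linear: "bounded_linear L \<Longrightarrow> smooth_at L x"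
  using smooth_at_bounded_linear[OF _ smooth_at_ident] .

lemma smooth_at_common:
  assumes "smooth_at f x" "smooth_at g x"
  obtains S where "open S" "x \<in> S" "smooth_on S f" "smooth_on S g"
proof -
  obtain S T where "open S" "x \<in> S" "smooth_on S f" "open T" "x \<in> T" "smooth_on T g"
    using assms unfolding smooth_at_def by blast
  then show ?thesis
    using that[of "S \<inter> T"] smooth_on_mono[of S f "S \<inter> T"] smooth_on_mono[of T g "S \<inter> T"]
    by blast
qed

lemma smooth_at_bounded_bilinear:
  assumes "bounded_bilinear B" "smooth_at f x" "smooth_at g x"
  shows "smooth_at (\<lambda>x. B (f x) (g x)) x"
proof -
  obtain S where "open S" "x \<in> S" "smooth_on S f" "smooth_on S g"
    using smooth_at_common[OF assms(2,3)] .
  then show ?thesis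
    by (intro smooth_atI[of S]) (simp_all add: smooth_on_def Ck_on_bounded_bilinear[OF assms(1)])
qed

lemma smooth_at_add [intro]:
  assumes "smooth_at f x" "smooth_at g x"
  shows "smooth_at (\<lambda>x. f x + g x) x"
proof -
  obtain S where "open S" "x \<in> S" "smooth_on S f" "smooth_on S g"
    using smooth_at_common[OF assms] .
  then show ?thesis
    by (intro smooth_atI[of S]) (simp_all add: smooth_on_def Ck_on_add)
qed

lemma smooth_at_sum [intro]:
  "(\<And>i. i \<in> I \<Longrightarrow> smooth_at (f i) x) \<Longrightarrow> smooth_at (\<lambda>x. \<Sum>i\<in>I. f i x) x"
  by (induction I rule: infinite_finite_induct) auto

lemmas smooth_at_mult [intro] = smooth_at_bounded_bilinear[OF bounded_bilinear_mult]
lemmas smooth_at_scaleR [intro] = smooth_at_bounded_bilinear[OF bounded_bilinear_scaleR]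
lemmas smooth_at_inner [intro] = smooth_at_bounded_bilinear[OF bounded_bilinear_inner]
lemmas smooth_at_minus [intro] =
  smooth_at_bounded_linear[OF bounded_linear_minus[OF bounded_linear_ident]]
lemmas smooth_at_fst [intro] = smooth_at_bounded_linear[OF bounded_linear_fst]
lemmas smooth_at_snd [intro] = smooth_at_bounded_linear[OF bounded_linear_snd]

lemma smooth_at_diff [intro]:
  "smooth_at f x \<Longrightarrow> smooth_at g x \<Longrightarrow> smooth_at (\<lambda>x. f x - g x) x"
  using smooth_at_add[OF _ smooth_at_minus, of f x g] by simp

lemma smooth_at_prod [intro]:
  "(\<And>i. i \<in> I \<Longrightarrow> smooth_at (f i) x) \<Longrightarrow> smooth_at (\<lambda>x. \<Prod>i\<in>I. f i x :: real) x"
  by (induction I rule: infinite_finite_induct) auto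

lemma smooth_at_Pair [intro]:
  assumes "smooth_at f x" "smooth_at g x"
  shows "smooth_at (\<lambda>x. (f x, g x)) x"
proof -
  have "smooth_at (\<lambda>x. (f x, 0) + (0, g x)) x"
    using assms by (intro smooth_at_add smooth_at_bounded_linear[of "\<lambda>x. (x, 0)" f]
      smooth_at_bounded_linear[of "\<lambda>x. (0, x)" g] bounded_linear_Pair bounded_linear_ident
      bounded_linear_zero)
  then show ?thesis by simp
qed

lemma smooth_at_inverse [intro]:
  fixes f :: "'a::real_normed_vector \<Rightarrow> real"
  assumes "smooth_at f x" "f x \<noteq> 0"
  shows "smooth_at (\<lambda>x. inverse (f x)) x"
proof -
  obtain S where S: "open S" "x \<in> S" "smooth_on S f"
    using assms by (auto simp: smooth_at_def)
  let ?S = "S \<inter> f -` (- {0})"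
  have "continuous_on S f"
    using S(3) by (metis Ck_on.simps(1) smooth_on_def)
  then have "open ?S"
    using S(1) by (intro continuous_open_preimage) auto
  moreover have "smooth_on ?S f"
    using S(3) by (rule smooth_on_mono) auto
  ultimately show ?thesis
    using S(2) assms(2) by (intro smooth_atI[of ?S]) (auto simp: smooth_on_def intro!: Ck_on_inverse)
qed

lemma smooth_at_divide [intro]:
  fixes f :: "'a::real_normed_vector \<Rightarrow> real"
  assumes "smooth_at f x" "smooth_at g x" "g x \<noteq> 0"
  shows "smooth_at (\<lambda>x. f x / g x) x"
  using assms by (auto simp: divide_inverse)

lemma smooth_at_compose:
  fixes g :: "'a::real_normed_vector \<Rightarrow> 'b::real_inner" and E :: "'b set"
  assumes "frame E" "smooth_at f (g x)" "smooth_at g x"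
  shows "smooth_at (\<lambda>x. f (g x)) x"
proof -
  obtain T where T: "open T" "g x \<in> T" "smooth_on T f"
    using assms by (auto simp: smooth_at_def)
  obtain S where S: "open S" "x \<in> S" "smooth_on S g"
    using assms by (auto simp: smooth_at_def)
  let ?S = "S \<inter> g -` T"
  have "continuous_on S g"
    using S(3) by (metis Ck_on.simps(1) smooth_on_def)
  then have o: "open ?S"
    using S(1) T(1) by (intro continuous_open_preimage) auto
  moreover have "smooth_on ?S g"
    using S(3) by (rule smooth_on_mono) auto
  then have "smooth_on ?S (\<lambda>x. f (g x))"
    unfolding smooth_on_def using T(3)
    by (metis Ck_on_compose[OF assms(1) o T(1)] smooth_on_def Int_lower2 image_subset_iff_subset_vimage)
  ultimately show ?thesis
    using S(2) T(2) by (intro smooth_atI[of ?S]) auto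
qed

lemma smooth_at_compose_real:
  fixes g :: "'a::real_normed_vector \<Rightarrow> real"
  assumes "smooth_at f (g x)" "smooth_at g x"
  shows "smooth_at (\<lambda>x. f (g x)) x"
  by (rule smooth_at_compose[OF _ assms, of "{1}"]) (simp add: frame_def)

text \<open>Base point and direction of the derivative both vary; the direction is expanded in the
  frame as for compositions. The expansion rests on linearity of the derivative, which is known
  where \<open>f\<close> is smooth, hence the passage to a neighbourhood.\<close>

lemma smooth_at_deriv:
  fixes g w :: "'a::real_normed_vector \<Rightarrow> 'b::real_inner" and E :: "'b set"
  assumes "frame E" "smooth_at f (g x)" "smooth_at g x" "smooth_at w x"
  shows "smooth_at (\<lambda>x. frechet_derivative f (at (g x)) (w x)) x"
proof (rule smooth_at_cong)
  have "isCont g x" using assms(3) smooth_at_isCont by blast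
  then have "filterlim g (nhds (g x)) (nhds x)"
    by (simp add: isCont_def tendsto_at_iff_tendsto_nhds)
  then have "\<forall>\<^sub>F y in nhds x. smooth_at f (g y)"
    using smooth_at_eventually[OF assms(2)] by (simp add: filterlim_iff)
  then show "\<forall>\<^sub>F y in nhds x. (\<Sum>b\<in>E. (w y \<bullet> b) *\<^sub>R frechet_derivative f (at (g y)) b)
      = frechet_derivative f (at (g y)) (w y)"
  proof eventually_elim
    case (elim y)
    have l: "linear (frechet_derivative f (at (g y)))"
      using elim smooth_at_has_derivative has_derivative_linear by blast
    show ?case by (rule frame_linear[OF assms(1) l, symmetric])
  qed
  show "smooth_at (\<lambda>y. \<Sum>b\<in>E. (w y \<bullet> b) *\<^sub>R frechet_derivative f (at (g y)) b) x"
    using assms by (intro smooth_at_sum smooth_at_scaleR smooth_at_inner smooth_at_const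
      smooth_at_compose[OF assms(1) smooth_at_deriv_const assms(3)])
qed

text \<open>\<open>frechet_derivative\<close> is a choice among the derivatives, and functions with
  the same germ have the same ones; this covers functions without a derivative as well.\<close>

lemma frechet_derivative_cong:
  assumes "eventually (\<lambda>y. f y = g y) (nhds x)"
  shows "frechet_derivative f (at x) = frechet_derivative g (at x)"
proof -
  obtain S where "open S" "x \<in> S" "\<And>y. y \<in> S \<Longrightarrow> f y = g y"
    using assms by (auto simp: eventually_nhds)
  then have "(f has_derivative D) (at x) \<longleftrightarrow> (g has_derivative D) (at x)" for D
    using has_derivative_transform_within_open[of f D x UNIV S g]
      has_derivative_transform_within_open[of g D x UNIV S f] by auto
  then show ?thesis by (simp add: frechet_derivative_def)
qed

lemma frechet_derivative_eqI:
  "(f has_derivative D) (at x) \<Longrightarrow> frechet_derivative f (at x) = D"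
  by (metis frechet_derivative_at)


text \<open>Gaussian elimination, so that neither determinants nor an inverse matrix are needed.\<close>

lemma smooth_linear_system:
  fixes G :: "'i \<Rightarrow> 'j \<Rightarrow> 'a::real_normed_vector \<Rightarrow> real"
  assumes "finite J"
    and "\<And>i j. i \<in> I \<Longrightarrow> j \<in> J \<Longrightarrow> smooth_at (G i j) x" "\<And>i. i \<in> I \<Longrightarrow> smooth_at (h i) x"
    and "\<forall>\<^sub>F y in nhds x. \<forall>i\<in>I. (\<Sum>j\<in>J. G i j y * V j y) = h i y"
    and "\<And>c j. (\<And>i. i \<in> I \<Longrightarrow> (\<Sum>j\<in>J. G i j x * c j) = 0) \<Longrightarrow> j \<in> J \<Longrightarrow> c j = (0::real)"
    and "j \<in> J"
  shows "smooth_at (V j) x"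
  using assms
proof (induction J arbitrary: G h j)
  case empty
  then show ?case by simp
next
  case (insert q J)
  \<comment> \<open>A pivot exists, since otherwise the unit vector at \<open>q\<close> would lie in
    the kernel at \<open>x\<close>.\<close>
  have "\<exists>p\<in>I. G p q x \<noteq> 0"
  proof (rule ccontr)
    assume *: "\<not> ?thesis"
    have "(\<lambda>j. if j = q then 1 else 0) q = (0::real)"
    proof (rule insert.prems(4)[of "\<lambda>j. if j = q then 1 else 0" q])
      fix i assume "i \<in> I"
      then show "(\<Sum>j\<in>insert q J. G i j x * (if j = q then 1 else 0)) = 0"
        using * insert.hyps by (auto simp: sum.insert intro!: sum.neutral)
    qed simp
    then show False by simp
  qed
  then obtain p where p: "p \<in> I" "G p q x \<noteq> 0" by blast
  \<comment> \<open>Column \<open>q\<close> is eliminated by row \<open>p\<close>. No row is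
    removed: row \<open>p\<close> turns into 0 = 0 near \<open>x\<close>, so \<open>I\<close> stays
    the same in the induction.\<close>
  define G' where "G' = (\<lambda>i j y. G i j y - G i q y * (G p j y / G p q y))"
  define h' where "h' = (\<lambda>i y. h i y - G i q y * (h p y / G p q y))"
  have "smooth_at (G p q) x"
    using insert.prems(1)[of p q] p(1) by simp
  then have "isCont (G p q) x"
    by (rule smooth_at_isCont)
  then have ev: "\<forall>\<^sub>F y in nhds x. G p q y \<noteq> 0"
    using p(2) continuous_at_imp_continuous_at_within
    by (metis isCont_def tendsto_at_iff_tendsto_nhds tendsto_imp_eventually_ne)
  have solve: "\<forall>\<^sub>F y in nhds x. V q y = (h p y - (\<Sum>j\<in>J. G p j y * V j y)) / G p q y"
    using insert.prems(3) ev
  proof eventually_elim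
    case (elim y)
    then show ?case using p(1) insert.hyps by (auto simp: field_simps)
  qed
  have sm: "smooth_at (V j) x" if "j \<in> J" for j
  proof (rule insert.IH[of G' h'])
    show "smooth_at (G' i j) x" if "i \<in> I" "j \<in> J" for i j
      unfolding G'_def using insert.prems(1) that p
      by (intro smooth_at_diff smooth_at_mult smooth_at_divide) auto
    show "smooth_at (h' i) x" if "i \<in> I" for i
      unfolding h'_def using insert.prems(1,2) that p
      by (intro smooth_at_diff smooth_at_mult smooth_at_divide) auto
    show "\<forall>\<^sub>F y in nhds x. \<forall>i\<in>I. (\<Sum>j\<in>J. G' i j y * V j y) = h' i y"
      using insert.prems(3) solve ev
    proof eventually_elim
      case (elim y)
      show ?case
      proof
        fix i assume i: "i \<in> I"
        have "(\<Sum>j\<in>J. G' i j y * V j y)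
            = (\<Sum>j\<in>J. G i j y * V j y) - G i q y / G p q y * (\<Sum>j\<in>J. G p j y * V j y)"
          unfolding G'_def by (simp add: algebra_simps sum_subtractf sum_distrib_left)
        also have "(\<Sum>j\<in>J. G i j y * V j y) = h i y - G i q y * V q y"
          using elim(1) i insert.hyps by auto
        also have "(\<Sum>j\<in>J. G p j y * V j y) = h p y - G p q y * V q y"
          using elim(1) p(1) insert.hyps by auto
        finally show "(\<Sum>j\<in>J. G' i j y * V j y) = h' i y"
          using elim(3) by (simp add: h'_def field_simps)
      qed
    qed
    show "c j = 0" if c: "\<And>i. i \<in> I \<Longrightarrow> (\<Sum>j\<in>J. G' i j x * c j) = 0" and j: "j \<in> J" for c j
    proof -
      \<comment> \<open>Back substitution through row \<open>p\<close> extends a kernel vector of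
        the reduced system to one of the full system.\<close>
      define cq where "cq = - (\<Sum>j\<in>J. G p j x * c j) / G p q x"
      define d where "d = (\<lambda>j. if j = q then cq else c j)"
      have "d j = 0"
      proof (rule insert.prems(4))
        fix i assume i: "i \<in> I"
        have "(\<Sum>j\<in>J. G i j x * d j) = (\<Sum>j\<in>J. G i j x * c j)"
          using insert.hyps by (intro sum.cong) (auto simp: d_def)
        moreover have "(\<Sum>j\<in>J. G' i j x * c j)
            = (\<Sum>j\<in>J. G i j x * c j) - G i q x / G p q x * (\<Sum>j\<in>J. G p j x * c j)"
          unfolding G'_def by (simp add: algebra_simps sum_subtractf sum_distrib_left)
        ultimately show "(\<Sum>j\<in>insert q J. G i j x * d j) = 0"
          using c[OF i] insert.hyps by (simp add: d_def cq_def)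
      qed (use j in auto)
      then show ?thesis using j insert.hyps by (auto simp: d_def split: if_splits)
    qed
  qed (use that in auto)
  show ?case
  proof (cases "j = q")
    case True
    have "smooth_at (\<lambda>y. (h p y - (\<Sum>j\<in>J. G p j y * V j y)) / G p q y) x"
      using insert.prems(1,2) p sm
      by (intro smooth_at_divide smooth_at_diff smooth_at_sum smooth_at_mult) auto
    then show ?thesis
      unfolding True by (rule smooth_at_cong[rotated]) (use solve in \<open>auto elim: eventually_mono\<close>)
  next
    case False
    then show ?thesis using sm insert.prems(5) by auto
  qed
qed

text \<open>Both mixed second derivatives arise as limits of the same second difference quotient.\<close>

lemma second_difference:
  fixes f :: "'a::real_normed_vector \<Rightarrow> real"
  assumes h: "0 < h"
    and sm: "\<And>s t. 0 \<le> s \<Longrightarrow> s \<le> h \<Longrightarrow> 0 \<le> t \<Longrightarrow> t \<le> h \<Longrightarrow> smooth_at f (x + s *\<^sub>R u + t *\<^sub>R v)"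
  obtains s t where "0 < s" "s < h" "0 < t" "t < h"
    "f (x + h *\<^sub>R u + h *\<^sub>R v) - f (x + h *\<^sub>R u) - f (x + h *\<^sub>R v) + f x
      = h * h * frechet_derivative (\<lambda>y. frechet_derivative f (at y) u) (at (x + s *\<^sub>R u + t *\<^sub>R v)) v"
proof -
  define Df where "Df = (\<lambda>y. frechet_derivative f (at y) u)"
  have d1: "((\<lambda>s. f (x + s *\<^sub>R u + t *\<^sub>R v)) has_real_derivative Df (x + s *\<^sub>R u + t *\<^sub>R v)) (at s)"
    if "0 \<le> s" "s \<le> h" "0 \<le> t" "t \<le> h" for s t
  proof -
    have d: "(f has_derivative frechet_derivative f (at (x + s *\<^sub>R u + t *\<^sub>R v))) (at (x + s *\<^sub>R u + t *\<^sub>R v))"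
      using sm[OF that] by (rule smooth_at_has_derivative)
    have "((\<lambda>s. x + s *\<^sub>R u + t *\<^sub>R v) has_derivative (\<lambda>r. r *\<^sub>R u)) (at s)"
      by (auto intro!: derivative_eq_intros)
    from has_derivative_compose[OF this d]
    show ?thesis
      using linear_scale[OF has_derivative_linear[OF d]]
      by (auto simp: has_field_derivative_def Df_def fun_eq_iff mult.commute elim!: has_derivative_eq_rhs)
  qed
  have d2: "((\<lambda>t. Df (x + s *\<^sub>R u + t *\<^sub>R v)) has_real_derivative
      frechet_derivative Df (at (x + s *\<^sub>R u + t *\<^sub>R v)) v) (at t)"
    if "0 \<le> s" "s \<le> h" "0 \<le> t" "t \<le> h" for s t
  proof -
    have d: "(Df has_derivative frechet_derivative Df (at (x + s *\<^sub>R u + t *\<^sub>R v))) (at (x + s *\<^sub>R u + t *\<^sub>R v))"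
      unfolding Df_def by (rule smooth_at_has_derivative[OF smooth_at_deriv_const[OF sm[OF that]]])
    have "((\<lambda>t. x + s *\<^sub>R u + t *\<^sub>R v) has_derivative (\<lambda>r. r *\<^sub>R v)) (at t)"
      by (auto intro!: derivative_eq_intros)
    from has_derivative_compose[OF this d]
    show ?thesis
      using linear_scale[OF has_derivative_linear[OF d]]
      by (auto simp: has_field_derivative_def fun_eq_iff mult.commute elim!: has_derivative_eq_rhs)
  qed
  \<comment> \<open>The mean value theorem is used in \<open>s\<close> for the increment of
    \<open>f\<close> in \<open>t\<close>, and afterwards in \<open>t\<close> for \<open>Df\<close>.
    The summand \<open>0 *\<^sub>R v\<close> keeps the shape required by \<open>d1\<close>.\<close>
  define g where "g = (\<lambda>s. f (x + s *\<^sub>R u + h *\<^sub>R v) - f (x + s *\<^sub>R u + 0 *\<^sub>R v))"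
  have "\<exists>s>0. s < h \<and> g h - g 0 = (h - 0) * (Df (x + s *\<^sub>R u + h *\<^sub>R v) - Df (x + s *\<^sub>R u + 0 *\<^sub>R v))"
    unfolding g_def using h by (intro MVT2 DERIV_diff d1) auto
  then obtain s where s: "0 < s" "s < h"
    "g h - g 0 = h * (Df (x + s *\<^sub>R u + h *\<^sub>R v) - Df (x + s *\<^sub>R u + 0 *\<^sub>R v))" by auto
  have "\<exists>t>0. t < h \<and> Df (x + s *\<^sub>R u + h *\<^sub>R v) - Df (x + s *\<^sub>R u + 0 *\<^sub>R v)
      = (h - 0) * frechet_derivative Df (at (x + s *\<^sub>R u + t *\<^sub>R v)) v"
    using h s by (intro MVT2 d2) auto
  then obtain t where t: "0 < t" "t < h" "Df (x + s *\<^sub>R u + h *\<^sub>R v) - Df (x + s *\<^sub>R u + 0 *\<^sub>R v)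
      = h * frechet_derivative Df (at (x + s *\<^sub>R u + t *\<^sub>R v)) v" by auto
  show ?thesis
    by (rule that[OF s(1,2) t(1,2)]) (use s(3) t(3) in \<open>simp add: g_def Df_def\<close>)
qed

lemma second_derivative_symmetric:
  fixes f :: "'a::real_normed_vector \<Rightarrow> real"
  assumes "smooth_at f x"
  shows "frechet_derivative (\<lambda>y. frechet_derivative f (at y) u) (at x) v
       = frechet_derivative (\<lambda>y. frechet_derivative f (at y) v) (at x) u"
proof -
  define P where "P = (\<lambda>u v y. frechet_derivative (\<lambda>y. frechet_derivative f (at y) u) (at y) v)"
  have cont: "isCont (P u v) x" for u v
    unfolding P_def by (intro smooth_at_isCont smooth_at_deriv_const assms)
  have "\<bar>P u v x - P v u x\<bar> < e" if e: "0 < e" for e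
  proof -
    have "\<forall>\<^sub>F y in nhds x. dist (P u v y) (P u v x) < e / 2 \<and> dist (P v u y) (P v u x) < e / 2
        \<and> smooth_at f y"
      using cont[of u v] cont[of v u] e
      by (intro eventually_conj smooth_at_eventually assms)
        (auto simp: isCont_def tendsto_at_iff_tendsto_nhds simp del: less_divide_eq_numeral1
          intro!: tendstoD)
    then obtain d where d: "0 < d" "\<And>y. dist y x < d \<Longrightarrow>
        dist (P u v y) (P u v x) < e / 2 \<and> dist (P v u y) (P v u x) < e / 2 \<and> smooth_at f y"
      by (auto simp: eventually_nhds_metric)
    \<comment> \<open>With this side length the parallelogram spanned by
      \<open>h *\<^sub>R u\<close> and \<open>h *\<^sub>R v\<close> at \<open>x\<close> stays in the
      ball of radius \<open>d\<close>; the summand 1 covers u = v = 0 and makes the estimate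
      strict.\<close>
    define h where "h = d / (norm u + norm v + 1)"
    have h: "0 < h" unfolding h_def using d(1) by (auto intro!: divide_pos_pos add_nonneg_pos)
    have near: "dist (x + s *\<^sub>R u + t *\<^sub>R v) x < d" if "0 \<le> s" "s \<le> h" "0 \<le> t" "t \<le> h" for s t
    proof -
      have "dist (x + s *\<^sub>R u + t *\<^sub>R v) x \<le> s * norm u + t * norm v"
        using that norm_triangle_ineq[of "s *\<^sub>R u" "t *\<^sub>R v"] by (simp add: dist_norm add.assoc)
      also have "\<dots> \<le> h * norm u + h * norm v"
        using that by (intro add_mono mult_right_mono) auto
      also have "\<dots> < h * (norm u + norm v + 1)"
        using h by (simp add: algebra_simps)
      also have "\<dots> = d"
        using add_nonneg_pos[of "norm u + norm v" 1] by (simp add: h_def)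
      finally show ?thesis .
    qed
    obtain s t where st: "0 < s" "s < h" "0 < t" "t < h"
      "f (x + h *\<^sub>R u + h *\<^sub>R v) - f (x + h *\<^sub>R u) - f (x + h *\<^sub>R v) + f x
        = h * h * P u v (x + s *\<^sub>R u + t *\<^sub>R v)"
      unfolding P_def by (rule second_difference[of h f x u v]) (use h near d(2) in auto)
    have "smooth_at f (x + s *\<^sub>R v + t *\<^sub>R u)" if "0 \<le> s" "s \<le> h" "0 \<le> t" "t \<le> h" for s t
      using near[of t s] d(2) that by (metis add.assoc add.commute)
    then obtain s' t' where st': "0 < s'" "s' < h" "0 < t'" "t' < h"
      "f (x + h *\<^sub>R v + h *\<^sub>R u) - f (x + h *\<^sub>R v) - f (x + h *\<^sub>R u) + f x
        = h * h * P v u (x + s' *\<^sub>R v + t' *\<^sub>R u)"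
      unfolding P_def using second_difference[of h f x v u] h by blast
    have c: "x + h *\<^sub>R v + h *\<^sub>R u = x + h *\<^sub>R u + h *\<^sub>R v"
      "x + s' *\<^sub>R v + t' *\<^sub>R u = x + t' *\<^sub>R u + s' *\<^sub>R v"
      by (simp_all add: add_ac)
    have "h * h * P u v (x + s *\<^sub>R u + t *\<^sub>R v) = h * h * P v u (x + t' *\<^sub>R u + s' *\<^sub>R v)"
      using st(5) st'(5)[unfolded c] by linarith
    then have "P u v (x + s *\<^sub>R u + t *\<^sub>R v) = P v u (x + t' *\<^sub>R u + s' *\<^sub>R v)"
      using h by simp
    moreover have "dist (P u v (x + s *\<^sub>R u + t *\<^sub>R v)) (P u v x) < e / 2"
      using d(2) near[of s t] st by simp
    moreover have "dist (P v u (x + t' *\<^sub>R u + s' *\<^sub>R v)) (P v u x) < e / 2"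
      using d(2) near[of t' s'] st' by simp
    ultimately show ?thesis unfolding dist_real_def by linarith
  qed
  then have "P u v x = P v u x"
    by (metis abs_ge_zero abs_zero eq_iff_diff_eq_0 less_irrefl zero_less_abs_iff)
  then show ?thesis by (simp add: P_def)
qed


text \<open>The exponent \<open>n\<close> makes the span of the family closed under differentiation.\<close>

definition flat_exp :: "nat \<Rightarrow> real \<Rightarrow> real" where
  "flat_exp n t = (if t > 0 then inverse t ^ n * exp (- inverse t) else 0)"

text \<open>To the right of 0 the substitution u = 1 / t reduces this to u^n / exp u tending to 0 at
  infinity; to the left the function is constantly 0.\<close>

lemma flat_exp_tendsto_0: "(flat_exp n \<longlongrightarrow> 0) (at 0)"
proof -
  have "((\<lambda>u::real. u ^ n / exp u) \<longlongrightarrow> 0) at_top"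
    by (rule tendsto_power_div_exp_0)
  then have "((\<lambda>t::real. inverse t ^ n / exp (inverse t)) \<longlongrightarrow> 0) (at_right 0)"
    by (rule filterlim_compose[OF _ filterlim_inverse_at_top_right])
  then have r: "(flat_exp n \<longlongrightarrow> 0) (at_right 0)"
    by (rule Lim_transform_eventually)
      (auto simp: flat_exp_def exp_minus field_simps eventually_at_right_less
        intro!: eventually_at_rightI[of 0 1])
  have l: "(flat_exp n \<longlongrightarrow> 0) (at_left 0)"
    by (rule Lim_transform_eventually[OF tendsto_const])
      (auto simp: flat_exp_def intro!: eventually_at_leftI[of "-1"])
  show ?thesis
    using l r by (simp add: filterlim_split_at)
qed

text \<open>Only t = 0 is delicate: there the difference quotient of \<open>flat_exp n\<close> is
  \<open>flat_exp (n + 1)\<close>, whose limit is 0.\<close>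

lemma flat_exp_deriv:
  "(flat_exp n has_real_derivative flat_exp (n + 2) t - real n * flat_exp (n + 1) t) (at t)"
proof (cases t "0::real" rule: linorder_cases)
  case less
  have "((\<lambda>t. 0) has_real_derivative flat_exp (n + 2) t - real n * flat_exp (n + 1) t) (at t)"
    using less by (simp add: flat_exp_def)
  then show ?thesis
    by (rule has_field_derivative_transform_within_open[where S = "{..<0}"])
      (use less in \<open>auto simp: flat_exp_def\<close>)
next
  case equal
  have "((\<lambda>h. (flat_exp n (0 + h) - flat_exp n 0) / h) \<longlongrightarrow> 0) (at 0)"
    by (rule Lim_transform_eventually[OF flat_exp_tendsto_0[of "n + 1"]])
      (auto simp: flat_exp_def field_simps)
  then show ?thesis
    unfolding equal DERIV_def by (simp add: flat_exp_def)
next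
  case greater
  have p: "m = 0 \<or> inverse t ^ m = inverse t * inverse t ^ (m - Suc 0)" for m
    by (cases m) auto
  have "((\<lambda>t. inverse t ^ n * exp (- inverse t)) has_real_derivative
      flat_exp (n + 2) t - real n * flat_exp (n + 1) t) (at t)"
    using greater p[of "n - 1"]
    by (cases n) (auto intro!: derivative_eq_intros simp: flat_exp_def power2_eq_square algebra_simps)
  then show ?thesis
    by (rule has_field_derivative_transform_within_open[where S = "{0<..}"])
      (use greater in \<open>auto simp: flat_exp_def\<close>)
qed

text \<open>By \<open>flat_exp_deriv\<close> every derivative is a combination of members of the
  same family, so the induction runs over all \<open>n\<close> at once.\<close>

lemma smooth_at_flat_exp: "smooth_at (flat_exp n) t"
proof -
  have "Ck_on k UNIV (flat_exp n)" for k
  proof (induction k arbitrary: n)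
    case 0
    then show ?case
      using DERIV_isCont[OF flat_exp_deriv] by (auto intro!: continuous_at_imp_continuous_on)
  next
    case (Suc k)
    have d: "(flat_exp n has_derivative (\<lambda>v. v * (flat_exp (n + 2) t + (- real n) * flat_exp (n + 1) t))) (at t)" for t
      using flat_exp_deriv[of n t] by (simp add: has_field_derivative_def mult.commute[of _ "_ - _"])
    show ?case
      by (rule Ck_on_SucI[OF open_UNIV d])
        (intro Ck_on_bounded_bilinear[OF bounded_bilinear_mult] Ck_on_add Ck_on_const Suc.IH open_UNIV)
  qed
  then show ?thesis
    by (intro smooth_atI[of UNIV]) (auto simp: smooth_on_def)
qed

lemma smooth_at_flat_exp_compose [intro]:
  "smooth_at f x \<Longrightarrow> smooth_at (\<lambda>x. flat_exp n (f x)) x"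
  by (rule smooth_at_compose_real[OF smooth_at_flat_exp])

lemma flat_exp_pos_iff [simp]: "0 < flat_exp n t \<longleftrightarrow> 0 < t"
  by (auto simp: flat_exp_def)

lemma flat_exp_eq_0_iff [simp]: "flat_exp n t = 0 \<longleftrightarrow> t \<le> 0"
  by (auto simp: flat_exp_def)

lemma flat_exp_nonneg [simp]: "0 \<le> flat_exp n t"
  by (auto simp: flat_exp_def)

lemma frechet_derivative_slice:
  assumes "smooth_at f (x, y)"
  shows "frechet_derivative (\<lambda>x'. f (x', y)) (at x) v = frechet_derivative f (at (x, y)) (v, 0)"
proof -
  have "((\<lambda>x'. (x', y)) has_derivative (\<lambda>v. (v, 0))) (at x)"
    by (intro has_derivative_Pair has_derivative_ident has_derivative_const)
  from has_derivative_compose[OF this smooth_at_has_derivative[OF assms]]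
  show ?thesis by (simp add: frechet_derivative_eqI)
qed

lemma frechet_derivative_eventually_eqI:
  assumes "(f has_derivative D) (at x)" "\<forall>\<^sub>F y in nhds x. f y = g y"
  shows "frechet_derivative g (at x) = D"
  using frechet_derivative_cong[OF assms(2)] frechet_derivative_eqI[OF assms(1)] by simp

lemma filterlim_fst_nhds: "filterlim fst (nhds a) (nhds (a, b))"
  using tendsto_fst[of "\<lambda>z. z" "(a, b)" "nhds (a, b)"] by (simp add: filterlim_ident)

lemma filterlim_snd_nhds: "filterlim snd (nhds b) (nhds (a, b))"
  using tendsto_snd[of "\<lambda>z. z" "(a, b)" "nhds (a, b)"] by (simp add: filterlim_ident)

lemma eventually_nhds_fst: "eventually P (nhds a) \<Longrightarrow> \<forall>\<^sub>F z in nhds (a, b). P (fst z)"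
  using filterlim_fst_nhds[of a b] unfolding filterlim_iff by blast

lemma eventually_nhds_snd: "eventually P (nhds b) \<Longrightarrow> \<forall>\<^sub>F z in nhds (a, b). P (snd z)"
  using filterlim_snd_nhds[of b a] unfolding filterlim_iff by blast

text \<open>Heine-Borel for the model space. By Cauchy-Schwarz \<open>R\<close> bounds all frame
  coefficients of points of the ball, so the ball is a closed subset of a finite sum of compact
  segments.\<close>

lemma compact_cball_frame:
  fixes E :: "'a::real_inner set"
  assumes "frame E"
  shows "compact (cball a r :: 'a set)"
proof -
  define R where "R = (norm a + \<bar>r\<bar>) * (\<Sum>b\<in>E. norm b)"
  have "\<exists>K. compact K \<and> (\<forall>t. (\<forall>b\<in>F. \<bar>t b\<bar> \<le> R) \<longrightarrow> (\<Sum>b\<in>F. t b *\<^sub>R b) \<in> K)" if "finite F" for F :: "'a set"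
    using that
  proof (induction F)
    case empty
    show ?case by (auto intro!: exI[of _ "{0}"])
  next
    case (insert b F)
    then obtain K where K: "compact K" "\<forall>t. (\<forall>b\<in>F. \<bar>t b\<bar> \<le> R) \<longrightarrow> (\<Sum>b\<in>F. t b *\<^sub>R b) \<in> K"
      by blast
    have "compact ((\<lambda>s. s *\<^sub>R b) ` {-R..R})"
      by (intro compact_continuous_image continuous_intros) auto
    note compact_sums[OF this K(1)]
    moreover have "(\<Sum>b\<in>insert b F. t b *\<^sub>R b) \<in> {x + y |x y. x \<in> (\<lambda>s. s *\<^sub>R b) ` {-R..R} \<and> y \<in> K}"
      if t: "\<forall>b\<in>insert b F. \<bar>t b\<bar> \<le> R" for t
    proof -
      have "t b *\<^sub>R b \<in> (\<lambda>s. s *\<^sub>R b) ` {-R..R}"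
        using t by (intro imageI) auto
      moreover have "(\<Sum>b\<in>F. t b *\<^sub>R b) \<in> K"
        using t K(2) by simp
      ultimately show ?thesis using insert.hyps by auto
    qed
    ultimately show ?case by blast
  qed
  from this[OF frame_finite[OF assms]]
  obtain K where K: "compact K" "\<And>t. (\<forall>b\<in>E. \<bar>t b\<bar> \<le> R) \<Longrightarrow> (\<Sum>b\<in>E. t b *\<^sub>R b) \<in> K"
    by blast
  have "cball a r \<subseteq> K"
  proof
    fix x assume x: "x \<in> cball a r"
    have "norm x \<le> norm a + \<bar>r\<bar>"
      using x norm_triangle_ineq2[of x a] by (auto simp: dist_norm norm_minus_commute)
    moreover have "norm b \<le> (\<Sum>b\<in>E. norm b)" if "b \<in> E" for b
      using that frame_finite[OF assms] by (intro member_le_sum) auto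
    ultimately have "\<forall>b\<in>E. \<bar>x \<bullet> b\<bar> \<le> R"
      unfolding R_def by (meson Cauchy_Schwarz_ineq2 mult_mono' norm_ge_zero order_trans)
    from K(2)[OF this] show "x \<in> K"
      using frame_expand[OF assms] by simp
  qed
  then show ?thesis
    using K(1) closed_cball compact_Int_closed[of K "cball a r"] by (simp add: Int_absorb1)
qed

section \<open>Smooth functions and tangent vectors on a manifold\<close>

locale manifold =
  fixes A :: "('m::{t2_space, second_countable_topology}, 'e::real_inner) chart set"
  assumes smooth_manifold: "smooth_manifold A"
begin

definition E :: "'e set" where
  "E = (SOME E. frame E \<and> (\<forall>a\<in>E. \<forall>b\<in>E. a \<bullet> b = (if a = b then 1 else 0)))"

lemma
  shows frame_E: "frame E"
    and inner_E: "a \<in> E \<Longrightarrow> b \<in> E \<Longrightarrow> a \<bullet> b = (if a = b then 1 else 0)"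
proof -
  obtain B :: "'e set" where "finite B" "span B = UNIV"
    using smooth_manifold by (auto simp: smooth_manifold_def)
  from someI_ex[OF frame_exists[OF this]]
  have *: "frame E \<and> (\<forall>a\<in>E. \<forall>b\<in>E. a \<bullet> b = (if a = b then 1 else 0))"
    unfolding E_def .
  then show "frame E" by (rule conjunct1)
  show "a \<in> E \<Longrightarrow> b \<in> E \<Longrightarrow> a \<bullet> b = (if a = b then 1 else 0)"
    using * by blast
qed

lemmas finite_E = frame_finite[OF frame_E]
lemmas frame_EE = frame_Times[OF frame_E frame_E]

lemma charts_at_iff: "c \<in> charts_at A p \<longleftrightarrow> c \<in> A \<and> p \<in> chart_dom c"
  by (simp add: charts_at_def)

lemma ex_chart: obtains c where "c \<in> charts_at A p"
  using smooth_manifold unfolding smooth_manifold_def charts_at_def by blast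

lemma topological_chart: "c \<in> A \<Longrightarrow> topological_chart c"
  using smooth_manifold by (simp add: smooth_manifold_def)

lemma open_chart_dom: "c \<in> A \<Longrightarrow> open (chart_dom c)"
  and open_chart_image: "c \<in> A \<Longrightarrow> open (chart_map c ` chart_dom c)"
  using topological_chart by (auto simp: topological_chart_def)

lemma chart_inv_chart_map [simp]: "c \<in> A \<Longrightarrow> p \<in> chart_dom c \<Longrightarrow> chart_inv c (chart_map c p) = p"
  using topological_chart[of c] by (auto simp: topological_chart_def homeomorphism_def)

lemma inj_on_chart: "c \<in> A \<Longrightarrow> inj_on (chart_map c) (chart_dom c)"
  by (metis chart_inv_chart_map inj_on_inverseI)

lemma chart_inv_in [simp]: "x \<in> chart_map c ` chart_dom c \<Longrightarrow> chart_inv c x \<in> chart_dom c"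
  by (simp add: chart_inv_def inv_into_into)

lemma chart_map_chart_inv [simp]: "x \<in> chart_map c ` chart_dom c \<Longrightarrow> chart_map c (chart_inv c x) = x"
  by (simp add: chart_inv_def f_inv_into_f)

lemma chart_inv_tendsto:
  assumes "c \<in> charts_at A p"
  shows "filterlim (chart_inv c) (nhds p) (nhds (chart_map c p))"
proof -
  have "continuous_on (chart_map c ` chart_dom c) (chart_inv c)"
    using assms topological_chart[of c] by (auto simp: charts_at_iff topological_chart_def homeomorphism_def)
  then have "isCont (chart_inv c) (chart_map c p)"
    using assms open_chart_image by (simp add: continuous_on_eq_continuous_at charts_at_iff)
  then show ?thesis
    using assms by (simp add: isCont_def tendsto_at_iff_tendsto_nhds charts_at_iff)
qed

lemma chart_map_tendsto:
  assumes "c \<in> charts_at A p"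
  shows "filterlim (chart_map c) (nhds (chart_map c p)) (nhds p)"
proof -
  have "continuous_on (chart_dom c) (chart_map c)"
    using assms topological_chart[of c] by (auto simp: charts_at_iff topological_chart_def homeomorphism_def)
  then have "isCont (chart_map c) p"
    using assms open_chart_dom by (simp add: continuous_on_eq_continuous_at charts_at_iff)
  then show ?thesis
    by (simp add: isCont_def tendsto_at_iff_tendsto_nhds)
qed

lemma eventually_chart_image:
  "c \<in> charts_at A p \<Longrightarrow> \<forall>\<^sub>F x in nhds (chart_map c p). x \<in> chart_map c ` chart_dom c"
  by (auto simp: charts_at_iff intro!: eventually_nhds_in_open open_chart_image)

lemma eventually_chart_inv:
  "c \<in> charts_at A p \<Longrightarrow> eventually P (nhds p) \<Longrightarrow> \<forall>\<^sub>F x in nhds (chart_map c p). P (chart_inv c x)"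
  using chart_inv_tendsto by (simp add: filterlim_iff)

lemma eventually_charts_at: "c \<in> charts_at A p \<Longrightarrow> \<forall>\<^sub>F q in nhds p. c \<in> charts_at A q"
  by (auto simp: charts_at_iff intro: eventually_mono[OF eventually_nhds_in_open[OF open_chart_dom]])

lemma eventually_chart_inv_charts_at:
  "c \<in> charts_at A p \<Longrightarrow> d \<in> charts_at A p \<Longrightarrow>
    \<forall>\<^sub>F x in nhds (chart_map c p). d \<in> charts_at A (chart_inv c x)"
  using eventually_chart_inv eventually_charts_at by blast

lemma open_chart_image_Int:
  assumes "c \<in> A" "open U"
  shows "open (chart_map c ` (chart_dom c \<inter> U))"
proof -
  have "continuous_on (chart_map c ` chart_dom c) (chart_inv c)"
    using assms topological_chart[of c] by (auto simp: topological_chart_def homeomorphism_def)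
  then have "open (chart_map c ` chart_dom c \<inter> chart_inv c -` U)"
    using assms open_chart_image by (intro continuous_open_preimage) auto
  also have "chart_map c ` chart_dom c \<inter> chart_inv c -` U = chart_map c ` (chart_dom c \<inter> U)"
    using assms by auto
  finally show ?thesis .
qed

lemma smooth_at_transition:
  assumes "c \<in> charts_at A p" "d \<in> charts_at A p"
  shows "smooth_at (transition c d) (chart_map c p)"
proof (rule smooth_atI)
  show "open (chart_map c ` (chart_dom c \<inter> chart_dom d))"
    using assms by (auto simp: charts_at_iff intro!: open_chart_image_Int open_chart_dom)
  show "smooth_on (chart_map c ` (chart_dom c \<inter> chart_dom d)) (transition c d)"
    using assms smooth_manifold by (simp add: charts_at_iff smooth_manifold_def)
qed (use assms in \<open>auto simp: charts_at_iff\<close>)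

lemma transition_chart_map [simp]: "c \<in> charts_at A p \<Longrightarrow> transition c d (chart_map c p) = chart_map d p"
  by (simp add: transition_def charts_at_iff)

text \<open>The chain rule for transition maps, whose composition law holds near the point, though
  not on all of their domains.\<close>

lemma transition_derivative_compose:
  assumes "c \<in> charts_at A p" "d \<in> charts_at A p" "e \<in> charts_at A p"
  shows "frechet_derivative (transition d e) (at (chart_map d p))
      (frechet_derivative (transition c d) (at (chart_map c p)) v)
    = frechet_derivative (transition c e) (at (chart_map c p)) v"
proof -
  have "((\<lambda>x. transition d e (transition c d x)) has_derivative
      (\<lambda>v. frechet_derivative (transition d e) (at (chart_map d p))
      (frechet_derivative (transition c d) (at (chart_map c p)) v))) (at (chart_map c p))"
    using has_derivative_compose[OF smooth_at_has_derivative[OF smooth_at_transition[OF assms(1,2)]]]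
      smooth_at_has_derivative[OF smooth_at_transition[OF assms(2,3)]] assms by simp
  moreover have "\<forall>\<^sub>F x in nhds (chart_map c p). transition d e (transition c d x) = transition c e x"
    using eventually_chart_inv_charts_at[OF assms(1,2)]
    by eventually_elim (auto simp: transition_def charts_at_iff)
  ultimately have "frechet_derivative (transition c e) (at (chart_map c p))
      = (\<lambda>v. frechet_derivative (transition d e) (at (chart_map d p))
      (frechet_derivative (transition c d) (at (chart_map c p)) v))"
    by (rule frechet_derivative_eventually_eqI)
  then show ?thesis by simp
qed

lemma transition_derivative_self:
  assumes "c \<in> charts_at A p"
  shows "frechet_derivative (transition c c) (at (chart_map c p)) v = v"
proof -
  have "\<forall>\<^sub>F x in nhds (chart_map c p). x = transition c c x"
    using eventually_chart_image[OF assms] by eventually_elim (simp add: transition_def)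
  from frechet_derivative_cong[OF this] show ?thesis
    by (metis frechet_derivative_ident)
qed

lemma linear_transition_derivative:
  "c \<in> charts_at A p \<Longrightarrow> d \<in> charts_at A p \<Longrightarrow> linear (frechet_derivative (transition c d) (at (chart_map c p)))"
  using smooth_at_transition smooth_at_has_derivative has_derivative_linear by blast

section \<open>Tangent spaces and coordinate vectors\<close>

lemma tangent_spaceI:
  assumes "\<And>c d. c \<in> charts_at A p \<Longrightarrow> d \<in> charts_at A p \<Longrightarrow>
      frechet_derivative (transition c d) (at (chart_map c p)) (v c) = v d"
    and "\<And>c. c \<notin> charts_at A p \<Longrightarrow> v c = 0"
  shows "v \<in> tangent_space A p"
  using assms unfolding tangent_space_def by simp

lemma tangent_spaceD:
  "v \<in> tangent_space A p \<Longrightarrow> c \<in> charts_at A p \<Longrightarrow> d \<in> charts_at A p \<Longrightarrow>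
      frechet_derivative (transition c d) (at (chart_map c p)) (v c) = v d"
  unfolding tangent_space_def mem_Collect_eq by (elim conjE, drule (1) bspec, drule (1) bspec, erule sym)

lemma tangent_space_outside: "v \<in> tangent_space A p \<Longrightarrow> c \<notin> charts_at A p \<Longrightarrow> v c = 0"
  unfolding tangent_space_def by blast

lemma tangent_space_add:
  assumes "u \<in> tangent_space A p" "v \<in> tangent_space A p"
  shows "tv_add u v \<in> tangent_space A p"
  unfolding tv_add_def
  by (rule tangent_spaceI)
    (simp_all add: linear_add[OF linear_transition_derivative] assms[THEN tangent_spaceD]
      assms[THEN tangent_space_outside])

lemma tangent_space_scale:
  assumes "u \<in> tangent_space A p"
  shows "tv_scale a u \<in> tangent_space A p"
  unfolding tv_scale_def
  by (rule tangent_spaceI)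
    (simp_all add: linear_scale[OF linear_transition_derivative] assms[THEN tangent_spaceD]
      assms[THEN tangent_space_outside])

lemma tangent_space_zero: "tv_zero \<in> tangent_space A p"
  unfolding tv_zero_def by (rule tangent_spaceI) (simp_all add: linear_0[OF linear_transition_derivative])

lemma coord_vec_in_tangent_space: "c \<in> charts_at A p \<Longrightarrow> coord_vec A c p e \<in> tangent_space A p"
  by (rule tangent_spaceI) (simp_all add: coord_vec_def transition_derivative_compose)

lemma coord_vec_self [simp]: "c \<in> charts_at A p \<Longrightarrow> coord_vec A c p e c = e"
  by (simp add: coord_vec_def transition_derivative_self)

lemma coord_vec_coord:
  assumes "c \<in> charts_at A p" "v \<in> tangent_space A p"
  shows "coord_vec A c p (v c) = v"
  using assms by (intro ext) (simp add: coord_vec_def tangent_spaceD tangent_space_outside)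

lemma tangent_space_eqI:
  "u \<in> tangent_space A p \<Longrightarrow> v \<in> tangent_space A p \<Longrightarrow> c \<in> charts_at A p \<Longrightarrow> u c = v c \<Longrightarrow> u = v"
  by (metis coord_vec_coord)

lemma coord_vec_add: "coord_vec A c p (e + f) = tv_add (coord_vec A c p e) (coord_vec A c p f)"
  if "c \<in> charts_at A p"
  using that by (intro ext) (simp add: coord_vec_def tv_add_def linear_add[OF linear_transition_derivative])

lemma coord_vec_scale: "coord_vec A c p (a *\<^sub>R e) = tv_scale a (coord_vec A c p e)"
  if "c \<in> charts_at A p"
  using that by (intro ext) (simp add: coord_vec_def tv_scale_def linear_scale[OF linear_transition_derivative])

section \<open>Smooth functions, smooth fields and derivations at a point\<close>

definition smooth_fun_at :: "('m \<Rightarrow> real) \<Rightarrow> 'm \<Rightarrow> bool" where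
  "smooth_fun_at f p \<longleftrightarrow> (\<forall>c\<in>charts_at A p. smooth_at (\<lambda>x. f (chart_inv c x)) (chart_map c p))"

definition smooth_fun2_at :: "('m \<Rightarrow> 'm \<Rightarrow> real) \<Rightarrow> 'm \<Rightarrow> 'm \<Rightarrow> bool" where
  "smooth_fun2_at f p q \<longleftrightarrow> (\<forall>c\<in>charts_at A p. \<forall>d\<in>charts_at A q.
     smooth_at (\<lambda>(x, y). f (chart_inv c x) (chart_inv d y)) (chart_map c p, chart_map d q))"

text \<open>Tangency is demanded only near \<open>p\<close>, so that the coordinate fields of a
  chart qualify at the points of its domain; near \<open>p\<close> it is what carries smoothness
  from one chart to another.\<close>

definition smooth_field_at :: "('m, 'e) vfield \<Rightarrow> 'm \<Rightarrow> bool" where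
  "smooth_field_at X p \<longleftrightarrow> (\<forall>\<^sub>F q in nhds p. X q \<in> tangent_space A q) \<and>
    (\<forall>c\<in>charts_at A p. smooth_at (\<lambda>x. X (chart_inv c x) c) (chart_map c p))"

text \<open>\<open>lie_deriv\<close> reads its field only at the point, so the constant family may
  be passed although it is not a vector field.\<close>

definition tangent_deriv :: "'m \<Rightarrow> ('m, 'e) tv \<Rightarrow> ('m \<Rightarrow> real) \<Rightarrow> real" where
  "tangent_deriv p u f = lie_deriv A (\<lambda>_. u) f p"

lemma smooth_fun_atI:
  assumes c: "c \<in> charts_at A p" and sm: "smooth_at (\<lambda>x. f (chart_inv c x)) (chart_map c p)"
  shows "smooth_fun_at f p"
  unfolding smooth_fun_at_def
proof
  fix d assume d: "d \<in> charts_at A p"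
  have "\<forall>\<^sub>F x in nhds (chart_map d p). f (chart_inv c (transition d c x)) = f (chart_inv d x)"
    using eventually_chart_inv_charts_at[OF d c] by eventually_elim (auto simp: transition_def charts_at_iff)
  moreover have "smooth_at (\<lambda>x. f (chart_inv c (transition d c x))) (chart_map d p)"
    using sm d by (intro smooth_at_compose[OF frame_E _ smooth_at_transition[OF d c]]) simp
  ultimately show "smooth_at (\<lambda>x. f (chart_inv d x)) (chart_map d p)"
    by (rule smooth_at_cong)
qed

lemma smooth_fun_atD: "smooth_fun_at f p \<Longrightarrow> c \<in> charts_at A p \<Longrightarrow> smooth_at (\<lambda>x. f (chart_inv c x)) (chart_map c p)"
  by (simp add: smooth_fun_at_def)

lemma smooth_fun2_atI:
  assumes c: "c \<in> charts_at A p" and d: "d \<in> charts_at A q"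
    and sm: "smooth_at (\<lambda>(x, y). f (chart_inv c x) (chart_inv d y)) (chart_map c p, chart_map d q)"
  shows "smooth_fun2_at f p q"
  unfolding smooth_fun2_at_def
proof (intro ballI)
  fix c' d' assume c': "c' \<in> charts_at A p" and d': "d' \<in> charts_at A q"
  let ?t = "\<lambda>z. (transition c' c (fst z), transition d' d (snd z))"
  let ?f = "\<lambda>(x, y). f (chart_inv c x) (chart_inv d y)"
  have "\<forall>\<^sub>F z in nhds (chart_map c' p, chart_map d' q).
      ?f (?t z) = (case z of (x, y) \<Rightarrow> f (chart_inv c' x) (chart_inv d' y))"
    using eventually_nhds_fst[OF eventually_chart_inv_charts_at[OF c' c]]
      eventually_nhds_snd[OF eventually_chart_inv_charts_at[OF d' d]]
    by eventually_elim (auto simp: transition_def charts_at_iff split: prod.splits)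
  moreover have "smooth_at (\<lambda>z. ?f (?t z)) (chart_map c' p, chart_map d' q)"
  proof (rule smooth_at_compose[OF frame_EE])
    show "smooth_at ?f (?t (chart_map c' p, chart_map d' q))"
      using sm c' d' by simp
    show "smooth_at ?t (chart_map c' p, chart_map d' q)"
      by (intro smooth_at_Pair smooth_at_compose[OF frame_E _ smooth_at_fst[OF smooth_at_ident]]
          smooth_at_compose[OF frame_E _ smooth_at_snd[OF smooth_at_ident]])
        (simp_all add: smooth_at_transition c c' d d')
  qed
  ultimately show "smooth_at (\<lambda>(x, y). f (chart_inv c' x) (chart_inv d' y)) (chart_map c' p, chart_map d' q)"
    by (rule smooth_at_cong)
qed

lemma smooth_fun2_atD: "smooth_fun2_at f p q \<Longrightarrow> c \<in> charts_at A p \<Longrightarrow> d \<in> charts_at A q \<Longrightarrow>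
    smooth_at (\<lambda>(x, y). f (chart_inv c x) (chart_inv d y)) (chart_map c p, chart_map d q)"
  by (simp add: smooth_fun2_at_def)

lemma smooth_fun_at_cong:
  assumes "\<forall>\<^sub>F q in nhds p. f q = g q" "smooth_fun_at f p"
  shows "smooth_fun_at g p"
  unfolding smooth_fun_at_def
proof
  fix c assume c: "c \<in> charts_at A p"
  show "smooth_at (\<lambda>x. g (chart_inv c x)) (chart_map c p)"
    using smooth_at_cong[OF eventually_chart_inv[OF c assms(1)] smooth_fun_atD[OF assms(2) c]] .
qed

lemma smooth_fun2_at_cong:
  assumes "\<forall>\<^sub>F z in nhds (p, q). f (fst z) (snd z) = g (fst z) (snd z)" "smooth_fun2_at f p q"
  shows "smooth_fun2_at g p q"
  unfolding smooth_fun2_at_def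
proof (intro ballI)
  fix c d assume c: "c \<in> charts_at A p" and d: "d \<in> charts_at A q"
  have "filterlim (\<lambda>z. (chart_inv c (fst z), chart_inv d (snd z))) (nhds (p, q)) (nhds (chart_map c p, chart_map d q))"
    by (intro tendsto_Pair filterlim_compose[OF chart_inv_tendsto[OF c] filterlim_fst_nhds]
        filterlim_compose[OF chart_inv_tendsto[OF d] filterlim_snd_nhds])
  then have "\<forall>\<^sub>F z in nhds (chart_map c p, chart_map d q).
      f (chart_inv c (fst z)) (chart_inv d (snd z)) = g (chart_inv c (fst z)) (chart_inv d (snd z))"
    using assms(1) by (auto simp: filterlim_iff)
  then show "smooth_at (\<lambda>(x, y). g (chart_inv c x) (chart_inv d y)) (chart_map c p, chart_map d q)"
    using smooth_fun2_atD[OF assms(2) c d] by (auto intro: smooth_at_cong simp: case_prod_unfold)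
qed

lemma smooth_fun2_at_slice: 
  assumes "smooth_fun2_at f p q" shows "smooth_fun_at (\<lambda>x. f x q) p"
proof -
  obtain c d where c: "c \<in> charts_at A p" and d: "d \<in> charts_at A q"
    using ex_chart by metis
  have "smooth_at (\<lambda>x. case (x, chart_map d q) of (x, y) \<Rightarrow> f (chart_inv c x) (chart_inv d y)) (chart_map c p)"
    by (rule smooth_at_compose[OF frame_EE, where g = "\<lambda>x. (x, chart_map d q)"])
      (auto simp: smooth_fun2_atD[OF assms c d])
  then show ?thesis
    using c d by (intro smooth_fun_atI[OF c]) (simp add: charts_at_iff)
qed

lemma smooth_fun2_at_diag: 
  assumes "smooth_fun2_at f p p" shows "smooth_fun_at (\<lambda>x. f x x) p"
proof -
  obtain c where c: "c \<in> charts_at A p"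
    using ex_chart by metis
  have "smooth_at (\<lambda>x. case (x, x) of (x, y) \<Rightarrow> f (chart_inv c x) (chart_inv c y)) (chart_map c p)"
    by (rule smooth_at_compose[OF frame_EE, where g = "\<lambda>x. (x, x)"])
      (auto simp: smooth_fun2_atD[OF assms c c])
  then show ?thesis
    using c by (intro smooth_fun_atI[OF c]) simp
qed

lemma smooth_fun2_at_fst: "smooth_fun2_at (\<lambda>x y. f x) p q" if "smooth_fun_at f p"
  unfolding smooth_fun2_at_def case_prod_unfold using that
  by (auto simp: smooth_fun_at_def intro!: smooth_at_compose[OF frame_E _ smooth_at_fst[OF smooth_at_ident]])

lemma smooth_fun2_at_snd: "smooth_fun2_at (\<lambda>x y. f y) p q" if "smooth_fun_at f q"
  unfolding smooth_fun2_at_def case_prod_unfold using that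
  by (auto simp: smooth_fun_at_def intro!: smooth_at_compose[OF frame_E _ smooth_at_snd[OF smooth_at_ident]])

lemma smooth_fun_at_const [simp, intro]: "smooth_fun_at (\<lambda>x. c) p"
  by (auto simp: smooth_fun_at_def)

lemma smooth_fun_at_add [intro]: "smooth_fun_at f p \<Longrightarrow> smooth_fun_at g p \<Longrightarrow> smooth_fun_at (\<lambda>x. f x + g x) p"
  unfolding smooth_fun_at_def by (intro ballI smooth_at_add) simp_all

lemma smooth_fun_at_mult [intro]: "smooth_fun_at f p \<Longrightarrow> smooth_fun_at g p \<Longrightarrow> smooth_fun_at (\<lambda>x. f x * g x) p"
  unfolding smooth_fun_at_def by (intro ballI smooth_at_mult) simp_all

lemma smooth_fun_at_sum [intro]: "(\<And>i. i \<in> I \<Longrightarrow> smooth_fun_at (f i) p) \<Longrightarrow> smooth_fun_at (\<lambda>x. \<Sum>i\<in>I. f i x) p"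
  unfolding smooth_fun_at_def by (intro ballI smooth_at_sum) simp_all

lemma smooth_fun_at_prod [intro]: "(\<And>i. i \<in> I \<Longrightarrow> smooth_fun_at (f i) p) \<Longrightarrow> smooth_fun_at (\<lambda>x. \<Prod>i\<in>I. f i x) p"
  unfolding smooth_fun_at_def by (intro ballI smooth_at_prod) simp_all

lemma smooth_fun_at_flat_exp_compose [intro]: "smooth_fun_at f p \<Longrightarrow> smooth_fun_at (\<lambda>x. flat_exp n (f x)) p"
  unfolding smooth_fun_at_def by (intro ballI smooth_at_flat_exp_compose) simp_all

lemma smooth_fun_at_divide [intro]: "smooth_fun_at f p \<Longrightarrow> smooth_fun_at g p \<Longrightarrow> g p \<noteq> 0 \<Longrightarrow> smooth_fun_at (\<lambda>x. f x / g x) p"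
  unfolding smooth_fun_at_def by (intro ballI smooth_at_divide) (simp_all add: charts_at_iff)

lemma smooth_fun2_at_add [intro]: "smooth_fun2_at f p q \<Longrightarrow> smooth_fun2_at g p q \<Longrightarrow> smooth_fun2_at (\<lambda>x y. f x y + g x y) p q"
  unfolding smooth_fun2_at_def case_prod_unfold by (intro ballI smooth_at_add) simp_all

lemma smooth_fun2_at_diff [intro]: "smooth_fun2_at f p q \<Longrightarrow> smooth_fun2_at g p q \<Longrightarrow> smooth_fun2_at (\<lambda>x y. f x y - g x y) p q"
  unfolding smooth_fun2_at_def case_prod_unfold by (intro ballI smooth_at_diff) simp_all

lemma smooth_fun2_at_mult [intro]: "smooth_fun2_at f p q \<Longrightarrow> smooth_fun2_at g p q \<Longrightarrow> smooth_fun2_at (\<lambda>x y. f x y * g x y) p q"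
  unfolding smooth_fun2_at_def case_prod_unfold by (intro ballI smooth_at_mult) simp_all

lemma smooth_fun2_at_sum [intro]: "(\<And>i. i \<in> I \<Longrightarrow> smooth_fun2_at (f i) p q) \<Longrightarrow> smooth_fun2_at (\<lambda>x y. \<Sum>i\<in>I. f i x y) p q"
  unfolding smooth_fun2_at_def case_prod_unfold by (intro ballI smooth_at_sum) simp_all

lemma lie_deriv_eq_tangent_deriv: "lie_deriv A X f p = tangent_deriv p (X p) f"
  by (simp add: tangent_deriv_def lie_deriv_def)

text \<open>\<open>lie_deriv\<close> works in a chart picked by choice. Passing to \<open>c\<close>
  composes with a transition map, and the transformation law of \<open>u\<close> absorbs its
  derivative.\<close>

lemma tangent_deriv_eq:
  assumes u: "u \<in> tangent_space A p" and f: "smooth_fun_at f p" and c: "c \<in> charts_at A p"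
  shows "tangent_deriv p u f = frechet_derivative (\<lambda>x. f (chart_inv c x)) (at (chart_map c p)) (u c)"
proof -
  define d where "d = (SOME c. c \<in> charts_at A p)"
  have d: "d \<in> charts_at A p" unfolding d_def using c by (rule someI)
  have "((\<lambda>x. f (chart_inv d (transition c d x))) has_derivative
      (\<lambda>v. frechet_derivative (\<lambda>x. f (chart_inv d x)) (at (chart_map d p))
         (frechet_derivative (transition c d) (at (chart_map c p)) v))) (at (chart_map c p))"
    using has_derivative_compose[OF smooth_at_has_derivative[OF smooth_at_transition[OF c d]]]
      smooth_at_has_derivative[OF smooth_fun_atD[OF f d]] c by simp
  moreover have "\<forall>\<^sub>F x in nhds (chart_map c p). f (chart_inv d (transition c d x)) = f (chart_inv c x)"
    using eventually_chart_inv_charts_at[OF c d] by eventually_elim (auto simp: transition_def charts_at_iff)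
  ultimately have "frechet_derivative (\<lambda>x. f (chart_inv c x)) (at (chart_map c p)) (u c)
      = frechet_derivative (\<lambda>x. f (chart_inv d x)) (at (chart_map d p))
         (frechet_derivative (transition c d) (at (chart_map c p)) (u c))"
    by (subst frechet_derivative_eventually_eqI) auto
  also have "frechet_derivative (transition c d) (at (chart_map c p)) (u c) = u d"
    using u c d by (simp add: tangent_spaceD)
  finally show ?thesis
    by (simp add: tangent_deriv_def lie_deriv_def d_def comp_def Let_def)
qed

lemma tangent_deriv_cong: 
  assumes "\<forall>\<^sub>F q in nhds p. f q = g q" shows "tangent_deriv p u f = tangent_deriv p u g"
proof -
  define d where "d = (SOME c. c \<in> charts_at A p)"
  have d: "d \<in> charts_at A p" unfolding d_def using ex_chart by (metis someI)
  show ?thesis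
    using frechet_derivative_cong[OF eventually_chart_inv[OF d assms]]
    by (simp add: tangent_deriv_def lie_deriv_def Let_def comp_def flip: d_def)
qed

lemma tangent_deriv_mult:
  assumes "u \<in> tangent_space A p" "smooth_fun_at f p" "smooth_fun_at g p"
  shows "tangent_deriv p u (\<lambda>x. f x * g x) = f p * tangent_deriv p u g + tangent_deriv p u f * g p"
proof -
  obtain c where c: "c \<in> charts_at A p" using ex_chart .
  show ?thesis
    using has_derivative_mult[OF smooth_at_has_derivative[OF smooth_fun_atD[OF assms(2) c]]
        smooth_at_has_derivative[OF smooth_fun_atD[OF assms(3) c]]] c
    by (simp add: tangent_deriv_eq[OF assms(1) _ c] assms smooth_fun_at_mult frechet_derivative_eqI charts_at_iff)
qed

lemma tangent_deriv_const [simp]: "tangent_deriv p u (\<lambda>x. c) = 0"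
  by (simp add: tangent_deriv_def lie_deriv_def Let_def comp_def)

lemma tangent_deriv_add:
  assumes "u \<in> tangent_space A p" "smooth_fun_at f p" "smooth_fun_at g p"
  shows "tangent_deriv p u (\<lambda>x. f x + g x) = tangent_deriv p u f + tangent_deriv p u g"
proof -
  obtain c where c: "c \<in> charts_at A p" using ex_chart .
  show ?thesis
    using has_derivative_add[OF smooth_at_has_derivative[OF smooth_fun_atD[OF assms(2) c]]
        smooth_at_has_derivative[OF smooth_fun_atD[OF assms(3) c]]]
    by (simp add: tangent_deriv_eq[OF assms(1) _ c] assms smooth_fun_at_add frechet_derivative_eqI)
qed

lemma tangent_deriv_cmult:
  assumes "u \<in> tangent_space A p" "smooth_fun_at f p"
  shows "tangent_deriv p u (\<lambda>x. a * f x) = a * tangent_deriv p u f"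
  using tangent_deriv_mult[OF assms(1) smooth_fun_at_const assms(2), of a] by simp

lemma tangent_deriv_sum:
  assumes "u \<in> tangent_space A p" "\<And>i. i \<in> I \<Longrightarrow> smooth_fun_at (f i) p"
  shows "tangent_deriv p u (\<lambda>x. \<Sum>i\<in>I. f i x) = (\<Sum>i\<in>I. tangent_deriv p u (f i))"
  using assms(2)
  by (induction I rule: infinite_finite_induct) (simp_all add: tangent_deriv_add[OF assms(1)] smooth_fun_at_sum)

lemma tangent_deriv_tv_add:
  assumes "u \<in> tangent_space A p" "v \<in> tangent_space A p" "smooth_fun_at f p"
  shows "tangent_deriv p (tv_add u v) f = tangent_deriv p u f + tangent_deriv p v f"
proof -
  obtain c where c: "c \<in> charts_at A p" using ex_chart .
  show ?thesis
    using has_derivative_linear[OF smooth_at_has_derivative[OF smooth_fun_atD[OF assms(3) c]]]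
    by (simp add: tangent_deriv_eq[OF _ assms(3) c] assms tangent_space_add)
      (simp add: tv_add_def linear_add)
qed

lemma tangent_deriv_tv_scale:
  assumes "u \<in> tangent_space A p" "smooth_fun_at f p"
  shows "tangent_deriv p (tv_scale a u) f = a * tangent_deriv p u f"
proof -
  obtain c where c: "c \<in> charts_at A p" using ex_chart .
  show ?thesis
    using has_derivative_linear[OF smooth_at_has_derivative[OF smooth_fun_atD[OF assms(2) c]]]
    by (simp add: tangent_deriv_eq[OF _ assms(2) c] assms tangent_space_scale)
      (simp add: tv_scale_def linear_scale)
qed

text \<open>In another chart the components near \<open>p\<close> are the given ones under the
  derivative of the transition map at a moving base point, which is the situation of
  \<open>smooth_at_deriv\<close>.\<close>

lemma smooth_field_atI:
  assumes T: "\<forall>\<^sub>F q in nhds p. X q \<in> tangent_space A q" and c: "c \<in> charts_at A p"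
    and sm: "smooth_at (\<lambda>x. X (chart_inv c x) c) (chart_map c p)"
  shows "smooth_field_at X p"
  unfolding smooth_field_at_def
proof (intro conjI ballI T)
  fix d assume d: "d \<in> charts_at A p"
  have "\<forall>\<^sub>F x in nhds (chart_map d p).
      frechet_derivative (transition c d) (at (transition d c x)) (X (chart_inv c (transition d c x)) c)
      = X (chart_inv d x) d"
    using eventually_chart_inv_charts_at[OF d c] eventually_chart_image[OF d] eventually_chart_inv[OF d T]
  proof eventually_elim
    case (elim x)
    have "d \<in> charts_at A (chart_inv d x)"
      using elim(2) d by (auto simp: charts_at_iff)
    from tangent_spaceD[OF elim(3,1) this] show ?case
      using elim(1) by (simp add: transition_def charts_at_iff)
  qed
  moreover have "smooth_at (\<lambda>x. frechet_derivative (transition c d) (at (transition d c x))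
      (X (chart_inv c (transition d c x)) c)) (chart_map d p)"
    using d sm
    by (intro smooth_at_deriv[OF frame_E] smooth_at_transition[OF d c]
        smooth_at_compose[OF frame_E, where g = "transition d c"])
      (simp_all add: smooth_at_transition[OF c d])
  ultimately show "smooth_at (\<lambda>x. X (chart_inv d x) d) (chart_map d p)"
    by (rule smooth_at_cong)
qed

lemma smooth_field_at_smooth: "smooth_field_at X p \<Longrightarrow> c \<in> charts_at A p \<Longrightarrow> smooth_at (\<lambda>x. X (chart_inv c x) c) (chart_map c p)"
  by (simp add: smooth_field_at_def)

lemma smooth_field_at_eventually: "smooth_field_at X p \<Longrightarrow> \<forall>\<^sub>F q in nhds p. X q \<in> tangent_space A q"
  by (simp add: smooth_field_at_def)

lemma smooth_field_at_tangent: "smooth_field_at X p \<Longrightarrow> X p \<in> tangent_space A p"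
  using smooth_field_at_eventually eventually_nhds_x_imp_x by fastforce

lemma vector_field_tangent: "vector_field A X \<Longrightarrow> X p \<in> tangent_space A p"
  by (simp add: vector_field_def)

lemma vector_field_smooth_field_at: 
  assumes "vector_field A X" shows "smooth_field_at X p"
proof -
  obtain c where c: "c \<in> charts_at A p" using ex_chart .
  then have "smooth_on (chart_map c ` chart_dom c) (\<lambda>x. X (chart_inv c x) c)"
    using assms by (simp add: vector_field_def charts_at_iff)
  then have "smooth_at (\<lambda>x. X (chart_inv c x) c) (chart_map c p)"
    using c by (intro smooth_atI[OF open_chart_image[of c]]) (auto simp: charts_at_iff)
  then show ?thesis
    using vector_field_tangent[OF assms] by (intro smooth_field_atI[OF _ c]) auto
qed

lemma vector_fieldI: 
  assumes "\<And>p. smooth_field_at X p" shows "vector_field A X"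
proof -
  have "smooth_at (\<lambda>x. X (chart_inv c x) c) x" if "c \<in> A" "x \<in> chart_map c ` chart_dom c" for c x
    using smooth_field_at_smooth[OF assms, of c "chart_inv c x"] that by (simp add: charts_at_iff)
  then show ?thesis
    using smooth_field_at_tangent[OF assms] by (simp add: vector_field_def smooth_on_iff_smooth_at open_chart_image)
qed

lemma smooth_field_at_cong:
  assumes "\<forall>\<^sub>F q in nhds p. X q = Y q" "smooth_field_at X p"
  shows "smooth_field_at Y p"
proof -
  obtain c where c: "c \<in> charts_at A p" using ex_chart .
  have "\<forall>\<^sub>F q in nhds p. Y q \<in> tangent_space A q"
    using smooth_field_at_eventually[OF assms(2)] assms(1) by eventually_elim simp
  moreover have "\<forall>\<^sub>F x in nhds (chart_map c p). X (chart_inv c x) c = Y (chart_inv c x) c"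
    using eventually_chart_inv[OF c assms(1)] by eventually_elim simp
  ultimately show ?thesis
    using smooth_field_at_smooth[OF assms(2) c] by (intro smooth_field_atI[OF _ c]) (auto intro: smooth_at_cong)
qed

lemma smooth_field_at_coord: "c \<in> charts_at A p \<Longrightarrow> smooth_field_at (\<lambda>q. coord_vec A c q e) p"
proof -
  assume c: "c \<in> charts_at A p"
  have "\<forall>\<^sub>F x in nhds (chart_map c p). e = coord_vec A c (chart_inv c x) e c"
    using eventually_chart_inv_charts_at[OF c c] by eventually_elim simp
  then show ?thesis
    using eventually_charts_at[OF c]
    by (intro smooth_field_atI[OF _ c]) (auto elim!: eventually_mono intro: coord_vec_in_tangent_space smooth_at_cong)
qed

lemma smooth_field_at_scale:
  assumes "smooth_fun_at f p" "smooth_field_at X p"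
  shows "smooth_field_at (\<lambda>q. tv_scale (f q) (X q)) p"
proof -
  obtain c where c: "c \<in> charts_at A p" using ex_chart .
  have "\<forall>\<^sub>F q in nhds p. tv_scale (f q) (X q) \<in> tangent_space A q"
    using smooth_field_at_eventually[OF assms(2)] by eventually_elim (rule tangent_space_scale)
  then show ?thesis
    using smooth_fun_atD[OF assms(1) c] smooth_field_at_smooth[OF assms(2) c]
    by (intro smooth_field_atI[OF _ c]) (auto simp: tv_scale_def)
qed

lemma smooth_field_at_add:
  assumes "smooth_field_at X p" "smooth_field_at Y p"
  shows "smooth_field_at (\<lambda>q. tv_add (X q) (Y q)) p"
proof -
  obtain c where c: "c \<in> charts_at A p" using ex_chart .
  have "\<forall>\<^sub>F q in nhds p. tv_add (X q) (Y q) \<in> tangent_space A q"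
    using smooth_field_at_eventually[OF assms(1)] smooth_field_at_eventually[OF assms(2)]
    by eventually_elim (rule tangent_space_add)
  then show ?thesis
    using smooth_field_at_smooth[OF assms(1) c] smooth_field_at_smooth[OF assms(2) c]
    by (intro smooth_field_atI[OF _ c]) (auto simp: tv_add_def)
qed

lemma smooth_field_at_zero: "smooth_field_at (\<lambda>q. tv_zero) p"
proof -
  obtain c where c: "c \<in> charts_at A p" using ex_chart .
  have "smooth_at (\<lambda>x. tv_zero c :: 'e) (chart_map c p)"
    by (simp add: tv_zero_def)
  then show ?thesis by (intro smooth_field_atI[OF always_eventually c]) (simp_all add: tangent_space_zero)
qed

section \<open>Bump functions and extension of tangent vectors\<close>

text \<open>In a chart, \<open>flat_exp 0\<close> of \<open>r\<^sup>2\<close> minus the squared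
  distance from the centre, extended by 0. It vanishes off the preimage \<open>K\<close> of a closed
  ball, which is compact and hence closed, the manifold being Hausdorff; thus the extension is
  smooth also outside the chart.\<close>

lemma bump_function:
  obtains c f K where "c \<in> charts_at A p" "\<And>q. smooth_fun_at f q" "\<And>q. 0 \<le> f q" "0 < f p"
    "closed K" "K \<subseteq> chart_dom c" "\<And>q. f q \<noteq> 0 \<Longrightarrow> q \<in> K"
proof -
  obtain c where c: "c \<in> charts_at A p" using ex_chart .
  then obtain r where r: "0 < r" "cball (chart_map c p) r \<subseteq> chart_map c ` chart_dom c"
    using open_chart_image[of c] by (auto simp: charts_at_iff open_contains_cball)
  define g where "g = (\<lambda>x. flat_exp 0 (r\<^sup>2 - (x - chart_map c p) \<bullet> (x - chart_map c p)))"
  define f where "f = (\<lambda>q. if q \<in> chart_dom c then g (chart_map c q) else 0)"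
  define K where "K = chart_inv c ` cball (chart_map c p) r"
  have "continuous_on (chart_map c ` chart_dom c) (chart_inv c)"
    using c topological_chart[of c] by (auto simp: charts_at_iff topological_chart_def homeomorphism_def)
  then have "compact K"
    unfolding K_def using r(2) compact_cball_frame[OF frame_E]
    by (intro compact_continuous_image) (auto intro: continuous_on_subset)
  then have K: "closed K" by (rule compact_imp_closed)
  have Kc: "K \<subseteq> chart_dom c"
    using r(2) by (auto simp: K_def)
  have fK: "q \<in> K" if "f q \<noteq> 0" for q
  proof -
    have q: "q \<in> chart_dom c" "(norm (chart_map c q - chart_map c p))\<^sup>2 < r\<^sup>2"
      using that by (auto simp: f_def g_def not_le power2_norm_eq_inner split: if_splits)
    then have "chart_map c q \<in> cball (chart_map c p) r"
      using r(1) power2_less_imp_less[OF q(2)] by (simp add: dist_norm norm_minus_commute)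
    then have "chart_inv c (chart_map c q) \<in> K" by (simp add: K_def)
    then show ?thesis using q(1) c by (simp add: charts_at_iff)
  qed
  have sm: "smooth_fun_at f q" for q
  proof (cases "q \<in> chart_dom c")
    case True
    then have q: "c \<in> charts_at A q" using c by (simp add: charts_at_iff)
    have "\<forall>\<^sub>F x in nhds (chart_map c q). g x = f (chart_inv c x)"
      using eventually_chart_image[OF q] by eventually_elim (simp add: f_def)
    moreover have "smooth_at g (chart_map c q)"
      unfolding g_def by (intro smooth_at_flat_exp_compose smooth_at_diff smooth_at_inner) auto
    ultimately show ?thesis
      by (intro smooth_fun_atI[OF q]) (rule smooth_at_cong)
  next
    case False
    then have "\<forall>\<^sub>F x in nhds q. x \<in> - K"
      using K Kc by (intro eventually_nhds_in_open) auto
    then have "\<forall>\<^sub>F x in nhds q. 0 = f x"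
      by eventually_elim (use fK in auto)
    then show ?thesis by (rule smooth_fun_at_cong) simp
  qed
  show ?thesis
    by (rule that[of c f K]) (use c sm K Kc fK r(1) in \<open>auto simp: f_def g_def charts_at_iff\<close>)
qed

text \<open>\<open>dL\<close> evaluates bi-forms on fields picked by \<open>vf_extension\<close>, so
  its meaning depends on this. A bump times a coordinate field serves; division by
  \<open>f p\<close> in its coefficient restores the value at \<open>p\<close>.\<close>

lemma vector_field_extension_exists:
  assumes "u \<in> tangent_space A p"
  shows "\<exists>X. vector_field A X \<and> X p = u"
proof -
  obtain c f K where c: "c \<in> charts_at A p" and f: "\<And>q. smooth_fun_at f q" "0 < f p"
    and K: "closed K" "K \<subseteq> chart_dom c" "\<And>q. f q \<noteq> 0 \<Longrightarrow> q \<in> K"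
    using bump_function[of p] by metis
  define X where "X = (\<lambda>q. tv_scale (f q) (coord_vec A c q (u c /\<^sub>R f p)))"
  have "smooth_field_at X q" for q
  proof (cases "q \<in> chart_dom c")
    case True
    then show ?thesis
      unfolding X_def using c f by (intro smooth_field_at_scale smooth_field_at_coord) (auto simp: charts_at_iff)
  next
    case False
    then have "\<forall>\<^sub>F x in nhds q. x \<in> - K"
      using K by (intro eventually_nhds_in_open) auto
    then have "\<forall>\<^sub>F x in nhds q. tv_zero = X x"
    proof eventually_elim
      case (elim x)
      then have "f x = 0" using K(3) by auto
      then show ?case by (simp add: X_def tv_scale_def tv_zero_def)
    qed
    then show ?thesis by (rule smooth_field_at_cong) (rule smooth_field_at_zero)
  qed
  moreover have "X p = u"
    using f(2) by (simp add: X_def coord_vec_coord[OF c assms] flip: coord_vec_scale[OF c])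
  ultimately show ?thesis using vector_fieldI by blast
qed

lemma
  assumes "u \<in> tangent_space A p"
  shows vector_field_vf_extension: "vector_field A (vf_extension A p u)"
    and vf_extension_at: "vf_extension A p u p = u"
  using someI_ex[OF vector_field_extension_exists[OF assms]] by (simp_all add: vf_extension_def)

section \<open>Differentiation in the left variable\<close>

lemma eventually_smooth_fun2_at_charts:
  assumes "smooth_fun2_at f p q" "c \<in> charts_at A p" "d \<in> charts_at A q"
  shows "\<forall>\<^sub>F z in nhds (chart_map c p, chart_map d q).
      smooth_at (\<lambda>(x, y). f (chart_inv c x) (chart_inv d y)) z \<and>
      fst z \<in> chart_map c ` chart_dom c \<and> snd z \<in> chart_map d ` chart_dom d"
  using smooth_at_eventually[OF smooth_fun2_atD[OF assms]] eventually_nhds_fst[OF eventually_chart_image[OF assms(2)]]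
    eventually_nhds_snd[OF eventually_chart_image[OF assms(3)]]
  by eventually_elim simp

text \<open>In a product chart this is the derivative of \<open>F\<close> at \<open>z\<close> in the
  direction (X, 0), where base point and direction are smooth in \<open>z\<close>.\<close>

lemma smooth_fun2_at_tangent_deriv:
  assumes f: "smooth_fun2_at f p q" and X: "smooth_field_at X p"
  shows "smooth_fun2_at (\<lambda>x y. tangent_deriv x (X x) (\<lambda>x'. f x' y)) p q"
proof -
  obtain c d where c: "c \<in> charts_at A p" and d: "d \<in> charts_at A q"
    using ex_chart by metis
  define F where "F = (\<lambda>(x, y). f (chart_inv c x) (chart_inv d y))"
  have F: "smooth_at F (chart_map c p, chart_map d q)"
    unfolding F_def by (rule smooth_fun2_atD[OF f c d])
  have "\<forall>\<^sub>F z in nhds (chart_map c p, chart_map d q).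
      frechet_derivative F (at z) (X (chart_inv c (fst z)) c, 0)
      = (case z of (x, y) \<Rightarrow> tangent_deriv (chart_inv c x) (X (chart_inv c x)) (\<lambda>x'. f x' (chart_inv d y)))"
    using eventually_smooth_fun2_at_charts[OF f c d] eventually_nhds_fst[OF eventually_chart_inv[OF c smooth_field_at_eventually[OF X]]]
  proof eventually_elim
    case (elim z)
    obtain x y where z: "z = (x, y)" by force
    have cx: "c \<in> charts_at A (chart_inv c x)" and dy: "d \<in> charts_at A (chart_inv d y)"
      using elim c d by (auto simp: z charts_at_iff)
    have "smooth_at (\<lambda>(x, y). f (chart_inv c x) (chart_inv d y))
        (chart_map c (chart_inv c x), chart_map d (chart_inv d y))"
      using elim by (simp add: z)
    from smooth_fun2_at_slice[OF smooth_fun2_atI[OF cx dy this]]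
    have "tangent_deriv (chart_inv c x) (X (chart_inv c x)) (\<lambda>x'. f x' (chart_inv d y))
        = frechet_derivative (\<lambda>x. F (x, y)) (at x) (X (chart_inv c x) c)"
      using elim by (subst tangent_deriv_eq[OF _ _ cx]) (simp_all add: z F_def)
    also have "\<dots> = frechet_derivative F (at (x, y)) (X (chart_inv c x) c, 0)"
      using elim by (intro frechet_derivative_slice) (simp add: z F_def)
    finally show ?case by (simp add: z)
  qed
  moreover have "smooth_at (\<lambda>z. frechet_derivative F (at z) (X (chart_inv c (fst z)) c, 0))
      (chart_map c p, chart_map d q)"
  proof (rule smooth_at_deriv[OF frame_EE, where g = "\<lambda>z. z"])
    have "smooth_at (\<lambda>z. X (chart_inv c (fst z)) c) (chart_map c p, chart_map d q)"
      by (rule smooth_at_compose[OF frame_E, where f = "\<lambda>x. X (chart_inv c x) c" and g = fst])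
        (simp_all add: smooth_field_at_smooth[OF X c] smooth_at_linear bounded_linear_fst)
    then show "smooth_at (\<lambda>z. (X (chart_inv c (fst z)) c, 0::'e)) (chart_map c p, chart_map d q)"
      by (rule smooth_at_Pair) simp
  qed (use F in simp_all)
  ultimately have "smooth_at (\<lambda>(x, y). tangent_deriv (chart_inv c x) (X (chart_inv c x)) (\<lambda>x'. f x' (chart_inv d y)))
      (chart_map c p, chart_map d q)"
    by (rule smooth_at_cong)
  then show ?thesis by (rule smooth_fun2_atI[OF c d])
qed

text \<open>A horizontal lift is (X, 0) in every product chart, so the derivative on the product
  sees only the slice with the right point fixed.\<close>

lemma lie_deriv_hlift_L:
  assumes f: "smooth_fun2_at f p q" and X: "X p \<in> tangent_space A p"
  shows "lie_deriv (prod_atlas A A) (hlift_L A X) (\<lambda>(x, y). f x y) (p, q) = tangent_deriv p (X p) (\<lambda>x. f x q)"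
proof -
  define C where "C = (SOME C. C \<in> charts_at (prod_atlas A A) (p, q))"
  obtain c0 d0 where cd0: "c0 \<in> charts_at A p" "d0 \<in> charts_at A q"
    using ex_chart by metis
  then have "(chart_dom c0 \<times> chart_dom d0, map_prod (chart_map c0) (chart_map d0)) \<in> prod_atlas A A"
    unfolding prod_atlas_def charts_at_def by blast
  with cd0 have "(chart_dom c0 \<times> chart_dom d0, map_prod (chart_map c0) (chart_map d0))
      \<in> charts_at (prod_atlas A A) (p, q)"
    by (simp add: charts_at_def)
  then have C: "C \<in> charts_at (prod_atlas A A) (p, q)"
    unfolding C_def by (rule someI)
  then obtain c d where cd: "C = (chart_dom c \<times> chart_dom d, map_prod (chart_map c) (chart_map d))"
    and "c \<in> A" "d \<in> A"
    unfolding charts_at_def prod_atlas_def by blast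
  with C have c: "c \<in> charts_at A p" and d: "d \<in> charts_at A q"
    by (simp_all add: charts_at_def)
  \<comment> \<open>\<open>hlift_L\<close> recovers the left factor of a product chart by projecting
    its domain, which gives \<open>chart_dom c\<close> because the right factor is nonempty.\<close>
  have ne: "chart_dom d \<noteq> {}"
    using d by (auto simp: charts_at_iff)
  have val: "hlift_L A X (p, q) C = (X p c, 0)"
    using C unfolding hlift_L_def pair_tv_def by (simp add: cd ne tv_zero_def)
  \<comment> \<open>\<open>chart_inv\<close> of the product chart is an inverse on the product
    domain; by injectivity it agrees near the point with the pair of the factor inverses.\<close>
  have inv: "\<forall>\<^sub>F z in nhds (chart_map c p, chart_map d q).
      (case z of (x, y) \<Rightarrow> f (chart_inv c x) (chart_inv d y)) = (case chart_inv C z of (x, y) \<Rightarrow> f x y)"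
    using eventually_smooth_fun2_at_charts[OF f c d]
  proof eventually_elim
    case (elim z)
    then obtain x y where xy: "x \<in> chart_dom c" "y \<in> chart_dom d" "fst z = chart_map c x" "snd z = chart_map d y"
      by (elim conjE imageE)
    then have z: "z = (chart_map c x, chart_map d y)" "x \<in> chart_dom c" "y \<in> chart_dom d"
      by (simp_all add: prod_eq_iff)
    have "inj_on (map_prod (chart_map c) (chart_map d)) (chart_dom c \<times> chart_dom d)"
      using inj_on_chart c d by (intro map_prod_inj_on) (auto simp: charts_at_iff)
    from inv_into_f_f[OF this, of "(x, y)"] have "chart_inv C z = (x, y)"
      using z by (simp add: chart_inv_def cd)
    then show ?case using z c d by (simp add: charts_at_iff)
  qed
  have "lie_deriv (prod_atlas A A) (hlift_L A X) (\<lambda>(x, y). f x y) (p, q)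
      = frechet_derivative (\<lambda>z. case chart_inv C z of (x, y) \<Rightarrow> f x y) (at (chart_map c p, chart_map d q)) (X p c, 0)"
    unfolding lie_deriv_def Let_def C_def[symmetric] val by (simp add: comp_def cd)
  also have "\<dots> = frechet_derivative (\<lambda>(x, y). f (chart_inv c x) (chart_inv d y)) (at (chart_map c p, chart_map d q)) (X p c, 0)"
    by (simp add: frechet_derivative_cong[OF inv])
  also have "\<dots> = frechet_derivative (\<lambda>x. f (chart_inv c x) q) (at (chart_map c p)) (X p c)"
    using frechet_derivative_slice[OF smooth_fun2_atD[OF f c d], of "X p c"] d by (simp add: charts_at_iff)
  also have "\<dots> = tangent_deriv p (X p) (\<lambda>x. f x q)"
    using tangent_deriv_eq[OF X smooth_fun2_at_slice[OF f] c] by simp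
  finally show ?thesis .
qed

end

text \<open>Some independent subset of the frame spans the space, and this instantiates the locale
  of finite-dimensional vector spaces.\<close>

lemma frame_linear_inj_imp_surj:
  fixes f :: "'a::real_inner \<Rightarrow> 'a" and E :: "'a set"
  assumes "frame E" "linear f" "\<And>x. f x = 0 \<Longrightarrow> x = 0"
  shows "surj f"
proof -
  have "x \<in> span E" for x
    using frame_expand[OF assms(1), of x] by (metis (no_types, lifting) span_base span_scale span_sum)
  then have sp: "span E = UNIV" by blast
  obtain B where B: "B \<subseteq> E" "independent B" "E \<subseteq> span B"
    using real_vector.maximal_independent_subset[of E] by blast
  have "span B = UNIV"
    using span_mono[OF B(3)] sp by (simp add: span_span top.extremum_uniqueI)
  then have fd: "finite_dimensional_vector_space (scaleR :: real \<Rightarrow> 'a \<Rightarrow> 'a) B"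
    using B finite_subset[OF B(1) frame_finite[OF assms(1)]]
    by unfold_locales
      (simp_all add: algebra_simps dependent_raw_def span_raw_def)
  have i: "inj f"
    using assms(2,3) linear_injective_0 by blast
  have "Vector_Spaces.linear scaleR scaleR f"
    using assms(2) by (simp add: linear_def Real_Vector_Spaces.linear_def)
  from finite_dimensional_vector_space.linear_inj_imp_surj[OF fd this i] show ?thesis .
qed

lemma alternating_form_0: "alternating_form T 0 F"
  by (simp add: alternating_form_def)

lemma alternating_form_1:
  "alternating_form T 1 F \<longleftrightarrow>
    (\<forall>u\<in>T. \<forall>v\<in>T. F [tv_add u v] = F [u] + F [v]) \<and> (\<forall>u\<in>T. \<forall>a. F [tv_scale a u] = a * F [u])"
proof -
  have *: "(\<forall>us. length us = 1 \<and> set us \<subseteq> T \<longrightarrow> P us) \<longleftrightarrow> (\<forall>u\<in>T. P [u])" for P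
    by (auto simp: length_Suc_conv)
  show ?thesis
    unfolding alternating_form_def * by auto
qed

section \<open>Bi-forms\<close>

context manifold
begin

lemma open_chart_image_Times_Int:
  assumes c: "c \<in> A" and d: "d \<in> A" and W: "open W"
  shows "open (map_prod (chart_map c) (chart_map d) ` ((chart_dom c \<times> chart_dom d) \<inter> W))"
proof -
  let ?S = "chart_map c ` chart_dom c \<times> chart_map d ` chart_dom d"
  let ?i = "map_prod (chart_inv c) (chart_inv d)"
  have cc: "continuous_on (chart_map c ` chart_dom c) (chart_inv c)"
    and cd: "continuous_on (chart_map d ` chart_dom d) (chart_inv d)"
    using topological_chart[OF c] topological_chart[OF d]
    by (simp_all add: topological_chart_def homeomorphism_def)
  have "continuous_on ?S (\<lambda>z. (chart_inv c (fst z), chart_inv d (snd z)))"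
    by (intro continuous_on_Pair continuous_on_compose2[OF cc continuous_on_fst[OF continuous_on_id]]
        continuous_on_compose2[OF cd continuous_on_snd[OF continuous_on_id]]) auto
  then have "continuous_on ?S ?i"
    by (simp add: map_prod_def case_prod_unfold)
  then have "open (?S \<inter> ?i -` W)"
    using c d W by (intro continuous_open_preimage open_Times open_chart_image)
  also have "?S \<inter> ?i -` W = map_prod (chart_map c) (chart_map d) ` ((chart_dom c \<times> chart_dom d) \<inter> W)"
    using c d by force
  finally show ?thesis .
qed

lemma smooth_on_chart_image_iff:
  assumes c: "c \<in> A" and d: "d \<in> A" and W: "open W"
  shows "smooth_on (map_prod (chart_map c) (chart_map d) ` ((chart_dom c \<times> chart_dom d) \<inter> W))
      (\<lambda>(x, y). f (chart_inv c x) (chart_inv d y)) \<longleftrightarrow>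
    (\<forall>p q. c \<in> charts_at A p \<and> d \<in> charts_at A q \<and> (p, q) \<in> W \<longrightarrow> smooth_fun2_at f p q)"
proof -
  have "smooth_at (\<lambda>(x, y). f (chart_inv c x) (chart_inv d y)) (chart_map c p, chart_map d q) \<longleftrightarrow> smooth_fun2_at f p q"
    if "c \<in> charts_at A p" "d \<in> charts_at A q" for p q
    using smooth_fun2_atI[OF that] smooth_fun2_atD[OF _ that] by blast
  note * = this
  have "smooth_on (map_prod (chart_map c) (chart_map d) ` ((chart_dom c \<times> chart_dom d) \<inter> W))
      (\<lambda>(x, y). f (chart_inv c x) (chart_inv d y)) \<longleftrightarrow>
    (\<forall>z\<in>(chart_dom c \<times> chart_dom d) \<inter> W.
      smooth_at (\<lambda>(x, y). f (chart_inv c x) (chart_inv d y)) (map_prod (chart_map c) (chart_map d) z))"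
    unfolding smooth_on_iff_smooth_at[OF open_chart_image_Times_Int[OF c d W]] by (simp only: ball_simps)
  also have "\<dots> \<longleftrightarrow> (\<forall>p q. (p, q) \<in> (chart_dom c \<times> chart_dom d) \<inter> W \<longrightarrow>
      smooth_at (\<lambda>(x, y). f (chart_inv c x) (chart_inv d y)) (chart_map c p, chart_map d q))"
    by (simp add: Ball_def split_paired_All)
  also have "\<dots> \<longleftrightarrow> (\<forall>p q. c \<in> charts_at A p \<and> d \<in> charts_at A q \<and> (p, q) \<in> W \<longrightarrow>
      smooth_at (\<lambda>(x, y). f (chart_inv c x) (chart_inv d y)) (chart_map c p, chart_map d q))"
    using c d by (simp add: charts_at_iff)
  finally show ?thesis using * by blast
qed

text \<open>Replaces the list arguments by single vectors, for which alternation is vacuous, and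
  smoothness on images of product charts by smoothness at points.\<close>

lemma biform_1_1_iff:
  "biform A 1 1 W \<omega> \<longleftrightarrow> open W \<and>
    (\<forall>m n. (m, n) \<in> W \<longrightarrow>
      (\<forall>v\<in>tangent_space A n.
        (\<forall>u\<in>tangent_space A m. \<forall>u'\<in>tangent_space A m. \<omega> m n [tv_add u u'] [v] = \<omega> m n [u] [v] + \<omega> m n [u'] [v]) \<and>
        (\<forall>u\<in>tangent_space A m. \<forall>a. \<omega> m n [tv_scale a u] [v] = a * \<omega> m n [u] [v])) \<and>
      (\<forall>u\<in>tangent_space A m.
        (\<forall>v\<in>tangent_space A n. \<forall>v'\<in>tangent_space A n. \<omega> m n [u] [tv_add v v'] = \<omega> m n [u] [v] + \<omega> m n [u] [v']) \<and>
        (\<forall>v\<in>tangent_space A n. \<forall>a. \<omega> m n [u] [tv_scale a v] = a * \<omega> m n [u] [v]))) \<and>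
    (\<forall>c d e f p q. c \<in> charts_at A p \<and> d \<in> charts_at A q \<and> (p, q) \<in> W \<longrightarrow>
      smooth_fun2_at (\<lambda>x y. \<omega> x y [coord_vec A c x e] [coord_vec A d y f]) p q)"
proof -
  have 1: "(\<forall>us. length us = 1 \<and> set us \<subseteq> T \<longrightarrow> P us) \<longleftrightarrow> (\<forall>u\<in>T. P [u])" for P and T :: "('m, 'e) tv set"
    by (auto simp: length_Suc_conv)
  have 2: "(\<forall>es fs. length es = 1 \<and> length fs = 1 \<longrightarrow> P es fs) \<longleftrightarrow> (\<forall>e f. P [e] [f])" for P :: "'e list \<Rightarrow> 'e list \<Rightarrow> bool"
    by (auto simp: length_Suc_conv)
  have 3: "(\<forall>c\<in>A. \<forall>d\<in>A. \<forall>e f.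
        smooth_on (map_prod (chart_map c) (chart_map d) ` ((chart_dom c \<times> chart_dom d) \<inter> W))
          (\<lambda>(x, y). \<omega> (chart_inv c x) (chart_inv d y)
             [coord_vec A c (chart_inv c x) e] [coord_vec A d (chart_inv d y) f])) \<longleftrightarrow>
      (\<forall>c d e f p q. c \<in> charts_at A p \<and> d \<in> charts_at A q \<and> (p, q) \<in> W \<longrightarrow>
      smooth_fun2_at (\<lambda>x y. \<omega> x y [coord_vec A c x e] [coord_vec A d y f]) p q)" (is "?l \<longleftrightarrow> ?r") if W: "open W"
  proof -
    have "?l \<longleftrightarrow> (\<forall>c\<in>A. \<forall>d\<in>A. \<forall>e f. \<forall>p q. c \<in> charts_at A p \<and> d \<in> charts_at A q \<and> (p, q) \<in> W \<longrightarrow>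
      smooth_fun2_at (\<lambda>x y. \<omega> x y [coord_vec A c x e] [coord_vec A d y f]) p q)"
      by (intro ball_cong refl arg_cong[where f = All] ext)
        (rule smooth_on_chart_image_iff[OF _ _ W, where f = "\<lambda>x y. \<omega> x y [coord_vec A _ x _] [coord_vec A _ y _]"])
    then show ?thesis unfolding charts_at_iff by blast
  qed
  have 5: "(\<forall>(m, n)\<in>W. P m n) \<longleftrightarrow> (\<forall>m n. (m, n) \<in> W \<longrightarrow> P m n)" for P
    by auto
  show ?thesis
    unfolding biform_def 1 2 5 alternating_form_1 list.map by (rule conj_cong[OF refl conj_cong[OF refl 3]])
qed

lemma biform_0_1_iff:
  "biform A 0 1 W S \<longleftrightarrow> open W \<and>
    (\<forall>m n. (m, n) \<in> W \<longrightarrow>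
      (\<forall>v\<in>tangent_space A n. \<forall>v'\<in>tangent_space A n. S m n [] [tv_add v v'] = S m n [] [v] + S m n [] [v']) \<and>
      (\<forall>v\<in>tangent_space A n. \<forall>a. S m n [] [tv_scale a v] = a * S m n [] [v])) \<and>
    (\<forall>c d f p q. c \<in> charts_at A p \<and> d \<in> charts_at A q \<and> (p, q) \<in> W \<longrightarrow>
      smooth_fun2_at (\<lambda>x y. S x y [] [coord_vec A d y f]) p q)"
proof -
  have 1: "(\<forall>us. length us = 1 \<and> set us \<subseteq> T \<longrightarrow> P us) \<longleftrightarrow> (\<forall>u\<in>T. P [u])" for P and T :: "('m, 'e) tv set"
    by (auto simp: length_Suc_conv)
  have 2: "(\<forall>es fs. length es = 0 \<and> length fs = 1 \<longrightarrow> P es fs) \<longleftrightarrow> (\<forall>f. P [] [f])" for P :: "'e list \<Rightarrow> 'e list \<Rightarrow> bool"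
    by (auto simp: length_Suc_conv)
  have 3: "(\<forall>c\<in>A. \<forall>d\<in>A. \<forall>f.
        smooth_on (map_prod (chart_map c) (chart_map d) ` ((chart_dom c \<times> chart_dom d) \<inter> W))
          (\<lambda>(x, y). S (chart_inv c x) (chart_inv d y) [] [coord_vec A d (chart_inv d y) f])) \<longleftrightarrow>
      (\<forall>c d f p q. c \<in> charts_at A p \<and> d \<in> charts_at A q \<and> (p, q) \<in> W \<longrightarrow>
      smooth_fun2_at (\<lambda>x y. S x y [] [coord_vec A d y f]) p q)" (is "?l \<longleftrightarrow> ?r") if W: "open W"
  proof -
    have "?l \<longleftrightarrow> (\<forall>c\<in>A. \<forall>d\<in>A. \<forall>f. \<forall>p q. c \<in> charts_at A p \<and> d \<in> charts_at A q \<and> (p, q) \<in> W \<longrightarrow>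
      smooth_fun2_at (\<lambda>x y. S x y [] [coord_vec A d y f]) p q)"
      by (intro ball_cong refl arg_cong[where f = All] ext)
        (rule smooth_on_chart_image_iff[OF _ _ W, where f = "\<lambda>x y. S x y [] [coord_vec A _ y _]"])
    then show ?thesis unfolding charts_at_iff by blast
  qed
  have 4: "(\<forall>us. length us = 0 \<and> set us \<subseteq> T \<longrightarrow> P us) \<longleftrightarrow> P []" for P and T :: "('m, 'e) tv set"
    by auto
  have 5: "(\<forall>(m, n)\<in>W. P m n) \<longleftrightarrow> (\<forall>m n. (m, n) \<in> W \<longrightarrow> P m n)" for P
    by auto
  have 6: "(\<forall>u\<in>U. alternating_form T 0 (F u)) = True" for U T :: "('m, 'e) tv set" and F
    by (simp add: alternating_form_0)
  show ?thesis
    unfolding biform_def 1 2 4 5 6 alternating_form_1 list.map simp_thms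
    by (rule conj_cong[OF refl conj_cong[OF refl 3]])
qed

lemma coord_linear_expand:
  assumes c: "c \<in> charts_at A p" and u: "u \<in> tangent_space A p"
    and add: "\<And>v w. v \<in> tangent_space A p \<Longrightarrow> w \<in> tangent_space A p \<Longrightarrow> \<phi> (tv_add v w) = \<phi> v + \<phi> w"
    and scale: "\<And>a v. v \<in> tangent_space A p \<Longrightarrow> \<phi> (tv_scale a v) = a * (\<phi> v :: real)"
  shows "\<phi> u = (\<Sum>b\<in>E. (u c \<bullet> b) * \<phi> (coord_vec A c p b))"
proof -
  have "linear (\<lambda>e. \<phi> (coord_vec A c p e))"
    by (rule linearI) (simp_all add: coord_vec_add[OF c] coord_vec_scale[OF c] add scale
        coord_vec_in_tangent_space[OF c])
  from frame_linear[OF frame_E this, of "u c"] show ?thesis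
    by (simp add: coord_vec_coord[OF c u])
qed

lemma smooth_fun_at_coord: "smooth_field_at X p \<Longrightarrow> c \<in> charts_at A p \<Longrightarrow> smooth_fun_at (\<lambda>x. X x c \<bullet> b) p"
  by (rule smooth_fun_atI, assumption) (rule smooth_at_inner[OF smooth_field_at_smooth smooth_at_const])

context
  fixes W \<omega> assumes \<omega>: "biform A 1 1 W \<omega>"
begin

lemma biform_open: "open W"
  using \<omega> unfolding biform_1_1_iff by blast

lemma biform_add_left: "(m, n) \<in> W \<Longrightarrow> u \<in> tangent_space A m \<Longrightarrow> u' \<in> tangent_space A m \<Longrightarrow> v \<in> tangent_space A n \<Longrightarrow>
    \<omega> m n [tv_add u u'] [v] = \<omega> m n [u] [v] + \<omega> m n [u'] [v]"
  and biform_scale_left: "(m, n) \<in> W \<Longrightarrow> u \<in> tangent_space A m \<Longrightarrow> v \<in> tangent_space A n \<Longrightarrow>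
    \<omega> m n [tv_scale a u] [v] = a * \<omega> m n [u] [v]"
  and biform_add_right: "(m, n) \<in> W \<Longrightarrow> u \<in> tangent_space A m \<Longrightarrow> v \<in> tangent_space A n \<Longrightarrow> v' \<in> tangent_space A n \<Longrightarrow>
    \<omega> m n [u] [tv_add v v'] = \<omega> m n [u] [v] + \<omega> m n [u] [v']"
  and biform_scale_right: "(m, n) \<in> W \<Longrightarrow> u \<in> tangent_space A m \<Longrightarrow> v \<in> tangent_space A n \<Longrightarrow>
    \<omega> m n [u] [tv_scale a v] = a * \<omega> m n [u] [v]"
  using \<omega> unfolding biform_1_1_iff by blast+

lemma biform_expand_left:
  assumes "(m, n) \<in> W" "u \<in> tangent_space A m" "v \<in> tangent_space A n" "c \<in> charts_at A m"
  shows "\<omega> m n [u] [v] = (\<Sum>b\<in>E. (u c \<bullet> b) * \<omega> m n [coord_vec A c m b] [v])"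
  by (rule coord_linear_expand[OF assms(4,2)])
    (simp_all add: biform_add_left biform_scale_left assms)

lemma biform_expand_right:
  assumes "(m, n) \<in> W" "u \<in> tangent_space A m" "v \<in> tangent_space A n" "d \<in> charts_at A n"
  shows "\<omega> m n [u] [v] = (\<Sum>b\<in>E. (v d \<bullet> b) * \<omega> m n [u] [coord_vec A d n b])"
  by (rule coord_linear_expand[OF assms(4,3)])
    (simp_all add: biform_add_right biform_scale_right assms)

text \<open>\<open>biform\<close> provides smoothness of the components in coordinate frames only.
  Near (p, q) both fields are tangent and the points stay in \<open>W\<close>, so both arguments can
  be expanded there.\<close>

lemma biform_smooth_fun2_at:
  assumes W: "(p, q) \<in> W" and X: "smooth_field_at X p" and Y: "smooth_field_at Y q"
  shows "smooth_fun2_at (\<lambda>x y. \<omega> x y [X x] [Y y]) p q"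
proof -
  obtain c d where c: "c \<in> charts_at A p" and d: "d \<in> charts_at A q"
    using ex_chart by metis
  have "\<forall>\<^sub>F z in nhds (p, q). (\<Sum>a\<in>E. \<Sum>b\<in>E. (X (fst z) c \<bullet> a) * (Y (snd z) d \<bullet> b) *
      \<omega> (fst z) (snd z) [coord_vec A c (fst z) a] [coord_vec A d (snd z) b])
    = \<omega> (fst z) (snd z) [X (fst z)] [Y (snd z)]"
    using eventually_nhds_in_open[OF biform_open W] eventually_nhds_fst[OF eventually_charts_at[OF c]]
      eventually_nhds_snd[OF eventually_charts_at[OF d]] eventually_nhds_fst[OF smooth_field_at_eventually[OF X]]
      eventually_nhds_snd[OF smooth_field_at_eventually[OF Y]]
  proof eventually_elim
    case (elim z)
    have W: "(fst z, snd z) \<in> W" using elim by simp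
    show ?case
      using elim by (subst biform_expand_left[OF W elim(4,5,2)], subst biform_expand_right[OF W _ elim(5,3)])
        (simp_all add: coord_vec_in_tangent_space sum_distrib_left mult_ac)
  qed
  moreover have "smooth_fun2_at (\<lambda>x y. \<omega> x y [coord_vec A c x a] [coord_vec A d y b]) p q" for a b
    using \<omega> c d W unfolding biform_1_1_iff by blast
  then have "smooth_fun2_at (\<lambda>x y. \<Sum>a\<in>E. \<Sum>b\<in>E. (X x c \<bullet> a) * (Y y d \<bullet> b) *
      \<omega> x y [coord_vec A c x a] [coord_vec A d y b]) p q"
    by (intro smooth_fun2_at_sum smooth_fun2_at_mult smooth_fun2_at_fst[OF smooth_fun_at_coord] smooth_fun2_at_snd[OF smooth_fun_at_coord] X Y c d)
  ultimately show ?thesis by (rule smooth_fun2_at_cong)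
qed

text \<open>The fixed vector \<open>v\<close> is extended to a field on the right factor, and the
  right point is then frozen at \<open>q\<close>.\<close>

lemma biform_smooth_fun_at:
  assumes "(p, q) \<in> W" "smooth_field_at X p" "v \<in> tangent_space A q"
  shows "smooth_fun_at (\<lambda>x. \<omega> x q [X x] [v]) p"
  using smooth_fun2_at_slice[OF biform_smooth_fun2_at[OF assms(1,2) vector_field_smooth_field_at[OF vector_field_vf_extension[OF assms(3)]]]]
  by (simp add: vf_extension_at[OF assms(3)])

lemma eventually_biform_slice: 
  assumes "(p, q) \<in> W" shows "\<forall>\<^sub>F x in nhds p. (x, q) \<in> W"
proof -
  have "filterlim (\<lambda>x. (x, q)) (nhds (p, q)) (nhds p)"
    by (intro tendsto_Pair filterlim_ident tendsto_const)
  then show ?thesis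
    using eventually_nhds_in_open[OF biform_open assms] unfolding filterlim_iff by blast
qed

end

lemma biform_0_1_add: "biform A 0 1 UNIV S \<Longrightarrow> v \<in> tangent_space A n \<Longrightarrow> v' \<in> tangent_space A n \<Longrightarrow>
    S m n [] [tv_add v v'] = S m n [] [v] + S m n [] [v']"
  and biform_0_1_scale: "biform A 0 1 UNIV S \<Longrightarrow> v \<in> tangent_space A n \<Longrightarrow>
    S m n [] [tv_scale a v] = a * S m n [] [v]"
  unfolding biform_0_1_iff by blast+

lemma biform_0_1_smooth_fun2_at:
  assumes S: "biform A 0 1 UNIV S" and Y: "smooth_field_at Y q"
  shows "smooth_fun2_at (\<lambda>x y. S x y [] [Y y]) p q"
proof -
  obtain c d where c: "c \<in> charts_at A p" and d: "d \<in> charts_at A q"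
    using ex_chart by metis
  have "\<forall>\<^sub>F z in nhds (p, q). (\<Sum>b\<in>E. (Y (snd z) d \<bullet> b) *
      S (fst z) (snd z) [] [coord_vec A d (snd z) b]) = S (fst z) (snd z) [] [Y (snd z)]"
    using eventually_nhds_snd[OF eventually_charts_at[OF d]] eventually_nhds_snd[OF smooth_field_at_eventually[OF Y]]
  proof eventually_elim
    case (elim z)
    have "S (fst z) (snd z) [] [Y (snd z)] = (\<Sum>b\<in>E. (Y (snd z) d \<bullet> b) *
      S (fst z) (snd z) [] [coord_vec A d (snd z) b])"
      by (rule coord_linear_expand[OF elim(1,2)]) (simp_all add: biform_0_1_add[OF S] biform_0_1_scale[OF S])
    then show ?case by simp
  qed
  moreover have "smooth_fun2_at (\<lambda>x y. S x y [] [coord_vec A d y b]) p q" for b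
    using S c d unfolding biform_0_1_iff by blast
  then have "smooth_fun2_at (\<lambda>x y. \<Sum>b\<in>E. (Y y d \<bullet> b) * S x y [] [coord_vec A d y b]) p q"
    by (intro smooth_fun2_at_sum smooth_fun2_at_mult smooth_fun2_at_snd[OF smooth_fun_at_coord] Y d)
  ultimately show ?thesis by (rule smooth_fun2_at_cong)
qed

lemma biform_0_1_smooth_fun_at:
  assumes "biform A 0 1 UNIV S" "v \<in> tangent_space A q"
  shows "smooth_fun_at (\<lambda>x. S x q [] [v]) p"
  using smooth_fun2_at_slice[OF biform_0_1_smooth_fun2_at[OF assms(1) vector_field_smooth_field_at[OF vector_field_vf_extension[OF assms(2)]], of p q]]
  by (simp add: vf_extension_at[OF assms(2)])

section \<open>The left differential in degree (0, 1)\<close>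

text \<open>For a single left field the bracket sum is empty, and what remains depends on the
  extensions only through their values at \<open>m\<close> and \<open>n\<close>. So the choices made
  by \<open>vf_extension\<close> disappear.\<close>

lemma dL_eq_tangent_deriv:
  assumes S: "biform A 0 1 UNIV S" and u: "u \<in> tangent_space A m" and v: "v \<in> tangent_space A n"
  shows "dL A S m n [u] [v] = tangent_deriv m u (\<lambda>x. S x n [] [v])"
proof -
  let ?X = "vf_extension A m u" and ?Y = "vf_extension A n v"
  have "dL A S m n [u] [v] = lie_deriv (prod_atlas A A) (hlift_L A ?X) (\<lambda>(x, y). S x y [] [?Y y]) (m, n)"
    by (simp add: dL_def dL_eval_def omit_def biform_eval_def)
  also have "\<dots> = tangent_deriv m (?X m) (\<lambda>x. S x n [] [?Y n])"
  proof (rule lie_deriv_hlift_L)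
    show "smooth_fun2_at (\<lambda>x y. S x y [] [?Y y]) m n"
      by (rule biform_0_1_smooth_fun2_at[OF S vector_field_smooth_field_at[OF vector_field_vf_extension[OF v]]])
  qed (simp add: vf_extension_at u)
  finally show ?thesis by (simp add: vf_extension_at u v)
qed

lemma biform_dL:
  assumes S: "biform A 0 1 UNIV S"
  shows "biform A 1 1 UNIV (dL A S)"
  unfolding biform_1_1_iff
proof (intro conjI allI impI ballI)
  fix c d e f p q assume "c \<in> charts_at A p \<and> d \<in> charts_at A q \<and> (p, q) \<in> UNIV"
  then have c: "c \<in> charts_at A p" and d: "d \<in> charts_at A q" by blast+
  have "\<forall>\<^sub>F z in nhds (p, q). tangent_deriv (fst z) (coord_vec A c (fst z) e) (\<lambda>x'. S x' (snd z) [] [coord_vec A d (snd z) f])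
     = dL A S (fst z) (snd z) [coord_vec A c (fst z) e] [coord_vec A d (snd z) f]"
    using eventually_nhds_fst[OF eventually_charts_at[OF c]] eventually_nhds_snd[OF eventually_charts_at[OF d]]
    by eventually_elim (simp add: dL_eq_tangent_deriv[OF S] coord_vec_in_tangent_space)
  then show "smooth_fun2_at (\<lambda>x y. dL A S x y [coord_vec A c x e] [coord_vec A d y f]) p q"
    by (rule smooth_fun2_at_cong) (intro smooth_fun2_at_tangent_deriv biform_0_1_smooth_fun2_at[OF S] smooth_field_at_coord c d)
qed (simp_all add: dL_eq_tangent_deriv[OF S] tangent_space_add tangent_space_scale tangent_deriv_tv_add tangent_deriv_tv_scale
    biform_0_1_smooth_fun_at[OF S] biform_0_1_add[OF S] biform_0_1_scale[OF S] tangent_deriv_add tangent_deriv_cmult)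

section \<open>The connection paired with the metric, in coordinates\<close>

text \<open>The covector g(\<nabla>_Z X, .) at \<open>m\<close>. Since the right point stays at
  \<open>m\<close> during differentiation, the argument \<open>v\<close> can be a tangent vector and
  needs no extension to a field.\<close>

definition conn_form :: "('m, 'e) biform \<Rightarrow> ('m, 'e) vfield \<Rightarrow> ('m, 'e) vfield \<Rightarrow> 'm \<Rightarrow> ('m, 'e) tv \<Rightarrow> real" where
  "conn_form \<omega> Z X m v = tangent_deriv m (Z m) (\<lambda>x. \<omega> x m [X x] [v])"

text \<open>The Christoffel symbols of the first kind in the chart \<open>c\<close>, contracted with \<open>z\<close>, \<open>e\<close> and \<open>v\<close>.\<close>

definition christoffel ::
  "('m, 'e) biform \<Rightarrow> ('m, 'e) chart \<Rightarrow> 'm \<Rightarrow> ('m, 'e) tv \<Rightarrow> 'e \<Rightarrow> 'e \<Rightarrow> real" where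
  "christoffel \<omega> c m v z e = frechet_derivative
     (\<lambda>x. \<omega> (chart_inv c x) m [coord_vec A c (chart_inv c x) e] [v]) (at (chart_map c m)) z"

text \<open>The vector \<open>e\<close> sits below the derivative, so its expansion must hold in a
  neighbourhood of the point before it can be differentiated term by term.\<close>

lemma christoffel_expand:
  assumes \<omega>: "biform A 1 1 W \<omega>" and W: "(m, m) \<in> W" and v: "v \<in> tangent_space A m" and c: "c \<in> charts_at A m"
  shows "christoffel \<omega> c m v z e = (\<Sum>b\<in>E. (e \<bullet> b) * christoffel \<omega> c m v z b)"
proof -
  let ?x = "chart_map c m"
  define \<beta> where "\<beta> = (\<lambda>b x. \<omega> (chart_inv c x) m [coord_vec A c (chart_inv c x) b] [v])"
  have d\<beta>: "(\<beta> b has_derivative frechet_derivative (\<beta> b) (at ?x)) (at ?x)" for b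
    unfolding \<beta>_def by (rule smooth_at_has_derivative[OF smooth_fun_atD[OF biform_smooth_fun_at[OF \<omega> W smooth_field_at_coord[OF c] v] c]])
  have "\<forall>\<^sub>F x in nhds ?x. (\<Sum>b\<in>E. (e \<bullet> b) * \<beta> b x) = \<beta> e x"
    using eventually_chart_inv_charts_at[OF c c] eventually_chart_inv[OF c eventually_biform_slice[OF \<omega> W]]
  proof eventually_elim
    case (elim x)
    show ?case
      using biform_expand_left[OF \<omega> elim(2) coord_vec_in_tangent_space[OF elim(1)] v elim(1), of e] elim(1)
      by (simp add: \<beta>_def)
  qed
  moreover have "((\<lambda>x. \<Sum>b\<in>E. (e \<bullet> b) * \<beta> b x) has_derivative
      (\<lambda>z. \<Sum>b\<in>E. (e \<bullet> b) * frechet_derivative (\<beta> b) (at ?x) z)) (at ?x)"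
    by (intro has_derivative_sum has_derivative_mult_right d\<beta>)
  ultimately show ?thesis
    unfolding christoffel_def \<beta>_def by (subst frechet_derivative_eventually_eqI) auto
qed

text \<open>After expansion of \<open>X\<close> in the coordinate frame the product rule splits the
  derivative: differentiating the components of \<open>X\<close> gives the first term,
  differentiating the bi-form on the frame gives the second.\<close>

lemma conn_form_coord:
  assumes \<omega>: "biform A 1 1 W \<omega>" and W: "(m, m) \<in> W" and X: "smooth_field_at X m" and Z: "Z m \<in> tangent_space A m"
    and v: "v \<in> tangent_space A m" and c: "c \<in> charts_at A m"
  shows "conn_form \<omega> Z X m v =
    \<omega> m m [coord_vec A c m (frechet_derivative (\<lambda>x. X (chart_inv c x) c) (at (chart_map c m)) (Z m c))] [v]
    + christoffel \<omega> c m v (Z m c) (X m c)"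
proof -
  let ?x = "chart_map c m" and ?z = "Z m c"
  define Xc where "Xc = (\<lambda>x. X (chart_inv c x) c)"
  define \<beta> where "\<beta> = (\<lambda>b x. \<omega> (chart_inv c x) m [coord_vec A c (chart_inv c x) b] [v])"
  let ?dX = "frechet_derivative Xc (at ?x)" and ?d\<beta> = "\<lambda>b. frechet_derivative (\<beta> b) (at ?x)"
  have dX: "(Xc has_derivative ?dX) (at ?x)"
    unfolding Xc_def by (rule smooth_at_has_derivative[OF smooth_field_at_smooth[OF X c]])
  have d\<beta>: "(\<beta> b has_derivative ?d\<beta> b) (at ?x)" for b
    unfolding \<beta>_def by (rule smooth_at_has_derivative[OF smooth_fun_atD[OF biform_smooth_fun_at[OF \<omega> W smooth_field_at_coord[OF c] v] c]])
  have x: "chart_inv c ?x = m" using c by (simp add: charts_at_iff)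
  have expand: "\<omega> (chart_inv c x) m [u] [v] = (\<Sum>b\<in>E. (u c \<bullet> b) * \<beta> b x)"
    if "c \<in> charts_at A (chart_inv c x)" "(chart_inv c x, m) \<in> W" "u \<in> tangent_space A (chart_inv c x)" for u x
    unfolding \<beta>_def by (rule biform_expand_left[OF \<omega> that(2,3) v that(1)])
  note ev = eventually_chart_inv_charts_at[OF c c] eventually_chart_inv[OF c eventually_biform_slice[OF \<omega> W]]
  have "\<forall>\<^sub>F x in nhds ?x. (\<Sum>b\<in>E. (Xc x \<bullet> b) * \<beta> b x) = \<omega> (chart_inv c x) m [X (chart_inv c x)] [v]"
    using ev eventually_chart_inv[OF c smooth_field_at_eventually[OF X]]
    by eventually_elim (simp add: expand Xc_def)
  moreover have "((\<lambda>x. \<Sum>b\<in>E. (Xc x \<bullet> b) * \<beta> b x) has_derivative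
      (\<lambda>z. \<Sum>b\<in>E. (Xc ?x \<bullet> b) * ?d\<beta> b z + (?dX z \<bullet> b) * \<beta> b ?x)) (at ?x)"
    by (intro has_derivative_sum has_derivative_mult d\<beta> has_derivative_inner_left dX)
  ultimately have 1: "conn_form \<omega> Z X m v = (\<Sum>b\<in>E. (Xc ?x \<bullet> b) * ?d\<beta> b ?z + (?dX ?z \<bullet> b) * \<beta> b ?x)"
    unfolding conn_form_def tangent_deriv_eq[OF Z biform_smooth_fun_at[OF \<omega> W X v] c]
    by (subst frechet_derivative_eventually_eqI) auto
  have 2: "christoffel \<omega> c m v ?z (X m c) = (\<Sum>b\<in>E. (X m c \<bullet> b) * ?d\<beta> b ?z)"
    unfolding \<beta>_def christoffel_def[symmetric] by (rule christoffel_expand[OF \<omega> W v c])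
  have 3: "\<omega> m m [coord_vec A c m (?dX ?z)] [v] = (\<Sum>b\<in>E. (?dX ?z \<bullet> b) * \<beta> b ?x)"
    using expand[of ?x "coord_vec A c m (?dX ?z)"] c W by (simp add: x coord_vec_in_tangent_space)
  show ?thesis
    using 1 2 3 by (simp add: sum.distrib x flip: Xc_def) (simp add: Xc_def x)
qed

lemma smooth_fun_imp_smooth_fun_at: "smooth_fun A UNIV f \<Longrightarrow> smooth_fun_at f p"
proof -
  assume f: "smooth_fun A UNIV f"
  obtain c where c: "c \<in> charts_at A p" using ex_chart .
  then have "smooth_on (chart_map c ` chart_dom c) (\<lambda>x. f (chart_inv c x))"
    using f by (simp add: smooth_fun_def charts_at_iff comp_def)
  then have "smooth_at (\<lambda>x. f (chart_inv c x)) (chart_map c p)"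
    using c by (intro smooth_atI[OF open_chart_image[of c]]) (simp_all add: charts_at_iff)
  then show "smooth_fun_at f p" by (rule smooth_fun_atI[OF c])
qed

lemma vector_field_add: "vector_field A X \<Longrightarrow> vector_field A Y \<Longrightarrow> vector_field A (vf_add X Y)"
  unfolding vf_add_def by (rule vector_fieldI, rule smooth_field_at_add[OF vector_field_smooth_field_at vector_field_smooth_field_at])

lemma vector_field_scale: "smooth_fun A UNIV f \<Longrightarrow> vector_field A X \<Longrightarrow> vector_field A (vf_scale f X)"
  unfolding vf_scale_def by (rule vector_fieldI, rule smooth_field_at_scale[OF smooth_fun_imp_smooth_fun_at vector_field_smooth_field_at])

end

section \<open>The induced connection\<close>

locale contrast = manifold A for A :: "('m::{t2_space, second_countable_topology}, 'e::real_inner) chart set" +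
  fixes W :: "('m \<times> 'm) set" and \<omega> :: "('m, 'e) biform"
  assumes contrast: "contrast_biform A W \<omega>"
begin

lemma diag_W: "(m, m) \<in> W"
  using contrast by (simp add: contrast_biform_def)

lemma biform: "biform A 1 1 W \<omega>"
  using contrast by (simp add: contrast_biform_def)

lemma induced_metric_eq: "induced_metric \<omega> m u v = \<omega> m m [u] [v]"
  by (simp add: induced_metric_def diag_pullback_def)

lemma pseudo_riemannian: "pseudo_riemannian A (induced_metric \<omega>)"
  using contrast by (simp add: contrast_biform_def)

lemma nondegenerate:
  assumes "u \<in> tangent_space A m" "\<And>v. v \<in> tangent_space A m \<Longrightarrow> \<omega> m m [u] [v] = 0"
  shows "u = tv_zero"
proof -
  have "\<forall>p. \<forall>u\<in>tangent_space A p. (\<forall>v\<in>tangent_space A p. \<omega> p p [u] [v] = 0) \<longrightarrow> u = tv_zero"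
    using pseudo_riemannian unfolding pseudo_riemannian_def induced_metric_eq by (elim conjE)
  then show ?thesis using assms by blast
qed

lemmas add_left = biform_add_left[OF biform]
lemmas scale_left = biform_scale_left[OF biform]
lemmas add_right = biform_add_right[OF biform]
lemmas scale_right = biform_scale_right[OF biform]

lemma metric_eqI:
  assumes u: "u \<in> tangent_space A m" and u': "u' \<in> tangent_space A m"
    and eq: "\<And>v. v \<in> tangent_space A m \<Longrightarrow> \<omega> m m [u] [v] = \<omega> m m [u'] [v]"
  shows "u = u'"
proof -
  have "tv_add u (tv_scale (-1) u') = tv_zero"
    using u u' by (intro nondegenerate[where m = m])
      (simp_all add: tangent_space_add tangent_space_scale add_left scale_left diag_W eq)
  then have "u c - u' c = 0" for c
    by (metis (no_types, lifting) tv_add_def tv_scale_def tv_zero_def scaleR_minus1_left diff_conv_add_uminus)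
  then show ?thesis by (intro ext) simp
qed

text \<open>In coordinates the form at \<open>m\<close> is \<open>v c \<bullet> L e\<close> with a
  linear \<open>L\<close>; nondegeneracy makes \<open>L\<close> injective, and finite dimension then
  makes it surjective.\<close>

lemma riesz:
  assumes add: "\<And>u v. u \<in> tangent_space A m \<Longrightarrow> v \<in> tangent_space A m \<Longrightarrow> \<phi> (tv_add u v) = \<phi> u + \<phi> v"
    and scale: "\<And>a v. v \<in> tangent_space A m \<Longrightarrow> \<phi> (tv_scale a v) = a * \<phi> v"
  obtains w where "w \<in> tangent_space A m" "\<And>v. v \<in> tangent_space A m \<Longrightarrow> \<omega> m m [w] [v] = \<phi> v"
proof -
  obtain c where c: "c \<in> charts_at A m" using ex_chart .
  note T = coord_vec_in_tangent_space[OF c]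
  define L where "L = (\<lambda>e. \<Sum>b\<in>E. \<omega> m m [coord_vec A c m e] [coord_vec A c m b] *\<^sub>R b)"
  have L: "linear L"
    unfolding L_def by (rule linearI)
      (simp_all add: coord_vec_add[OF c] coord_vec_scale[OF c] add_left scale_left diag_W T
        scaleR_left_distrib sum.distrib scaleR_sum_right)
  have repr: "\<omega> m m [coord_vec A c m e] [v] = v c \<bullet> L e" if v: "v \<in> tangent_space A m" for e v
    unfolding L_def using biform_expand_right[OF biform diag_W T v c]
    by (simp add: inner_sum_right mult.commute)
  have "surj L"
  proof (rule frame_linear_inj_imp_surj[OF frame_E L])
    fix e assume "L e = 0"
    then have "coord_vec A c m e = tv_zero"
      by (intro nondegenerate[where m = m]) (simp_all add: repr T)
    then have "coord_vec A c m e c = tv_zero c" by simp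
    then show "e = 0" by (simp add: tv_zero_def c)
  qed
  \<comment> \<open>The right-hand side is the coordinate vector whose inner product with
    \<open>v c\<close> is \<open>\<phi> v\<close>, by expansion of \<open>v\<close> in the
    coordinate frame.\<close>
  then obtain e where e: "L e = (\<Sum>b\<in>E. \<phi> (coord_vec A c m b) *\<^sub>R b)"
    by (metis surjD)
  have "\<omega> m m [coord_vec A c m e] [v] = \<phi> v" if v: "v \<in> tangent_space A m" for v
    using coord_linear_expand[OF c v, of \<phi>] add scale
    by (simp add: repr[OF v] e inner_sum_right mult.commute)
  with T show ?thesis by (rule that)
qed

lemma conn_form_add_vector:
  assumes X: "smooth_field_at X m" and Z: "Z m \<in> tangent_space A m" and "v \<in> tangent_space A m" "v' \<in> tangent_space A m"
  shows "conn_form \<omega> Z X m (tv_add v v') = conn_form \<omega> Z X m v + conn_form \<omega> Z X m v'"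
proof -
  have "\<forall>\<^sub>F x in nhds m. \<omega> x m [X x] [tv_add v v'] = \<omega> x m [X x] [v] + \<omega> x m [X x] [v']"
    using eventually_biform_slice[OF biform diag_W] smooth_field_at_eventually[OF X]
    by eventually_elim (simp add: add_right assms)
  then show ?thesis
    unfolding conn_form_def by (simp add: tangent_deriv_cong tangent_deriv_add[OF Z] biform_smooth_fun_at[OF biform diag_W X] assms)
qed

lemma conn_form_scale_vector:
  assumes X: "smooth_field_at X m" and Z: "Z m \<in> tangent_space A m" and "v \<in> tangent_space A m"
  shows "conn_form \<omega> Z X m (tv_scale a v) = a * conn_form \<omega> Z X m v"
proof -
  have "\<forall>\<^sub>F x in nhds m. \<omega> x m [X x] [tv_scale a v] = a * \<omega> x m [X x] [v]"
    using eventually_biform_slice[OF biform diag_W] smooth_field_at_eventually[OF X]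
    by eventually_elim (simp add: scale_right assms)
  then show ?thesis
    unfolding conn_form_def by (simp add: tangent_deriv_cong tangent_deriv_cmult[OF Z] biform_smooth_fun_at[OF biform diag_W X] assms)
qed

lemma lie_deriv_biform_eval:
  assumes "vector_field A Z" "vector_field A X" "vector_field A Y"
  shows "lie_deriv (prod_atlas A A) (hlift_L A Z) (biform_eval \<omega> [X] [Y]) (m, m) = conn_form \<omega> Z X m (Y m)"
proof -
  have "biform_eval \<omega> [X] [Y] = (\<lambda>(x, y). \<omega> x y [X x] [Y y])"
    by (simp add: biform_eval_def)
  then show ?thesis
    unfolding conn_form_def
    using assms by (simp add: lie_deriv_hlift_L biform_smooth_fun2_at[OF biform diag_W] vector_field_smooth_field_at vector_field_tangent)
qed

text \<open>Tested against a coordinate frame, the components of \<open>V\<close> solve a linear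
  system whose matrix is that of the metric and whose right-hand side is smooth by
  \<open>sm\<close>.\<close>

lemma smooth_field_at_of_metric:
  assumes T: "\<And>q. V q \<in> tangent_space A q"
    and sm: "\<And>Y. smooth_field_at Y p \<Longrightarrow> smooth_fun_at (\<lambda>q. \<omega> q q [V q] [Y q]) p"
  shows "smooth_field_at V p"
proof -
  obtain c where c: "c \<in> charts_at A p" using ex_chart .
  let ?x = "chart_map c p"
  define G where "G = (\<lambda>i j y. \<omega> (chart_inv c y) (chart_inv c y)
    [coord_vec A c (chart_inv c y) j] [coord_vec A c (chart_inv c y) i])"
  define h where "h = (\<lambda>i y. \<omega> (chart_inv c y) (chart_inv c y)
    [V (chart_inv c y)] [coord_vec A c (chart_inv c y) i])"
  have x: "chart_inv c ?x = p" using c by (simp add: charts_at_iff)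
  have comp: "smooth_at (\<lambda>y. V (chart_inv c y) c \<bullet> b) ?x" if "b \<in> E" for b
  proof (rule smooth_linear_system[OF finite_E, where I = E and G = G and h = h
        and V = "\<lambda>b y. V (chart_inv c y) c \<bullet> b"])
    show "smooth_at (G i j) ?x" for i j
      unfolding G_def
      using smooth_fun_atD[OF smooth_fun2_at_diag[OF biform_smooth_fun2_at[OF biform diag_W smooth_field_at_coord[OF c] smooth_field_at_coord[OF c]]] c] .
    show "smooth_at (h i) ?x" for i
      unfolding h_def using smooth_fun_atD[OF sm[OF smooth_field_at_coord[OF c]] c] .
    show "\<forall>\<^sub>F y in nhds ?x. \<forall>i\<in>E. (\<Sum>j\<in>E. G i j y * (V (chart_inv c y) c \<bullet> j)) = h i y"
      using eventually_chart_inv_charts_at[OF c c]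
    proof eventually_elim
      case (elim y)
      show ?case
        unfolding G_def h_def
        using biform_expand_left[OF biform diag_W T coord_vec_in_tangent_space[OF elim] elim]
        by (simp add: mult.commute)
    qed
    \<comment> \<open>By orthonormality of \<open>E\<close> the vector \<open>w\<close> has the
      coordinates \<open>k\<close>. It pairs to 0 with the whole coordinate frame, so nondegeneracy
      of the metric forces it to be 0.\<close>
    show "k j = 0" if k: "\<And>i. i \<in> E \<Longrightarrow> (\<Sum>j\<in>E. G i j ?x * k j) = 0" and j: "j \<in> E" for k j
    proof -
      define w where "w = (\<Sum>j\<in>E. k j *\<^sub>R j)"
      have wi: "w \<bullet> i = k i" if "i \<in> E" for i
      proof -
        have "w \<bullet> i = (\<Sum>j\<in>E. if j = i then k j else 0)"
          unfolding w_def inner_sum_left using that by (intro sum.cong) (simp_all add: inner_E)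
        then show ?thesis using that finite_E by simp
      qed
      have 0: "\<omega> p p [coord_vec A c p w] [coord_vec A c p i] = 0" if "i \<in> E" for i
        using k[OF that] biform_expand_left[OF biform diag_W coord_vec_in_tangent_space[OF c]
            coord_vec_in_tangent_space[OF c] c, of w i]
        by (simp add: c wi G_def x mult.commute)
      have "coord_vec A c p w = tv_zero"
      proof (rule nondegenerate[OF coord_vec_in_tangent_space[OF c]])
        fix v assume "v \<in> tangent_space A p"
        then show "\<omega> p p [coord_vec A c p w] [v] = 0"
          by (subst biform_expand_right[OF biform diag_W coord_vec_in_tangent_space[OF c] _ c])
            (simp_all add: 0)
      qed
      then have "coord_vec A c p w c = tv_zero c" by simp
      then have "w = 0" by (simp add: c tv_zero_def)
      then show ?thesis using wi[OF j] by simp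
    qed
  qed (use that in simp_all)
  have "smooth_at (\<lambda>y. \<Sum>b\<in>E. (V (chart_inv c y) c \<bullet> b) *\<^sub>R b) ?x"
    by (intro smooth_at_sum smooth_at_scaleR comp smooth_at_const)
  then have "smooth_at (\<lambda>y. V (chart_inv c y) c) ?x"
    by (simp add: frame_expand[OF frame_E])
  then show ?thesis
    by (intro smooth_field_atI[OF always_eventually c]) (simp_all add: T)
qed

text \<open>The connection is given by a definite description, so a unique smooth solution has to be
  exhibited: \<open>riesz\<close> solves the equation at each point,
  \<open>smooth_field_at_of_metric\<close> makes the solutions smooth, and nondegeneracy makes them
  unique.\<close>

lemma induced_connection:
  assumes Z: "vector_field A Z" and X: "vector_field A X"
  shows vector_field_induced_connection: "vector_field A (induced_connection A \<omega> Z X)"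
    and induced_connection_eq: "v \<in> tangent_space A m \<Longrightarrow>
      \<omega> m m [induced_connection A \<omega> Z X m] [v] = conn_form \<omega> Z X m v"
proof -
  let ?P = "\<lambda>V. vector_field A V \<and> (\<forall>Y m. vector_field A Y \<longrightarrow>
        induced_metric \<omega> m (V m) (Y m) =
        lie_deriv (prod_atlas A A) (hlift_L A Z) (biform_eval \<omega> [X] [Y]) (m, m))"
  \<comment> \<open>Testing against vector fields and against tangent vectors amounts to the same,
    as every tangent vector extends to a field.\<close>
  have P: "?P V \<longleftrightarrow> vector_field A V \<and> (\<forall>m. \<forall>v\<in>tangent_space A m. \<omega> m m [V m] [v] = conn_form \<omega> Z X m v)" for V
  proof (intro iffI conjI; (elim conjE)?; (intro allI ballI impI)?)
    fix m v assume "\<forall>Y m. vector_field A Y \<longrightarrow>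
        induced_metric \<omega> m (V m) (Y m) =
        lie_deriv (prod_atlas A A) (hlift_L A Z) (biform_eval \<omega> [X] [Y]) (m, m)" and v: "v \<in> tangent_space A m"
    from this(1)[rule_format, OF vector_field_vf_extension[OF v], of m]
    show "\<omega> m m [V m] [v] = conn_form \<omega> Z X m v"
      by (simp add: induced_metric_eq lie_deriv_biform_eval Z X vector_field_vf_extension vf_extension_at v)
  next
    fix Y m assume "\<forall>m. \<forall>v\<in>tangent_space A m. \<omega> m m [V m] [v] = conn_form \<omega> Z X m v" "vector_field A Y"
    then show "induced_metric \<omega> m (V m) (Y m) =
        lie_deriv (prod_atlas A A) (hlift_L A Z) (biform_eval \<omega> [X] [Y]) (m, m)"
      by (simp add: induced_metric_eq lie_deriv_biform_eval Z X vector_field_tangent)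
  qed
  have "\<exists>w. w \<in> tangent_space A m \<and> (\<forall>v\<in>tangent_space A m. \<omega> m m [w] [v] = conn_form \<omega> Z X m v)" for m
    by (rule riesz[of m "conn_form \<omega> Z X m"])
      (use Z X in \<open>auto simp: conn_form_add_vector conn_form_scale_vector vector_field_smooth_field_at vector_field_tangent\<close>)
  then obtain V where V: "\<And>m. V m \<in> tangent_space A m"
    "\<And>m v. v \<in> tangent_space A m \<Longrightarrow> \<omega> m m [V m] [v] = conn_form \<omega> Z X m v"
    by metis
  have "smooth_field_at V p" for p
  proof (rule smooth_field_at_of_metric[OF V(1)])
    fix Y assume Y: "smooth_field_at Y p"
    have "smooth_fun_at (\<lambda>q. conn_form \<omega> Z X q (Y q)) p"
      unfolding conn_form_def
      by (rule smooth_fun2_at_diag) (intro smooth_fun2_at_tangent_deriv biform_smooth_fun2_at[OF biform diag_W] vector_field_smooth_field_at[OF Z]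
          vector_field_smooth_field_at[OF X] Y)
    moreover have "\<forall>\<^sub>F q in nhds p. conn_form \<omega> Z X q (Y q) = \<omega> q q [V q] [Y q]"
      using smooth_field_at_eventually[OF Y] by eventually_elim (simp add: V(2))
    ultimately show "smooth_fun_at (\<lambda>q. \<omega> q q [V q] [Y q]) p"
      by (rule smooth_fun_at_cong[rotated])
  qed
  then have V': "?P V"
    unfolding P using V(2) by (simp add: vector_fieldI)
  have "?P (induced_connection A \<omega> Z X)"
    unfolding induced_connection_def
  proof (rule theI[of ?P V, OF V'])
    fix V' assume "?P V'"
    then have "vector_field A V'" "\<And>m v. v \<in> tangent_space A m \<Longrightarrow> \<omega> m m [V' m] [v] = conn_form \<omega> Z X m v"
      unfolding P by blast+
    then have "V' m = V m" for m
      using V by (intro metric_eqI[of "V' m" m "V m"]) (simp_all add: vector_field_tangent)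
    then show "V' = V" by (rule ext)
  qed
  then show "vector_field A (induced_connection A \<omega> Z X)"
    "v \<in> tangent_space A m \<Longrightarrow> \<omega> m m [induced_connection A \<omega> Z X m] [v] = conn_form \<omega> Z X m v"
    unfolding P by blast+
qed

lemma induced_connection_eqI:
  assumes Z: "vector_field A Z" and X: "vector_field A X" and u: "u \<in> tangent_space A m"
    and "\<And>v. v \<in> tangent_space A m \<Longrightarrow> conn_form \<omega> Z X m v = \<omega> m m [u] [v]"
  shows "induced_connection A \<omega> Z X m = u"
proof (rule metric_eqI)
  show "induced_connection A \<omega> Z X m \<in> tangent_space A m"
    by (rule vector_field_tangent[OF vector_field_induced_connection[OF Z X]])
  show "\<omega> m m [induced_connection A \<omega> Z X m] [v] = \<omega> m m [u] [v]" if "v \<in> tangent_space A m" for v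
    using induced_connection_eq[OF Z X that] assms(4)[OF that] by simp
qed (rule u)

text \<open>Each axiom is checked after pairing with a tangent vector; there it becomes linearity of
  \<open>tangent_deriv\<close> or the product rule.\<close>

lemma affine_connection_induced: "affine_connection A (induced_connection A \<omega>)"
  unfolding affine_connection_def
proof (intro allI impI, elim conjE, intro conjI allI impI)
  fix X Y :: "('m, 'e) vfield" assume X: "vector_field A X" and Y: "vector_field A Y"
  let ?D = "induced_connection A \<omega>"
  note T = vector_field_tangent vector_field_induced_connection tangent_space_add tangent_space_scale
  have T': "vf_add V V' m \<in> tangent_space A m" if "V m \<in> tangent_space A m" "V' m \<in> tangent_space A m" for V V' m
    using that by (simp add: vf_add_def T)
  have T'': "vf_scale f V m \<in> tangent_space A m" if "V m \<in> tangent_space A m" for V f m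
    using that by (simp add: vf_scale_def T)
  note sm = biform_smooth_fun_at[OF biform diag_W] vector_field_smooth_field_at
  show "vector_field A (?D X Y)"
    by (rule vector_field_induced_connection[OF X Y])
  {
    fix Z assume Z: "vector_field A Z"
    show "?D (vf_add X Z) Y = vf_add (?D X Y) (?D Z Y)"
    proof (rule ext, rule induced_connection_eqI)
      fix m v assume v: "v \<in> tangent_space A m"
      show "conn_form \<omega> (vf_add X Z) Y m v = \<omega> m m [vf_add (?D X Y) (?D Z Y) m] [v]"
        using X Y Z v
        by (simp add: vf_add_def add_left diag_W T induced_connection_eq)
          (simp add: conn_form_def tangent_deriv_tv_add sm T)
    qed (simp_all add: X Y Z vector_field_add T T')
    show "?D X (vf_add Y Z) = vf_add (?D X Y) (?D X Z)"
    proof (rule ext, rule induced_connection_eqI)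
      fix m v assume v: "v \<in> tangent_space A m"
      have "\<forall>\<^sub>F x in nhds m. \<omega> x m [vf_add Y Z x] [v] = \<omega> x m [Y x] [v] + \<omega> x m [Z x] [v]"
        using eventually_biform_slice[OF biform diag_W]
        by eventually_elim (simp add: vf_add_def add_left v Y Z T)
      then have "conn_form \<omega> X (vf_add Y Z) m v = conn_form \<omega> X Y m v + conn_form \<omega> X Z m v"
        unfolding conn_form_def using X Y Z v by (simp add: tangent_deriv_cong tangent_deriv_add sm T)
      then show "conn_form \<omega> X (vf_add Y Z) m v = \<omega> m m [vf_add (?D X Y) (?D X Z) m] [v]"
        using X Y Z v by (simp add: vf_add_def add_left diag_W T induced_connection_eq)
    qed (simp_all add: X Y Z vector_field_add T T')
  }
  {
    fix f assume f: "smooth_fun A UNIV f"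
    show "?D (vf_scale f X) Y = vf_scale f (?D X Y)"
    proof (rule ext, rule induced_connection_eqI)
      fix m v assume v: "v \<in> tangent_space A m"
      show "conn_form \<omega> (vf_scale f X) Y m v = \<omega> m m [vf_scale f (?D X Y) m] [v]"
        using X Y v
        by (simp add: vf_scale_def scale_left diag_W T induced_connection_eq)
          (simp add: conn_form_def tangent_deriv_tv_scale sm T)
    qed (simp_all add: X Y f vector_field_scale T T'')
    show "?D X (vf_scale f Y) = vf_add (vf_scale (lie_deriv A X f) Y) (vf_scale f (?D X Y))"
    proof (rule ext, rule induced_connection_eqI)
      fix m v assume v: "v \<in> tangent_space A m"
      have "\<forall>\<^sub>F x in nhds m. \<omega> x m [vf_scale f Y x] [v] = f x * \<omega> x m [Y x] [v]"
        using eventually_biform_slice[OF biform diag_W]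
        by eventually_elim (simp add: vf_scale_def scale_left v Y T)
      then have "conn_form \<omega> X (vf_scale f Y) m v
          = f m * conn_form \<omega> X Y m v + lie_deriv A X f m * \<omega> m m [Y m] [v]"
        unfolding conn_form_def lie_deriv_eq_tangent_deriv
        using X Y v by (simp add: tangent_deriv_cong tangent_deriv_mult sm T smooth_fun_imp_smooth_fun_at[OF f])
      then show "conn_form \<omega> X (vf_scale f Y) m v
          = \<omega> m m [vf_add (vf_scale (lie_deriv A X f) Y) (vf_scale f (?D X Y)) m] [v]"
        using X Y v by (simp add: vf_add_def vf_scale_def add_left scale_left diag_W T induced_connection_eq)
    qed (simp_all add: X Y f vector_field_scale T T' T'')
  }
qed

section \<open>Torsion and Christoffel symbols\<close>

text \<open>Paired with \<open>v\<close>, the field derivatives in \<open>conn_form_coord\<close>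
  combine to the Lie bracket, so what is left of the torsion is the antisymmetric part of the
  Christoffel symbols. Arbitrary \<open>z\<close> and \<open>e\<close> occur, since coordinate
  vectors extend to vector fields.\<close>

lemma torsion_free_iff:
  "torsion_free A (induced_connection A \<omega>) \<longleftrightarrow>
    (\<forall>m v c z e. v \<in> tangent_space A m \<and> c \<in> charts_at A m \<longrightarrow>
      christoffel \<omega> c m v z e = christoffel \<omega> c m v e z)"
proof -
  let ?D = "induced_connection A \<omega>"
  note T = vector_field_tangent vector_field_induced_connection tangent_space_add tangent_space_scale
  have key: "?D X Y m c - ?D Y X m c = lie_bracket A X Y m c \<longleftrightarrow>
      (\<forall>v\<in>tangent_space A m. christoffel \<omega> c m v (X m c) (Y m c) = christoffel \<omega> c m v (Y m c) (X m c))"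
    if X: "vector_field A X" and Y: "vector_field A Y" and c: "c \<in> charts_at A m" for X Y m c
  proof -
    define dX where "dX = frechet_derivative (\<lambda>x. X (chart_inv c x) c) (at (chart_map c m)) (Y m c)"
    define dY where "dY = frechet_derivative (\<lambda>x. Y (chart_inv c x) c) (at (chart_map c m)) (X m c)"
    \<comment> \<open>\<open>?u\<close> is \<nabla>_X Y - \<nabla>_Y X at \<open>m\<close>, and
      \<open>?b\<close> is the bracket, both as tangent vectors so that the metric can compare
      them.\<close>
    let ?u = "tv_add (?D X Y m) (tv_scale (-1) (?D Y X m))" and ?b = "coord_vec A c m (dY - dX)"
    have C: "\<omega> m m [coord_vec A c m (dY - dX)] [v] = \<omega> m m [coord_vec A c m dY] [v] - \<omega> m m [coord_vec A c m dX] [v]"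
      if v: "v \<in> tangent_space A m" for v
      using coord_vec_add[OF c, of dY "- dX"] coord_vec_scale[OF c, of "-1" dX] v
      by (simp add: add_left scale_left diag_W T coord_vec_in_tangent_space[OF c])
    have "\<omega> m m [?u] [v] = \<omega> m m [?b] [v] + (christoffel \<omega> c m v (X m c) (Y m c) - christoffel \<omega> c m v (Y m c) (X m c))"
      if v: "v \<in> tangent_space A m" for v
      using X Y v c conn_form_coord[where Z = Y and X = X and m = m, OF biform diag_W vector_field_smooth_field_at[OF X] vector_field_tangent[OF Y] v c]
        conn_form_coord[where Z = X and X = Y and m = m, OF biform diag_W vector_field_smooth_field_at[OF Y] vector_field_tangent[OF X] v c]
      by (simp add: add_left scale_left diag_W T induced_connection_eq C flip: dX_def dY_def)
    then have "(\<forall>v\<in>tangent_space A m. christoffel \<omega> c m v (X m c) (Y m c) = christoffel \<omega> c m v (Y m c) (X m c))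
        \<longleftrightarrow> (\<forall>v\<in>tangent_space A m. \<omega> m m [?u] [v] = \<omega> m m [?b] [v])"
      by simp
    also have "\<dots> \<longleftrightarrow> ?u = ?b"
      using metric_eqI[of ?u m ?b] X Y c by (auto simp: T coord_vec_in_tangent_space)
    also have "\<dots> \<longleftrightarrow> ?u c = ?b c"
      using tangent_space_eqI[of ?u m ?b c] X Y c by (auto simp: T coord_vec_in_tangent_space)
    also have "\<dots> \<longleftrightarrow> ?D X Y m c - ?D Y X m c = lie_bracket A X Y m c"
      using c by (simp add: tv_add_def tv_scale_def lie_bracket_def dX_def dY_def)
    finally show ?thesis by simp
  qed
  \<comment> \<open>At charts not around \<open>m\<close> all tangent vectors are 0 by convention,
    and \<open>lie_bracket\<close> follows the same convention.\<close>
  have outside: "?D X Y m c - ?D Y X m c = lie_bracket A X Y m c"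
    if "vector_field A X" "vector_field A Y" "c \<notin> charts_at A m" for X Y m c
    using that by (simp add: lie_bracket_def tangent_space_outside[OF vector_field_tangent[OF vector_field_induced_connection]])
  have "torsion_free A ?D \<longleftrightarrow> (\<forall>X Y. vector_field A X \<and> vector_field A Y \<longrightarrow>
      (\<forall>m c. ?D X Y m c - ?D Y X m c = lie_bracket A X Y m c))"
    unfolding torsion_free_def torsion_def tv_zero_def fun_eq_iff by (simp only: right_minus_eq)
  also have "\<dots> \<longleftrightarrow> (\<forall>m v c z e. v \<in> tangent_space A m \<and> c \<in> charts_at A m \<longrightarrow>
      christoffel \<omega> c m v z e = christoffel \<omega> c m v e z)" (is "?l \<longleftrightarrow> ?r")
  proof
    assume l: ?l
    show ?r
    proof (intro allI impI, elim conjE)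
      fix m v c z e assume v: "v \<in> tangent_space A m" and c: "c \<in> charts_at A m"
      let ?X = "vf_extension A m (coord_vec A c m z)" and ?Y = "vf_extension A m (coord_vec A c m e)"
      note ext = vector_field_vf_extension[OF coord_vec_in_tangent_space[OF c]]
      from l ext have "?D ?X ?Y m c - ?D ?Y ?X m c = lie_bracket A ?X ?Y m c" by blast
      then show "christoffel \<omega> c m v z e = christoffel \<omega> c m v e z"
        using v unfolding key[OF ext ext c]
        by (simp add: vf_extension_at[OF coord_vec_in_tangent_space[OF c]] c)
    qed
  next
    assume r: ?r
    show ?l
    proof (intro allI impI, elim conjE)
      fix X Y m c assume X: "vector_field A X" and Y: "vector_field A Y"
      show "?D X Y m c - ?D Y X m c = lie_bracket A X Y m c"
      proof (cases "c \<in> charts_at A m")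
        case True
        show ?thesis unfolding key[OF X Y True] using r True by blast
      next
        case False
        then show ?thesis using outside X Y by blast
      qed
    qed
  qed
  finally show ?thesis .
qed

end

context manifold
begin

text \<open>\<open>taylor_potential\<close> is written with \<open>conn_form\<close>, whose smooth
  dependence on the point is known; this identifies its coefficients as Christoffel symbols.
  Coordinate fields have constant components, so no further term appears.\<close>

lemma conn_form_coord_fields:
  assumes \<omega>: "biform A 1 1 W \<omega>" and W: "(m, m) \<in> W" and v: "v \<in> tangent_space A m" and c: "c \<in> charts_at A m"
  shows "conn_form \<omega> (\<lambda>x. coord_vec A c x z) (\<lambda>x. coord_vec A c x e) m v = christoffel \<omega> c m v z e"
  unfolding conn_form_def christoffel_def
  by (simp add: tangent_deriv_eq[OF coord_vec_in_tangent_space[OF c] biform_smooth_fun_at[OF \<omega> W smooth_field_at_coord[OF c] v] c] c)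

lemma linear_christoffel:
  assumes \<omega>: "biform A 1 1 W \<omega>" and W: "(m, m) \<in> W" and v: "v \<in> tangent_space A m" and c: "c \<in> charts_at A m"
  shows "linear (\<lambda>z. christoffel \<omega> c m v z e)"
  unfolding christoffel_def
  by (rule has_derivative_linear[OF smooth_at_has_derivative[OF smooth_fun_atD[OF biform_smooth_fun_at[OF \<omega> W smooth_field_at_coord[OF c] v] c]]])

text \<open>Near the point the components of \<open>dL A S\<close> are the partial derivatives of a
  single function, so their derivatives are its second derivatives.\<close>

lemma christoffel_dL:
  assumes S: "biform A 0 1 UNIV S" and v: "v \<in> tangent_space A m" and c: "c \<in> charts_at A m"
  shows "christoffel (dL A S) c m v z e = frechet_derivative
    (\<lambda>x. frechet_derivative (\<lambda>x. S (chart_inv c x) m [] [v]) (at x) e) (at (chart_map c m)) z"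
proof -
  have "\<forall>\<^sub>F x in nhds (chart_map c m). dL A S (chart_inv c x) m [coord_vec A c (chart_inv c x) e] [v]
      = frechet_derivative (\<lambda>x. S (chart_inv c x) m [] [v]) (at x) e"
    using eventually_chart_inv_charts_at[OF c c] eventually_chart_image[OF c]
  proof eventually_elim
    case (elim x)
    show ?case
      using elim(2) by (simp add: dL_eq_tangent_deriv[OF S] coord_vec_in_tangent_space elim(1) v
          tangent_deriv_eq[OF _ biform_0_1_smooth_fun_at[OF S v] elim(1)])
  qed
  then show ?thesis
    unfolding christoffel_def by (simp add: frechet_derivative_cong)
qed

text \<open>The derivative at \<open>m\<close> sees the bi-forms at the points (x, m) with
  \<open>x\<close> near \<open>m\<close>, and these lie in the open set \<open>W\<close>.\<close>

lemma christoffel_cong: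
  assumes "open W" "(m, m) \<in> W" "biform_eq_on A 1 1 W \<omega> \<theta>" "v \<in> tangent_space A m" and c: "c \<in> charts_at A m"
  shows "christoffel \<omega> c m v z e = christoffel \<theta> c m v z e"
proof -
  have "filterlim (\<lambda>x. (x, m)) (nhds (m, m)) (nhds m)"
    by (intro tendsto_Pair filterlim_ident tendsto_const)
  then have "\<forall>\<^sub>F x in nhds m. (x, m) \<in> W"
    using eventually_nhds_in_open[OF assms(1,2)] unfolding filterlim_iff by blast
  from eventually_chart_inv[OF c this] eventually_chart_inv_charts_at[OF c c]
  have "\<forall>\<^sub>F x in nhds (chart_map c m). \<omega> (chart_inv c x) m [coord_vec A c (chart_inv c x) e] [v]
      = \<theta> (chart_inv c x) m [coord_vec A c (chart_inv c x) e] [v]"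
  proof eventually_elim
    case (elim x)
    have *: "\<omega> p q [u] [w] = \<theta> p q [u] [w]"
      if "(p, q) \<in> W" "u \<in> tangent_space A p" "w \<in> tangent_space A q" for p q u w
      using assms(3) that unfolding biform_eq_on_def by force
    show ?case by (rule *[OF elim(1) coord_vec_in_tangent_space[OF elim(2)] assms(4)])
  qed
  then show ?thesis
    unfolding christoffel_def by (simp add: frechet_derivative_cong)
qed

end

context contrast
begin

lemma left_exact_imp_smat:
  assumes "left_exact A W \<omega>"
  shows "smat A (induced_metric \<omega>) (induced_connection A \<omega>)"
proof -
  obtain S where S: "biform A 0 1 UNIV S" and eq: "biform_eq_on A 1 1 W \<omega> (dL A S)"
    using assms unfolding left_exact_def by blast
  have "christoffel \<omega> c m v z e = christoffel \<omega> c m v e z"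
    if v: "v \<in> tangent_space A m" and c: "c \<in> charts_at A m" for m v c z e
    unfolding christoffel_cong[OF biform_open[OF biform] diag_W eq v c] christoffel_dL[OF S v c]
    by (rule second_derivative_symmetric[OF smooth_fun_atD[OF biform_0_1_smooth_fun_at[OF S v] c]])
  then have "torsion_free A (induced_connection A \<omega>)"
    unfolding torsion_free_iff by blast
  then show ?thesis
    unfolding smat_def using pseudo_riemannian affine_connection_induced by blast
qed

end

section \<open>A potential with prescribed metric and connection\<close>

text \<open>
  The \<open>2\<close>-jet at \<open>y\<close> of a cut-off second order Taylor polynomial; as \<open>\<kappa>\<close> is stationary at \<open>y\<close>,
  the cut-off only enters through the factor \<open>\<kappa> y\<close>.
\<close>

lemma cutoff_quadratic_jet:
  fixes \<kappa> \<sigma> :: "'a::real_inner \<Rightarrow> real" and \<alpha> :: "'a \<Rightarrow> real" and \<eta> :: "'a \<Rightarrow> 'a \<Rightarrow> real"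
  assumes \<kappa>: "smooth_at \<kappa> y" and \<kappa>0: "\<And>v. frechet_derivative \<kappa> (at y) v = 0"
    and sym: "\<And>i j. i \<in> E \<Longrightarrow> j \<in> E \<Longrightarrow> \<eta> i j = \<eta> j i"
    and \<sigma>: "\<forall>\<^sub>F x in nhds y. \<kappa> x * ((\<Sum>i\<in>E. ((x - y) \<bullet> i) * \<alpha> i)
        + (\<Sum>i\<in>E. \<Sum>j\<in>E. ((x - y) \<bullet> i) * ((x - y) \<bullet> j) * \<eta> i j) / 2) = \<sigma> x"
  shows "frechet_derivative \<sigma> (at y) e = \<kappa> y * (\<Sum>i\<in>E. (e \<bullet> i) * \<alpha> i)"
    and "frechet_derivative (\<lambda>x. frechet_derivative \<sigma> (at x) e) (at y) z
      = \<kappa> y * (\<Sum>i\<in>E. \<Sum>j\<in>E. (e \<bullet> i) * (z \<bullet> j) * \<eta> i j)"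
proof -
  define q where "q = (\<lambda>x. (\<Sum>i\<in>E. ((x - y) \<bullet> i) * \<alpha> i)
        + (\<Sum>i\<in>E. \<Sum>j\<in>E. ((x - y) \<bullet> i) * ((x - y) \<bullet> j) * \<eta> i j) / 2)"
  \<comment> \<open>The derivative of \<open>q\<close>, simplified by the symmetry of
    \<open>\<eta>\<close>: the two contributions of the quadratic part coincide and cancel the
    factor 1 / 2.\<close>
  define q' where "q' = (\<lambda>x e. (\<Sum>i\<in>E. (e \<bullet> i) * \<alpha> i)
        + (\<Sum>i\<in>E. \<Sum>j\<in>E. (e \<bullet> i) * ((x - y) \<bullet> j) * \<eta> i j))"
  have q: "(q has_derivative q' x) (at x)" for x
  proof -
    have "(q has_derivative (\<lambda>e. (\<Sum>i\<in>E. (e \<bullet> i) * \<alpha> i)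
        + (\<Sum>i\<in>E. \<Sum>j\<in>E. (((x - y) \<bullet> i) * (e \<bullet> j) + (e \<bullet> i) * ((x - y) \<bullet> j)) * \<eta> i j) / 2)) (at x)"
      unfolding q_def
      by (rule derivative_eq_intros refl | simp)+
    moreover have "(\<Sum>i\<in>E. \<Sum>j\<in>E. (((x - y) \<bullet> i) * (e \<bullet> j) + (e \<bullet> i) * ((x - y) \<bullet> j)) * \<eta> i j)
        = 2 * (\<Sum>i\<in>E. \<Sum>j\<in>E. (e \<bullet> i) * ((x - y) \<bullet> j) * \<eta> i j)" for e
    proof -
      have "(\<Sum>i\<in>E. \<Sum>j\<in>E. ((x - y) \<bullet> i) * (e \<bullet> j) * \<eta> i j)
          = (\<Sum>j\<in>E. \<Sum>i\<in>E. ((x - y) \<bullet> i) * (e \<bullet> j) * \<eta> i j)"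
        by (rule sum.swap)
      also have "\<dots> = (\<Sum>i\<in>E. \<Sum>j\<in>E. (e \<bullet> i) * ((x - y) \<bullet> j) * \<eta> i j)"
        by (intro sum.cong refl) (simp add: sym mult_ac)
      finally show ?thesis
        by (simp add: ring_distribs sum.distrib)
    qed
    ultimately show ?thesis by (simp add: q'_def)
  qed
  have q'_deriv: "((\<lambda>x. q' x e) has_derivative (\<lambda>z. \<Sum>i\<in>E. \<Sum>j\<in>E. (e \<bullet> i) * (z \<bullet> j) * \<eta> i j)) (at y)" for e
    unfolding q'_def by (rule derivative_eq_intros refl | simp)+
  have qy: "q y = 0" by (simp add: q_def)
  have q'y: "q' y e = (\<Sum>i\<in>E. (e \<bullet> i) * \<alpha> i)" for e by (simp add: q'_def)
  have \<sigma>': "\<forall>\<^sub>F x in nhds y. \<kappa> x * q x = \<sigma> x"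
    using \<sigma> by (simp add: q_def)
  have d\<sigma>: "\<forall>\<^sub>F x in nhds y. \<kappa> x * q' x e + frechet_derivative \<kappa> (at x) e * q x
      = frechet_derivative \<sigma> (at x) e" for e
    using smooth_at_eventually[OF \<kappa>] eventually_eventually[THEN iffD2, OF \<sigma>']
  proof eventually_elim
    case (elim x)
    have "((\<lambda>x. \<kappa> x * q x) has_derivative
        (\<lambda>e. \<kappa> x * q' x e + frechet_derivative \<kappa> (at x) e * q x)) (at x)"
      by (rule has_derivative_mult[OF smooth_at_has_derivative[OF elim(1)] q])
    from frechet_derivative_eventually_eqI[OF this elim(2)] show ?case by simp
  qed
  show "frechet_derivative \<sigma> (at y) e = \<kappa> y * (\<Sum>i\<in>E. (e \<bullet> i) * \<alpha> i)"
    using eventually_nhds_x_imp_x[OF d\<sigma>[of e]] by (simp add: qy q'y)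
  \<comment> \<open>By \<open>\<kappa>0\<close> both cross terms with the first derivative of
    \<open>\<kappa>\<close> vanish at \<open>y\<close>, and the second derivative of
    \<open>\<kappa>\<close> is multiplied by \<open>q y\<close>, which is 0.\<close>
  have "((\<lambda>x. \<kappa> x * q' x e + frechet_derivative \<kappa> (at x) e * q x) has_derivative
      (\<lambda>z. (\<kappa> y * (\<Sum>i\<in>E. \<Sum>j\<in>E. (e \<bullet> i) * (z \<bullet> j) * \<eta> i j) + frechet_derivative \<kappa> (at y) z * q' y e)
        + (frechet_derivative \<kappa> (at y) e * q' y z
          + frechet_derivative (\<lambda>x. frechet_derivative \<kappa> (at x) e) (at y) z * q y))) (at y)"
    by (intro has_derivative_add has_derivative_mult smooth_at_has_derivative \<kappa> q q'_deriv
        smooth_at_deriv_const)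
  from frechet_derivative_eventually_eqI[OF this d\<sigma>[of e]]
  show "frechet_derivative (\<lambda>x. frechet_derivative \<sigma> (at x) e) (at y) z
      = \<kappa> y * (\<Sum>i\<in>E. \<Sum>j\<in>E. (e \<bullet> i) * (z \<bullet> j) * \<eta> i j)"
    by (simp add: \<kappa>0 qy)
qed

context manifold
begin

section \<open>Locally finite bump functions\<close>

lemma smooth_fun_at_filterlim: 
  assumes "smooth_fun_at f p" shows "filterlim f (nhds (f p)) (nhds p)"
proof -
  obtain c where c: "c \<in> charts_at A p" using ex_chart .
  have "isCont (\<lambda>x. f (chart_inv c x)) (chart_map c p)"
    by (rule smooth_at_isCont[OF smooth_fun_atD[OF assms c]])
  moreover have "isCont g x \<Longrightarrow> filterlim g (nhds (g x)) (nhds x)" for g :: "'e \<Rightarrow> real" and x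
    by (simp add: isCont_def tendsto_at_iff_tendsto_nhds)
  ultimately have "filterlim (\<lambda>x. f (chart_inv c x)) (nhds (f p)) (nhds (chart_map c p))"
    using c unfolding charts_at_iff by (metis (no_types, lifting) chart_inv_chart_map)
  from filterlim_compose[OF this chart_map_tendsto[OF c]]
  have *: "filterlim (\<lambda>q. f (chart_inv c (chart_map c q))) (nhds (f p)) (nhds p)" .
  have "\<forall>\<^sub>F q in nhds p. f (chart_inv c (chart_map c q)) = f q"
    using eventually_charts_at[OF c] by eventually_elim (simp add: charts_at_iff)
  from filterlim_cong[OF refl refl this] * show ?thesis by simp
qed

lemma eventually_greater: "smooth_fun_at f p \<Longrightarrow> a < f p \<Longrightarrow> \<forall>\<^sub>F q in nhds p. a < f q"
  using order_tendstoD(1)[OF smooth_fun_at_filterlim] .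

definition bump_on :: "('m, 'e) chart \<Rightarrow> ('m \<Rightarrow> real) \<Rightarrow> bool" where
  "bump_on c f \<longleftrightarrow> c \<in> A \<and> (\<forall>q. smooth_fun_at f q) \<and> (\<forall>q. 0 \<le> f q) \<and>
     (\<exists>K. closed K \<and> K \<subseteq> chart_dom c \<and> (\<forall>q. f q \<noteq> 0 \<longrightarrow> q \<in> K))"

text \<open>
  A countable family of bumps whose positivity sets cover \<open>M\<close> becomes locally finite by damping the
  \<open>n\<close>-th one where an earlier one exceeds \<open>1 / (n + 1)\<close>.
\<close>

lemma locally_finite_bumps:
  obtains cs :: "nat \<Rightarrow> ('m, 'e) chart" and bs where "\<forall>n. bump_on (cs n) (bs n)" "\<forall>p. \<exists>n. 0 < bs n p"
    "\<forall>p. \<exists>N. \<forall>\<^sub>F q in nhds p. \<forall>n\<ge>N. bs n q = 0"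
proof -
  have "\<exists>c f. bump_on c f \<and> 0 < f p" for p
  proof -
    obtain c f K where *: "c \<in> charts_at A p" "\<And>q. smooth_fun_at f q" "\<And>q. 0 \<le> f q" "0 < f p"
      "closed K" "K \<subseteq> chart_dom c" "\<And>q. f q \<noteq> 0 \<Longrightarrow> q \<in> K"
      using bump_function[of p] by blast
    have "bump_on c f"
      unfolding bump_on_def using * by (intro conjI allI exI[of _ K]) (simp_all add: charts_at_iff)
    with *(4) show ?thesis by blast
  qed
  then obtain c f where cf: "\<And>p. bump_on (c p) (f p)" "\<And>p. 0 < f p p"
    by metis
  have sm: "smooth_fun_at (f p) q" and nn: "0 \<le> f p q" for p q
    using cf(1)[of p] by (simp_all add: bump_on_def)
  define U where "U = (\<lambda>p. {q. 0 < f p q})"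
  have "open (U p)" for p
    unfolding open_subopen[of "U p"]
  proof
    fix q assume "q \<in> U p"
    then have "\<forall>\<^sub>F q in nhds q. 0 < f p q"
      using eventually_greater[OF sm] by (simp add: U_def)
    then show "\<exists>T. open T \<and> q \<in> T \<and> T \<subseteq> U p"
      unfolding eventually_nhds U_def by blast
  qed
  then have "open S" if "S \<in> range U" for S
    using that by (elim rangeE) simp
  \<comment> \<open>Second countability enters here: countably many positivity sets already cover
    the manifold.\<close>
  then obtain F where F: "F \<subseteq> range U" "countable F" "\<Union>F = \<Union>(range U)"
    by (rule Lindelof)
  have cover: "q \<in> \<Union>F" for q
    unfolding F(3) using cf(2)[of q] by (auto simp: U_def)
  then have "F \<noteq> {}" by blast
  \<comment> \<open>If \<open>F\<close> is finite, the enumeration repeats members; this is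
    harmless, since repeated bumps are damped like all others.\<close>
  have "\<exists>p. U p = from_nat_into F n" for n
    using from_nat_into[OF \<open>F \<noteq> {}\<close>, of n] F(1) by blast
  then obtain P where P: "\<And>n. U (P n) = from_nat_into F n"
    by metis
  define g where "g = (\<lambda>n. f (P n))"
  define b where "b = (\<lambda>n q. g n q * (\<Prod>i<n. flat_exp 0 (1 / (real n + 1) + (- 1) * g i q)))"
  have g: "\<exists>n. 0 < g n q" for q
  proof -
    obtain V where V: "V \<in> F" "q \<in> V" using cover by blast
    then obtain n where "V = from_nat_into F n"
      using F(2) by (metis from_nat_into_surj)
    then show ?thesis using V(2) P[of n] by (auto simp: U_def g_def)
  qed
  show ?thesis
  proof (rule that[of "\<lambda>n. c (P n)" b]; intro allI)
    show "bump_on (c (P n)) (b n)" for n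
    proof -
      obtain K where K: "closed K" "K \<subseteq> chart_dom (c (P n))" "\<And>q. g n q \<noteq> 0 \<Longrightarrow> q \<in> K"
        using cf(1)[of "P n"] unfolding bump_on_def g_def by blast
      have "smooth_fun_at (b n) q" for q
        unfolding b_def g_def by (intro smooth_fun_at_mult smooth_fun_at_prod smooth_fun_at_flat_exp_compose smooth_fun_at_add sm smooth_fun_at_const)
      moreover have "0 \<le> b n q" for q
        unfolding b_def using nn by (intro mult_nonneg_nonneg prod_nonneg) (simp_all add: g_def)
      moreover have "q \<in> K" if "b n q \<noteq> 0" for q
        using that K(3)[of q] by (auto simp: b_def)
      ultimately show ?thesis
        using cf(1)[of "P n"] K(1,2) unfolding bump_on_def by blast
    qed
    show "\<exists>n. 0 < b n p" for p
    proof -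
      \<comment> \<open>At the first index whose bump is positive at \<open>p\<close> all earlier
        bumps vanish, so every damping factor is positive.\<close>
      define n where "n = (LEAST n. 0 < g n p)"
      have "0 < g n p"
        unfolding n_def by (rule LeastI_ex[OF g])
      moreover have "g i p = 0" if "i < n" for i
        using not_less_Least[of i "\<lambda>n. 0 < g n p"] that nn[of "P i" p] by (simp add: n_def g_def)
      ultimately have "0 < b n p"
        unfolding b_def by (intro mult_pos_pos prod_pos) simp_all
      then show ?thesis by blast
    qed
    show "\<exists>N. \<forall>\<^sub>F q in nhds p. \<forall>n\<ge>N. b n q = 0" for p
    proof -
      obtain i where i: "0 < g i p" using g by blast
      \<comment> \<open>Near \<open>p\<close> the bump \<open>g i\<close> exceeds half its value at
        \<open>p\<close>, hence 1 / k. From \<open>max k (Suc i)\<close> on, the threshold 1 / (n +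
        1) is no larger than 1 / k and \<open>i\<close> is among the damping indices, so the product
        is 0.\<close>
      obtain k :: nat where k: "0 < k" "inverse (real k) < g i p / 2"
        using ex_inverse_of_nat_less[of "g i p / 2"] i by auto
      have "smooth_fun_at (g i) p" unfolding g_def by (rule sm)
      moreover have "g i p / 2 < g i p" using i by simp
      ultimately have "\<forall>\<^sub>F q in nhds p. g i p / 2 < g i q"
        by (rule eventually_greater)
      then have "\<forall>\<^sub>F q in nhds p. \<forall>n\<ge>max k (Suc i). b n q = 0"
      proof eventually_elim
        case (elim q)
        show ?case
        proof (intro allI impI)
          fix n assume n: "max k (Suc i) \<le> n"
          have "1 / (real n + 1) \<le> inverse (real k)"
            using n k(1) by (simp add: divide_simps)
          then have "flat_exp 0 (1 / (real n + 1) + (- 1) * g i q) = 0"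
            using k(2) elim by simp
          moreover have "i \<in> {..<n}" using n by simp
          ultimately have "(\<Prod>i<n. flat_exp 0 (1 / (real n + 1) + (- 1) * g i q)) = 0"
            by (intro prod_zero) auto
          then show "b n q = 0" by (simp add: b_def)
        qed
      qed
      then show ?thesis by blast
    qed
  qed
qed

text \<open>The tensors are compared on tangent vectors only; coordinate vectors are tangent over
  the domain of their chart, whose image is open, and there smoothness carries over.\<close>

lemma pseudo_riemannian_cong:
  assumes g: "pseudo_riemannian A g"
    and eq: "\<And>m u v. u \<in> tangent_space A m \<Longrightarrow> v \<in> tangent_space A m \<Longrightarrow> g m u v = h m u v"
  shows "pseudo_riemannian A h"
proof -
  have 1: "h p u v = h p v u \<and>
        (\<forall>w\<in>tangent_space A p. h p (tv_add u w) v = h p u v + h p w v) \<and>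
        (\<forall>a. h p (tv_scale a u) v = a * h p u v)"
    if "u \<in> tangent_space A p" "v \<in> tangent_space A p" for p u v
  proof -
    have G: "g p u v = g p v u" "\<And>w. w \<in> tangent_space A p \<Longrightarrow> g p (tv_add u w) v = g p u v + g p w v"
      "\<And>a. g p (tv_scale a u) v = a * g p u v"
      using g that unfolding pseudo_riemannian_def by blast+
    show ?thesis
    proof (intro conjI ballI allI)
      show "h p u v = h p v u"
        using G(1) eq[OF that] eq[OF that(2,1)] by simp
      show "h p (tv_add u w) v = h p u v + h p w v" if w: "w \<in> tangent_space A p" for w
        using G(2)[OF w] eq[OF tangent_space_add[OF \<open>u \<in> _\<close> w] \<open>v \<in> _\<close>] eq[OF \<open>u \<in> _\<close> \<open>v \<in> _\<close>]
          eq[OF w \<open>v \<in> _\<close>] by simp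
      show "h p (tv_scale a u) v = a * h p u v" for a
        using G(3)[of a] eq[OF tangent_space_scale[OF that(1)] that(2)] eq[OF that] by simp
    qed
  qed
  have 2: "u = tv_zero" if "u \<in> tangent_space A p" "\<forall>v\<in>tangent_space A p. h p u v = 0" for p u
  proof -
    have "\<forall>v\<in>tangent_space A p. g p u v = 0"
      using that by (simp add: eq)
    then show ?thesis
      using g that(1) unfolding pseudo_riemannian_def by blast
  qed
  have 3: "smooth_on (chart_map c ` chart_dom c)
        (\<lambda>x. h (chart_inv c x) (coord_vec A c (chart_inv c x) e) (coord_vec A c (chart_inv c x) f))"
    if c: "c \<in> A" for c e f
  proof (rule smooth_on_cong[OF open_chart_image[OF c]])
    show "smooth_on (chart_map c ` chart_dom c)
        (\<lambda>x. g (chart_inv c x) (coord_vec A c (chart_inv c x) e) (coord_vec A c (chart_inv c x) f))"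
      using g c unfolding pseudo_riemannian_def by blast
    fix x assume "x \<in> chart_map c ` chart_dom c"
    then show "g (chart_inv c x) (coord_vec A c (chart_inv c x) e) (coord_vec A c (chart_inv c x) f)
        = h (chart_inv c x) (coord_vec A c (chart_inv c x) e) (coord_vec A c (chart_inv c x) f)"
      using c by (intro eq coord_vec_in_tangent_space) (simp_all add: charts_at_iff)
  qed
  show ?thesis
    unfolding pseudo_riemannian_def using 1 2 3 by blast
qed

lemma smooth_fun_at_chart_coord: "c \<in> charts_at A p \<Longrightarrow> smooth_fun_at (\<lambda>x. chart_map c x \<bullet> i) p"
proof -
  assume c: "c \<in> charts_at A p"
  have "\<forall>\<^sub>F x in nhds (chart_map c p). x \<bullet> i = chart_map c (chart_inv c x) \<bullet> i"
    using eventually_chart_image[OF c] by eventually_elim simp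
  moreover have "smooth_at (\<lambda>x. x \<bullet> i) (chart_map c p)"
    by (intro smooth_at_inner smooth_at_ident smooth_at_const)
  ultimately have "smooth_at (\<lambda>x. chart_map c (chart_inv c x) \<bullet> i) (chart_map c p)"
    by (rule smooth_at_cong)
  then show ?thesis by (rule smooth_fun_atI[OF c])
qed

end

context contrast
begin

text \<open>
  In the chart \<open>c\<close> the second factor is the second order Taylor polynomial prescribed by the metric
  and the Christoffel symbols at \<open>y\<close>.  The factor \<open>2 * b y - b x\<close> makes the cut-off, as a function
  of \<open>x\<close>, stationary at \<open>x = y\<close>.
\<close>

definition taylor_potential :: "('m, 'e) chart \<Rightarrow> 'm \<Rightarrow> 'm \<Rightarrow> ('m, 'e) tv \<Rightarrow> real" where
  "taylor_potential c x y v =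
     (\<Sum>i\<in>E. ((chart_map c x - chart_map c y) \<bullet> i) * \<omega> y y [coord_vec A c y i] [v])
   + (\<Sum>i\<in>E. \<Sum>j\<in>E. ((chart_map c x - chart_map c y) \<bullet> i) * ((chart_map c x - chart_map c y) \<bullet> j) *
        conn_form \<omega> (\<lambda>x. coord_vec A c x j) (\<lambda>x. coord_vec A c x i) y v) / 2"

definition local_potential :: "('m, 'e) chart \<Rightarrow> ('m \<Rightarrow> real) \<Rightarrow> ('m, 'e) biform" where
  "local_potential c b x y us vs = (if x \<in> chart_dom c \<and> y \<in> chart_dom c
     then b x * b y * (2 * b y - b x) * taylor_potential c x y (hd vs) else 0)"

lemma taylor_potential_add:
  assumes "c \<in> charts_at A y" "v \<in> tangent_space A y" "v' \<in> tangent_space A y"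
  shows "taylor_potential c x y (tv_add v v') = taylor_potential c x y v + taylor_potential c x y v'"
  unfolding taylor_potential_def using assms
  by (simp add: add_right diag_W conn_form_add_vector smooth_field_at_coord coord_vec_in_tangent_space
      ring_distribs sum.distrib add_divide_distrib)

lemma taylor_potential_scale:
  assumes "c \<in> charts_at A y" "v \<in> tangent_space A y"
  shows "taylor_potential c x y (tv_scale a v) = a * taylor_potential c x y v"
  unfolding taylor_potential_def using assms
  by (simp add: scale_right diag_W conn_form_scale_vector smooth_field_at_coord coord_vec_in_tangent_space
      distrib_left sum_distrib_left mult_ac)

text \<open>Both \<open>b x\<close> and \<open>b y\<close> are factors, so the potential vanishes
  off the closed set K x K inside the product of the chart domains. A point outside that product has
  a neighbourhood missing K x K, hence extension by 0 is smooth.\<close>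

lemma biform_local_potential:
  assumes b: "bump_on c b"
  shows "biform A 0 1 UNIV (local_potential c b)"
  unfolding biform_0_1_iff
proof (intro conjI allI impI ballI)
  have cA: "c \<in> A" and bsm: "\<And>q. smooth_fun_at b q" using b by (simp_all add: bump_on_def)
  obtain K where K: "closed K" "K \<subseteq> chart_dom c" "\<And>q. b q \<noteq> 0 \<Longrightarrow> q \<in> K"
    using b unfolding bump_on_def by blast
  fix c' d f p q assume "c' \<in> charts_at A p \<and> d \<in> charts_at A q \<and> (p, q) \<in> UNIV"
  then have d: "d \<in> charts_at A q" by blast
  show "smooth_fun2_at (\<lambda>x y. local_potential c b x y [] [coord_vec A d y f]) p q"
  proof (cases "p \<in> chart_dom c \<and> q \<in> chart_dom c")
    case True
    then have cp: "c \<in> charts_at A p" and cq: "c \<in> charts_at A q"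
      using cA by (simp_all add: charts_at_iff)
    note diff = smooth_fun2_at_diff[OF smooth_fun2_at_fst[OF smooth_fun_at_chart_coord[OF cp]] smooth_fun2_at_snd[OF smooth_fun_at_chart_coord[OF cq]]]
    have m: "smooth_fun_at (\<lambda>y. \<omega> y y [coord_vec A c y i] [coord_vec A d y f]) q" for i
      by (rule smooth_fun2_at_diag[OF biform_smooth_fun2_at[OF biform diag_W smooth_field_at_coord[OF cq] smooth_field_at_coord[OF d]]])
    have n: "smooth_fun_at (\<lambda>y. conn_form \<omega> (\<lambda>x. coord_vec A c x j) (\<lambda>x. coord_vec A c x i) y (coord_vec A d y f)) q" for i j
      unfolding conn_form_def
      by (rule smooth_fun2_at_diag[OF smooth_fun2_at_tangent_deriv[OF biform_smooth_fun2_at[OF biform diag_W smooth_field_at_coord[OF cq] smooth_field_at_coord[OF d]] smooth_field_at_coord[OF cq]]])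
    have T: "smooth_fun2_at (\<lambda>x y. taylor_potential c x y (coord_vec A d y f)) p q"
      unfolding taylor_potential_def inner_diff_left divide_inverse
      by (intro smooth_fun2_at_add smooth_fun2_at_sum smooth_fun2_at_mult diff smooth_fun2_at_snd[OF m] smooth_fun2_at_snd[OF n] smooth_fun2_at_snd[OF smooth_fun_at_const])
    have "smooth_fun2_at (\<lambda>x y. b x * b y * (2 * b y - b x) * taylor_potential c x y (coord_vec A d y f)) p q"
      by (intro smooth_fun2_at_mult smooth_fun2_at_diff T smooth_fun2_at_fst[OF bsm] smooth_fun2_at_snd[OF bsm] smooth_fun2_at_snd[OF smooth_fun_at_const])
    then show ?thesis
    proof (rule smooth_fun2_at_cong[rotated])
      show "\<forall>\<^sub>F z in nhds (p, q). b (fst z) * b (snd z) * (2 * b (snd z) - b (fst z)) *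
          taylor_potential c (fst z) (snd z) (coord_vec A d (snd z) f)
        = local_potential c b (fst z) (snd z) [] [coord_vec A d (snd z) f]"
        using eventually_nhds_fst[OF eventually_charts_at[OF cp]] eventually_nhds_snd[OF eventually_charts_at[OF cq]]
        by eventually_elim (simp add: local_potential_def charts_at_iff)
    qed
  next
    case False
    then have "(p, q) \<in> - (K \<times> K)" using K(2) by auto
    moreover have "open (- (K \<times> K))" using K(1) by (simp add: open_Compl closed_Times)
    ultimately have "\<forall>\<^sub>F z in nhds (p, q). z \<in> - (K \<times> K)"
      by (intro eventually_nhds_in_open)
    then have "\<forall>\<^sub>F z in nhds (p, q). 0 = local_potential c b (fst z) (snd z) [] [coord_vec A d (snd z) f]"
    proof eventually_elim
      case (elim z)
      then have "fst z \<notin> K \<or> snd z \<notin> K" by (cases z) auto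
      then have "b (fst z) = 0 \<or> b (snd z) = 0" using K(3) by blast
      then show ?case by (auto simp: local_potential_def)
    qed
    then show ?thesis
      by (rule smooth_fun2_at_cong) (rule smooth_fun2_at_fst[OF smooth_fun_at_const])
  qed
next
  fix m n v a assume v: "v \<in> tangent_space A n"
  then show "local_potential c b m n [] [tv_scale a v] = a * local_potential c b m n [] [v]"
    using b by (simp add: local_potential_def taylor_potential_scale charts_at_iff bump_on_def)
  fix v' assume "v' \<in> tangent_space A n"
  with v show "local_potential c b m n [] [tv_add v v'] = local_potential c b m n [] [v] + local_potential c b m n [] [v']"
    using b by (simp add: local_potential_def taylor_potential_add charts_at_iff bump_on_def distrib_left)
qed simp

lemma local_potential_diag: "local_potential c b m m us vs = 0"
  by (simp add: local_potential_def taylor_potential_def)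

lemma local_potential_zero: "b y = 0 \<Longrightarrow> local_potential c b x y us vs = 0"
  by (simp add: local_potential_def)

lemma local_potential_jet:
  assumes b: "bump_on c b" and c: "c \<in> charts_at A m" and v: "v \<in> tangent_space A m"
    and tf: "torsion_free A (induced_connection A \<omega>)"
  defines "\<sigma> \<equiv> \<lambda>x. local_potential c b (chart_inv c x) m [] [v]"
  shows "frechet_derivative \<sigma> (at (chart_map c m)) e = b m ^ 3 * \<omega> m m [coord_vec A c m e] [v]"
    and "frechet_derivative (\<lambda>x. frechet_derivative \<sigma> (at x) e) (at (chart_map c m)) z
      = b m ^ 3 * christoffel \<omega> c m v z e"
proof -
  let ?y = "chart_map c m"
  define \<beta> where "\<beta> = (\<lambda>x. b (chart_inv c x))"
  define \<kappa> where "\<kappa> = (\<lambda>x. \<beta> x * b m * (2 * b m - \<beta> x))"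
  have \<beta>: "smooth_at \<beta> ?y"
    unfolding \<beta>_def using b by (intro smooth_fun_atD[OF _ c]) (simp add: bump_on_def)
  have \<beta>y: "\<beta> ?y = b m" using c by (simp add: \<beta>_def charts_at_iff)
  have \<kappa>: "smooth_at \<kappa> ?y"
    unfolding \<kappa>_def by (intro smooth_at_mult smooth_at_diff smooth_at_const \<beta>)
  \<comment> \<open>The first and the last factor of \<open>\<kappa>\<close> contribute (b m)^2
    times the derivative of \<open>\<beta>\<close>, with opposite signs.\<close>
  have "(\<kappa> has_derivative (\<lambda>v. 0)) (at ?y)"
    unfolding \<kappa>_def
    by (rule derivative_eq_intros smooth_at_has_derivative[OF \<beta>] refl)+ (simp add: \<beta>y fun_eq_iff algebra_simps)
  then have \<kappa>0: "frechet_derivative \<kappa> (at ?y) v = 0" for v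
    by (simp add: frechet_derivative_eqI)
  have \<kappa>y: "\<kappa> ?y = b m ^ 3"
    by (simp add: \<kappa>_def \<beta>y power3_eq_cube)
  have chr: "conn_form \<omega> (\<lambda>x. coord_vec A c x j) (\<lambda>x. coord_vec A c x i) m v = christoffel \<omega> c m v j i" for i j
    by (rule conn_form_coord_fields[OF biform diag_W v c])
  \<comment> \<open>This is where torsion-freeness enters: the second derivatives of a potential are
    symmetric, so only symmetric Christoffel symbols can be prescribed.\<close>
  have sym: "christoffel \<omega> c m v i j = christoffel \<omega> c m v j i" for i j
    using tf v c unfolding torsion_free_iff by blast
  have "\<forall>\<^sub>F x in nhds ?y. \<kappa> x * ((\<Sum>i\<in>E. ((x - ?y) \<bullet> i) * \<omega> m m [coord_vec A c m i] [v])
      + (\<Sum>i\<in>E. \<Sum>j\<in>E. ((x - ?y) \<bullet> i) * ((x - ?y) \<bullet> j) * christoffel \<omega> c m v j i) / 2) = \<sigma> x"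
    using eventually_chart_image[OF c]
  proof eventually_elim
    case (elim x)
    then show ?case
      using c by (simp add: \<sigma>_def local_potential_def taylor_potential_def chr \<kappa>_def \<beta>_def charts_at_iff)
  qed
  note jet = cutoff_quadratic_jet[OF \<kappa> \<kappa>0 sym this]
  have "frechet_derivative \<sigma> (at ?y) e = b m ^ 3 * (\<Sum>i\<in>E. (e \<bullet> i) * \<omega> m m [coord_vec A c m i] [v])"
    unfolding jet(1) \<kappa>y ..
  also have "(\<Sum>i\<in>E. (e \<bullet> i) * \<omega> m m [coord_vec A c m i] [v]) = \<omega> m m [coord_vec A c m e] [v]"
    using biform_expand_left[OF biform diag_W coord_vec_in_tangent_space[OF c] v c, of e] by (simp add: c)
  finally show "frechet_derivative \<sigma> (at ?y) e = b m ^ 3 * \<omega> m m [coord_vec A c m e] [v]" .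
  have "(\<Sum>i\<in>E. \<Sum>j\<in>E. (e \<bullet> i) * (z \<bullet> j) * christoffel \<omega> c m v j i)
      = (\<Sum>i\<in>E. (e \<bullet> i) * (\<Sum>j\<in>E. (z \<bullet> j) * christoffel \<omega> c m v j i))"
    by (simp add: sum_distrib_left mult_ac)
  also have "\<dots> = (\<Sum>i\<in>E. (e \<bullet> i) * christoffel \<omega> c m v z i)"
    using frame_linear[OF frame_E linear_christoffel[OF biform diag_W v c], of z] by simp
  also have "\<dots> = christoffel \<omega> c m v z e"
    by (rule christoffel_expand[OF biform diag_W v c, symmetric])
  finally show "frechet_derivative (\<lambda>x. frechet_derivative \<sigma> (at x) e) (at ?y) z
      = b m ^ 3 * christoffel \<omega> c m v z e"
    unfolding jet(2) \<kappa>y by simp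
qed

lemma dL_local_potential:
  assumes b: "bump_on c b" and u: "u \<in> tangent_space A m" and v: "v \<in> tangent_space A m"
    and tf: "torsion_free A (induced_connection A \<omega>)"
  shows "dL A (local_potential c b) m m [u] [v] = b m ^ 3 * \<omega> m m [u] [v]"
proof (cases "b m = 0")
  \<comment> \<open>Here \<open>m\<close> may lie outside the chart, so that no coordinates are
    available; but the potential then vanishes for every left point.\<close>
  case True
  then show ?thesis
    by (simp add: dL_eq_tangent_deriv[OF biform_local_potential[OF b] u v] local_potential_zero)
next
  case False
  then have c: "c \<in> charts_at A m"
    using b unfolding bump_on_def charts_at_iff by blast
  show ?thesis
    unfolding dL_eq_tangent_deriv[OF biform_local_potential[OF b] u v]
      tangent_deriv_eq[OF u biform_0_1_smooth_fun_at[OF biform_local_potential[OF b] v] c] local_potential_jet[OF b c v tf]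
    by (simp add: coord_vec_coord[OF c u])
qed

text \<open>In the coordinate formula both terms scale by \<open>b m ^ 3\<close>, one by the first
  and one by the second order jet. The outcome no longer mentions coordinates, which makes
  contributions from different charts comparable.\<close>

lemma conn_form_local_potential:
  assumes b: "bump_on c b" and X: "smooth_field_at X m" and Z: "Z m \<in> tangent_space A m" and v: "v \<in> tangent_space A m"
    and tf: "torsion_free A (induced_connection A \<omega>)"
  shows "conn_form (dL A (local_potential c b)) Z X m v = b m ^ 3 * conn_form \<omega> Z X m v"
proof (cases "b m = 0")
  case True
  have "\<forall>\<^sub>F x in nhds m. dL A (local_potential c b) x m [X x] [v] = 0"
    using smooth_field_at_eventually[OF X]
    by eventually_elim (simp add: dL_eq_tangent_deriv[OF biform_local_potential[OF b] _ v] local_potential_zero True)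
  from tangent_deriv_cong[OF this] show ?thesis
    by (simp add: conn_form_def True)
next
  case False
  then have c: "c \<in> charts_at A m"
    using b unfolding bump_on_def charts_at_iff by blast
  note L = biform_local_potential[OF b]
  show ?thesis
    unfolding conn_form_coord[where X = X and Z = Z, OF biform_dL[OF L] UNIV_I X Z v c]
      conn_form_coord[where X = X and Z = Z, OF biform diag_W X Z v c]
      christoffel_dL[OF L v c] local_potential_jet(2)[OF b c v tf]
    by (simp add: dL_local_potential[OF b coord_vec_in_tangent_space[OF c] v tf] distrib_left)
qed

section \<open>Gluing the local potentials\<close>

text \<open>Phrased with \<open>conn_form\<close> rather than with the connection, because the
  former is linear in the bi-form and can be added up over the local potentials.\<close>

lemma torsion_free_imp_potential:
  assumes tf: "torsion_free A (induced_connection A \<omega>)"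
  obtains S where "biform A 0 1 UNIV S"
    "\<forall>m vs. S m m [] vs = 0"
    "\<forall>m. \<forall>u\<in>tangent_space A m. \<forall>v\<in>tangent_space A m. dL A S m m [u] [v] = \<omega> m m [u] [v]"
    "\<forall>m Z X v. smooth_field_at X m \<longrightarrow> Z m \<in> tangent_space A m \<longrightarrow> v \<in> tangent_space A m \<longrightarrow>
      conn_form (dL A S) Z X m v = conn_form \<omega> Z X m v"
proof -
  obtain cs :: "nat \<Rightarrow> ('m, 'e) chart" and bs where *: "\<forall>n. bump_on (cs n) (bs n)" "\<forall>p. \<exists>n. 0 < bs n p"
    "\<forall>p. \<exists>N. \<forall>\<^sub>F q in nhds p. \<forall>n\<ge>N. bs n q = 0"
    using locally_finite_bumps .
  note bump = *(1)[THEN spec] and pos = *(2)[THEN spec] and fin = *(3)[THEN spec]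
  define T where "T = (\<lambda>n. local_potential (cs n) (bs n))"
  \<comment> \<open>The index set depends on the right point only, since a local potential vanishes
    for all left points once its bump is 0 at the right one. It is finite, and near a given right
    point a fixed initial segment can replace it.\<close>
  define J where "J = (\<lambda>y. {n. bs n y \<noteq> 0})"
  define F where "F = (\<lambda>y. \<Sum>n\<in>J y. bs n y ^ 3)"
  define S where "S = (\<lambda>x y us vs. (\<Sum>n\<in>J y. T n x y us vs) / F y)"
  have T: "biform A 0 1 UNIV (T n)" for n
    unfolding T_def by (rule biform_local_potential[OF bump])
  have bsm: "smooth_fun_at (bs n) q" and bnn: "0 \<le> bs n q" for n q
    using bump[of n] by (simp_all add: bump_on_def)
  have F_eq: "F y = (\<Sum>n<N. bs n y ^ 3)" and S_eq: "S x y us vs = (\<Sum>n<N. T n x y us vs) / F y"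
    if "\<forall>n\<ge>N. bs n y = 0" for N x y us vs
  proof -
    have J: "J y \<subseteq> {..<N}" using that by (auto simp: J_def not_le[symmetric])
    show "F y = (\<Sum>n<N. bs n y ^ 3)"
      unfolding F_def by (rule sum.mono_neutral_left) (use J in \<open>auto simp: J_def\<close>)
    have "(\<Sum>n\<in>J y. T n x y us vs) = (\<Sum>n<N. T n x y us vs)"
      by (rule sum.mono_neutral_left) (use J in \<open>auto simp: J_def T_def local_potential_zero\<close>)
    then show "S x y us vs = (\<Sum>n<N. T n x y us vs) / F y"
      by (simp add: S_def)
  qed
  have bound: "\<exists>N. \<forall>n\<ge>N. bs n y = 0" for y
    using fin[of y] eventually_nhds_x_imp_x by blast
  have Fpos: "0 < F y" for y
  proof -
    obtain N where N: "\<forall>n\<ge>N. bs n y = 0" using bound by blast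
    obtain k where k: "0 < bs k y" using pos by blast
    then have "k < N" using N by (metis less_irrefl not_le)
    then have "bs k y ^ 3 \<le> F y"
      unfolding F_eq[OF N] using bnn by (intro member_le_sum) auto
    then show ?thesis using k by (smt (verit) zero_less_power)
  qed
  have S: "biform A 0 1 UNIV S"
    unfolding biform_0_1_iff
  proof (intro conjI allI impI ballI)
    fix c d f p q assume "c \<in> charts_at A p \<and> d \<in> charts_at A q \<and> (p, q) \<in> UNIV"
    then have d: "d \<in> charts_at A q" by blast
    obtain N where N: "\<forall>\<^sub>F y in nhds q. \<forall>n\<ge>N. bs n y = 0" using fin by blast
    have "smooth_fun_at (\<lambda>y. \<Sum>n<N. bs n y * (bs n y * bs n y)) q"
      by (intro smooth_fun_at_sum smooth_fun_at_mult bsm)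
    moreover have "\<forall>\<^sub>F y in nhds q. (\<Sum>n<N. bs n y * (bs n y * bs n y)) = F y"
      using N by eventually_elim (simp add: F_eq power3_eq_cube mult.assoc)
    ultimately have "smooth_fun_at F q" by (rule smooth_fun_at_cong[rotated])
    then have F: "smooth_fun_at (\<lambda>y. 1 / F y) q"
      using Fpos[of q] by (intro smooth_fun_at_divide smooth_fun_at_const) simp_all
    have "smooth_fun2_at (\<lambda>x y. (\<Sum>n<N. T n x y [] [coord_vec A d y f]) * (1 / F y)) p q"
      by (intro smooth_fun2_at_mult smooth_fun2_at_sum smooth_fun2_at_snd[OF F] biform_0_1_smooth_fun2_at[OF T] smooth_field_at_coord d)
    moreover have "\<forall>\<^sub>F z in nhds (p, q). (\<Sum>n<N. T n (fst z) (snd z) [] [coord_vec A d (snd z) f]) * (1 / F (snd z))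
        = S (fst z) (snd z) [] [coord_vec A d (snd z) f]"
      using eventually_nhds_snd[OF N] by eventually_elim (simp add: S_eq)
    ultimately show "smooth_fun2_at (\<lambda>x y. S x y [] [coord_vec A d y f]) p q"
      by (rule smooth_fun2_at_cong[rotated])
  qed (simp_all add: S_def biform_0_1_add[OF T] biform_0_1_scale[OF T] sum.distrib add_divide_distrib
      sum_distrib_left[symmetric])
  \<comment> \<open>\<open>N\<close> is tied to the right point \<open>m\<close>, so the same finite
    sum represents \<open>S\<close> for all left points, and \<open>F m\<close> is a constant for
    the derivative.\<close>
  have dLS: "dL A S x m [u] [v] = (\<Sum>n<N. 1 / F m * dL A (T n) x m [u] [v])"
    if "\<forall>n\<ge>N. bs n m = 0" "u \<in> tangent_space A x" "v \<in> tangent_space A m" for N x m u v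
  proof -
    have "dL A S x m [u] [v] = tangent_deriv x u (\<lambda>x. \<Sum>n<N. 1 / F m * T n x m [] [v])"
      by (simp add: dL_eq_tangent_deriv[OF S that(2,3)] S_eq[OF that(1)] sum_divide_distrib)
    also have "\<dots> = (\<Sum>n<N. tangent_deriv x u (\<lambda>x. 1 / F m * T n x m [] [v]))"
      by (intro tangent_deriv_sum that(2) smooth_fun_at_mult smooth_fun_at_const biform_0_1_smooth_fun_at[OF T that(3)])
    also have "\<dots> = (\<Sum>n<N. 1 / F m * tangent_deriv x u (\<lambda>x. T n x m [] [v]))"
      by (simp only: tangent_deriv_cmult[OF that(2) biform_0_1_smooth_fun_at[OF T that(3)]])
    finally show ?thesis by (simp add: dL_eq_tangent_deriv[OF T that(2,3)])
  qed
  \<comment> \<open>The cubes \<open>bs n m ^ 3\<close> divided by \<open>F m\<close> are weights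
    with sum 1; this is what dictates the divisor \<open>F\<close>.\<close>
  have weights: "(\<Sum>n<N. 1 / F m * (bs n m ^ 3 * a)) = a" if "\<forall>n\<ge>N. bs n m = 0" for N m a
  proof -
    have "(\<Sum>n<N. 1 / F m * (bs n m ^ 3 * a)) = (\<Sum>n<N. bs n m ^ 3) * (a / F m)"
      by (simp add: sum_distrib_left sum_distrib_right mult_ac)
    then show ?thesis using Fpos[of m] by (simp flip: F_eq[OF that])
  qed
  show ?thesis
  proof (rule that[OF S]; intro allI ballI impI)
    show "S m m [] vs = 0" for m vs
      by (simp add: S_def T_def local_potential_diag)
    show "dL A S m m [u] [v] = \<omega> m m [u] [v]" if "u \<in> tangent_space A m" "v \<in> tangent_space A m" for m u v
    proof -
      obtain N where N: "\<forall>n\<ge>N. bs n m = 0" using bound by blast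
      show ?thesis
        unfolding dLS[OF N that] unfolding T_def dL_local_potential[OF bump that tf] by (rule weights[OF N])
    qed
    show "conn_form (dL A S) Z X m v = conn_form \<omega> Z X m v"
      if X: "smooth_field_at X m" and Z: "Z m \<in> tangent_space A m" and v: "v \<in> tangent_space A m" for m Z X v
    proof -
      obtain N where N: "\<forall>n\<ge>N. bs n m = 0" using bound by blast
      have sm: "smooth_fun_at (\<lambda>x. dL A (T n) x m [X x] [v]) m" for n
        by (rule biform_smooth_fun_at[OF biform_dL[OF T] UNIV_I X v])
      have "\<forall>\<^sub>F x in nhds m. dL A S x m [X x] [v] = (\<Sum>n<N. 1 / F m * dL A (T n) x m [X x] [v])"
        using smooth_field_at_eventually[OF X] by eventually_elim (rule dLS[OF N _ v])
      then have "conn_form (dL A S) Z X m v = tangent_deriv m (Z m) (\<lambda>x. \<Sum>n<N. 1 / F m * dL A (T n) x m [X x] [v])"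
        unfolding conn_form_def by (rule tangent_deriv_cong)
      also have "\<dots> = (\<Sum>n<N. tangent_deriv m (Z m) (\<lambda>x. 1 / F m * dL A (T n) x m [X x] [v]))"
        by (intro tangent_deriv_sum Z smooth_fun_at_mult smooth_fun_at_const sm)
      also have "\<dots> = (\<Sum>n<N. 1 / F m * conn_form (dL A (T n)) Z X m v)"
        unfolding conn_form_def by (simp only: tangent_deriv_cmult[OF Z sm])
      also have "\<dots> = conn_form \<omega> Z X m v"
        unfolding T_def conn_form_local_potential[where X = X and Z = Z, OF bump X Z v tf] by (rule weights[OF N])
      finally show ?thesis .
    qed
  qed
qed

lemma smat_imp_potential:
  assumes "smat A (induced_metric \<omega>) (induced_connection A \<omega>)"
  shows "\<exists>S. biform A 0 1 UNIV S \<and>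
    contrast_biform A UNIV (dL A S) \<and>
    tensor2_eq A (induced_metric (dL A S)) (induced_metric \<omega>) \<and>
    connection_eq A (induced_connection A (dL A S)) (induced_connection A \<omega>) \<and>
    (\<forall>m. \<forall>v\<in>tangent_space A m. diag_pullback 0 S m [v] = 0)"
proof -
  have tf: "torsion_free A (induced_connection A \<omega>)"
    using assms by (simp add: smat_def)
  obtain S where S: "biform A 0 1 UNIV S" and diag: "\<forall>m vs. S m m [] vs = 0"
    and "\<forall>m. \<forall>u\<in>tangent_space A m. \<forall>v\<in>tangent_space A m. dL A S m m [u] [v] = \<omega> m m [u] [v]"
    and "\<forall>m Z X v. smooth_field_at X m \<longrightarrow> Z m \<in> tangent_space A m \<longrightarrow> v \<in> tangent_space A m \<longrightarrow>
      conn_form (dL A S) Z X m v = conn_form \<omega> Z X m v"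
    using torsion_free_imp_potential[OF tf] .
  note metric = this(3)[rule_format] and conn = this(4)[rule_format]
  have metric': "induced_metric (dL A S) m u v = induced_metric \<omega> m u v"
    if "u \<in> tangent_space A m" "v \<in> tangent_space A m" for m u v
    using metric[OF that] by (simp add: induced_metric_def diag_pullback_def)
  have c: "contrast_biform A UNIV (dL A S)"
    unfolding contrast_biform_def
    using biform_dL[OF S] pseudo_riemannian_cong[OF pseudo_riemannian, of "induced_metric (dL A S)"] metric' by simp
  \<comment> \<open>The connection of \<open>dL A S\<close> is again a definite description. With
    the contrast property at hand, its uniqueness reduces equality of the connections to equality of
    the metrics and of \<open>conn_form\<close>.\<close>
  interpret S: contrast A UNIV "dL A S"
    by unfold_locales (rule c)
  have "induced_connection A (dL A S) Z X m = induced_connection A \<omega> Z X m"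
    if Z: "vector_field A Z" and X: "vector_field A X" for Z X m
  proof (rule S.induced_connection_eqI[OF Z X])
    show T: "induced_connection A \<omega> Z X m \<in> tangent_space A m"
      by (rule vector_field_tangent[OF vector_field_induced_connection[OF Z X]])
    show "conn_form (dL A S) Z X m v = dL A S m m [induced_connection A \<omega> Z X m] [v]"
      if v: "v \<in> tangent_space A m" for v
      using conn[where X = X and Z = Z and m = m, OF vector_field_smooth_field_at[OF X] vector_field_tangent[OF Z] v] metric[OF T v] induced_connection_eq[OF Z X v]
      by simp
  qed
  then have "connection_eq A (induced_connection A (dL A S)) (induced_connection A \<omega>)"
    unfolding connection_eq_def by blast
  moreover have "tensor2_eq A (induced_metric (dL A S)) (induced_metric \<omega>)"
    unfolding tensor2_eq_def using metric' by blast
  moreover have "diag_pullback 0 S m [v] = 0" for m v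
    using diag by (simp add: diag_pullback_def)
  ultimately show ?thesis
    using S c by blast
qed

end

theorem theorem1:
  fixes A :: "('m::{t2_space, second_countable_topology}, 'e::real_inner) chart set"
    and W :: "('m \<times> 'm) set"
    and \<omega> :: "('m, 'e) biform"
  assumes "smooth_manifold A"
    and "contrast_biform A W \<omega>"
  shows "(left_exact A W \<omega> \<longrightarrow> smat A (induced_metric \<omega>) (induced_connection A \<omega>)) \<and>
    (smat A (induced_metric \<omega>) (induced_connection A \<omega>) \<longrightarrow>
      (\<exists>S. biform A 0 1 UNIV S \<and>
           contrast_biform A UNIV (dL A S) \<and>
           tensor2_eq A (induced_metric (dL A S)) (induced_metric \<omega>) \<and>
           connection_eq A (induced_connection A (dL A S)) (induced_connection A \<omega>) \<and>
           (\<forall>m. \<forall>v\<in>tangent_space A m. diag_pullback 0 S m [v] = 0)))"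
proof -
  interpret contrast A W \<omega>
    using assms by unfold_locales
  show ?thesis
    using left_exact_imp_smat smat_imp_potential by blast
qed

end
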